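(* Let $(R,\mathfrak m,\mathsf k)$ be an Artinian local ring with canonical module $\omega$. Let $\mathfrak a$ be a self-dual ideal in $R$ (i.e. $\mathfrak a\simeq\mathfrak a^\vee$ as $R$-modules) such that $(0:_R\mathfrak a)\subseteq\mathfrak a^2$, and let $T$ be an algebra retract of $R$ with respect to $\mathfrak a$. Assume further that $2$ is invertible in $R$. Then $g(R)\leq\lambda(R/\mathfrak a)$.
   Context: All rings are commutative Noetherian with unit; $\lambda$ denotes length (of a ring, as a module over itself). For an Artinian local ring $R$ with residue field $\mathsf k$, the canonical module $\omega$ is the injective hull of $\mathsf k$ over $R$, and $M^\vee:=\mathrm{Hom}_R(M,\omega)$ for an $R$-module $M$. A subring $T$ of $R$ is an algebra retract of $R$ with respect to an ideal $\mathfrak a$ if the composite $T\to R\to R/\mathfrak a$ of the inclusion with the natural projection is an isomorphism. The Gorenstein colength of $R$ is $g(R)=\min\{\lambda(S)-\lambda(R): S\text{ is a Gorenstein Artin local ring with a surjective ring homomorphism } S\to R\}$. No condition is imposed on the embedding dimension of $S$. *)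

theory Defs
  imports "HOL-Library.Extended_Nat" "HOL-Algebra.Module" "HOL-Algebra.Ideal_Product" "HOL-Algebra.QuotRing"
    "HOL-Algebra.Ring_Divisibility" "HOL-Algebra.Subrings"
begin

section \<open>Artinian local rings and length\<close>

text \<open>
  All rings are commutative Noetherian with unit, so Noetherianness is carried along explicitly
  although it follows from the descending chain condition.  The parameter \<open>\<mm>\<close> is the maximal
  ideal; its existence makes the ring nonzero.
\<close>

locale artinian_local_ring = cring R + noetherian_ring R + maximalideal \<mm> R
  for R (structure) and \<mm> +
  assumes descending_chain:
      "\<lbrakk>\<And>n::nat. ideal (I n) R; \<And>n. I (Suc n) \<subseteq> I n\<rbrakk> \<Longrightarrow> \<exists>n. \<forall>k\<ge>n. I k = I n"
    and unique_maximal: "maximalideal J R \<Longrightarrow> J = \<mm>"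

definition ring_length :: "('a, 'm) ring_scheme \<Rightarrow> enat" where
  "ring_length R = Sup {enat n | n. \<exists>I :: nat \<Rightarrow> 'a set.
     (\<forall>i\<le>n. ideal (I i) R) \<and> (\<forall>i<n. I i \<subset> I (Suc i))}"


section \<open>Modules and the canonical module\<close>

definition mod_hom ::
    "('a, 'm) ring_scheme \<Rightarrow> ('a, 'b) module \<Rightarrow> ('a, 'c) module \<Rightarrow> ('b \<Rightarrow> 'c) set" where
  "mod_hom R M N = {f \<in> carrier M \<rightarrow> carrier N.
     (\<forall>x\<in>carrier M. \<forall>y\<in>carrier M. f (x \<oplus>\<^bsub>M\<^esub> y) = f x \<oplus>\<^bsub>N\<^esub> f y) \<and>
     (\<forall>r\<in>carrier R. \<forall>x\<in>carrier M. f (r \<odot>\<^bsub>M\<^esub> x) = r \<odot>\<^bsub>N\<^esub> f x)}"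

definition mod_iso ::
    "('a, 'm) ring_scheme \<Rightarrow> ('a, 'b) module \<Rightarrow> ('a, 'c) module \<Rightarrow> bool" where
  "mod_iso R M N \<longleftrightarrow> (\<exists>f\<in>mod_hom R M N. bij_betw f (carrier M) (carrier N))"

text \<open>
  The fields \<^term>\<open>monoid.mult\<close> and \<^term>\<open>monoid.one\<close> of a module record are
  irrelevant.  Elements of the Hom module are extensional, so that equal homomorphisms are equal as functions on the whole type.
\<close>

definition Hom_module ::
    "('a, 'm) ring_scheme \<Rightarrow> ('a, 'b) module \<Rightarrow> ('a, 'c) module \<Rightarrow> ('a, 'b \<Rightarrow> 'c) module" where
  "Hom_module R M N =
     \<lparr>carrier = mod_hom R M N \<inter> extensional (carrier M),
      monoid.mult = undefined, monoid.one = undefined,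
      ring.zero = (\<lambda>x\<in>carrier M. \<zero>\<^bsub>N\<^esub>),
      ring.add = (\<lambda>f g. \<lambda>x\<in>carrier M. f x \<oplus>\<^bsub>N\<^esub> g x),
      smult = (\<lambda>r f. \<lambda>x\<in>carrier M. r \<odot>\<^bsub>N\<^esub> f x)\<rparr>"

definition ideal_module :: "('a, 'm) ring_scheme \<Rightarrow> 'a set \<Rightarrow> ('a, 'a) module" where
  "ideal_module R I =
     \<lparr>carrier = I, monoid.mult = monoid.mult R, monoid.one = \<one>\<^bsub>R\<^esub>,
      ring.zero = \<zero>\<^bsub>R\<^esub>, ring.add = ring.add R, smult = monoid.mult R\<rparr>"

abbreviation regular_module :: "('a, 'm) ring_scheme \<Rightarrow> ('a, 'a) module" where
  "regular_module R \<equiv> ideal_module R (carrier R)"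

definition quotient_module :: "('a, 'm) ring_scheme \<Rightarrow> 'a set \<Rightarrow> ('a, 'a set) module" where
  "quotient_module R I =
     \<lparr>carrier = carrier (R Quot I), monoid.mult = monoid.mult (R Quot I),
      monoid.one = \<one>\<^bsub>R Quot I\<^esub>, ring.zero = \<zero>\<^bsub>R Quot I\<^esub>,
      ring.add = ring.add (R Quot I),
      smult = (\<lambda>r X. (I +>\<^bsub>R\<^esub> r) \<otimes>\<^bsub>R Quot I\<^esub> X)\<rparr>"

text \<open>
  A definition cannot quantify over modules on all types.  The test modules below live on the type
  of the ring elements; \<open>injective_module_extension\<close> shows that the extension property then holds
  for modules on arbitrary types.
\<close>

definition injective_module :: "('a, 'm) ring_scheme \<Rightarrow> ('a, 'b) module \<Rightarrow> bool" where
  "injective_module R E \<longleftrightarrow> module R E \<and>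
     (\<forall>(M :: ('a, 'a) module) (N :: ('a, 'a) module) i g.
        module R M \<and> module R N \<and> i \<in> mod_hom R M N \<and> inj_on i (carrier M) \<and>
        g \<in> mod_hom R M E \<longrightarrow>
        (\<exists>h\<in>mod_hom R N E. \<forall>x\<in>carrier M. h (i x) = g x))"

definition injective_hull ::
    "('a, 'm) ring_scheme \<Rightarrow> ('a, 'b) module \<Rightarrow> ('a, 'c) module \<Rightarrow> bool" where
  "injective_hull R M E \<longleftrightarrow> injective_module R E \<and>
     (\<exists>i\<in>mod_hom R M E. inj_on i (carrier M) \<and>
        (\<forall>N. submodule N R E \<and> N \<noteq> {\<zero>\<^bsub>E\<^esub>} \<longrightarrow> N \<inter> i ` carrier M \<noteq> {\<zero>\<^bsub>E\<^esub>}))"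

definition canonical_module :: "('a, 'm) ring_scheme \<Rightarrow> 'a set \<Rightarrow> ('a, 'b) module \<Rightarrow> bool" where
  "canonical_module R \<mm> \<omega> \<longleftrightarrow> injective_hull R (quotient_module R \<mm>) \<omega>"


section \<open>Self-dual ideals and algebra retracts\<close>

definition self_dual_ideal ::
    "('a, 'm) ring_scheme \<Rightarrow> ('a, 'b) module \<Rightarrow> 'a set \<Rightarrow> bool" where
  "self_dual_ideal R \<omega> \<aa> \<longleftrightarrow> ideal \<aa> R \<and>
     mod_iso R (ideal_module R \<aa>) (Hom_module R (ideal_module R \<aa>) \<omega>)"

definition annihilator :: "('a, 'm) ring_scheme \<Rightarrow> 'a set \<Rightarrow> 'a set" where
  "annihilator R \<aa> = {r \<in> carrier R. \<forall>x\<in>\<aa>. r \<otimes>\<^bsub>R\<^esub> x = \<zero>\<^bsub>R\<^esub>}"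

definition algebra_retract :: "('a, 'm) ring_scheme \<Rightarrow> 'a set \<Rightarrow> 'a set \<Rightarrow> bool" where
  "algebra_retract R \<aa> T \<longleftrightarrow> subring T R \<and>
     (\<lambda>t. \<aa> +>\<^bsub>R\<^esub> t) \<in> ring_iso (R\<lparr>carrier := T\<rparr>) (R Quot \<aa>)"


section \<open>Gorenstein colength\<close>

text \<open>An Artinian local ring is Gorenstein if it is its own canonical module.\<close>

definition gorenstein_artinian_local :: "('a, 'm) ring_scheme \<Rightarrow> bool" where
  "gorenstein_artinian_local S \<longleftrightarrow>
     (\<exists>\<nn>. artinian_local_ring S \<nn> \<and> canonical_module S \<nn> (regular_module S))"

text \<open>
  The rings \<open>S\<close> range over rings whose elements are lists of elements of \<open>R\<close>.  This loses nothing: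
  an Artinian local ring mapping onto \<open>R\<close> has the same residue field as \<open>R\<close> and a finite filtration
  by ideals with simple quotients, so its elements can be encoded by such lists, see
  \<open>artinian_local_cover_list_coding\<close>.  The infimum is taken in \<^typ>\<open>enat\<close>, where that of the
  empty set is infinite.
\<close>

definition gorenstein_colength :: "('a, 'm) ring_scheme \<Rightarrow> enat" where
  "gorenstein_colength R =
     Inf {ring_length S - ring_length R | S :: 'a list ring.
       gorenstein_artinian_local S \<and> (\<exists>h\<in>ring_hom S R. h ` carrier S = carrier R)}"


section \<open>The type restrictions lose nothing\<close>

lemma mod_homD:
  assumes "f \<in> mod_hom R M N"
  shows "x \<in> carrier M \<Longrightarrow> f x \<in> carrier N"
    and "x \<in> carrier M \<Longrightarrow> y \<in> carrier M \<Longrightarrow> f (x \<oplus>\<^bsub>M\<^esub> y) = f x \<oplus>\<^bsub>N\<^esub> f y"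
    and "r \<in> carrier R \<Longrightarrow> x \<in> carrier M \<Longrightarrow> f (r \<odot>\<^bsub>M\<^esub> x) = r \<odot>\<^bsub>N\<^esub> f x"
  using assms by (auto simp: mod_hom_def)

lemma ideal_module_is_module:
  assumes "cring R" "ideal I R"
  shows "module R (ideal_module R I)"
proof -
  interpret cring R by fact
  interpret I: ideal I R by fact
  have sub: "\<And>x. x \<in> I \<Longrightarrow> x \<in> carrier R" using I.a_subset by auto
  show ?thesis
  proof (rule moduleI)
    show "abelian_group (ideal_module R I)"
    proof (rule abelian_groupI)
      fix x assume "x \<in> carrier (ideal_module R I)"
      then have x: "x \<in> I" by (simp add: ideal_module_def)
      then have "\<ominus>\<^bsub>R\<^esub> x \<oplus>\<^bsub>R\<^esub> x = \<zero>\<^bsub>R\<^esub>" using sub l_neg by blast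
      with x show "\<exists>y\<in>carrier (ideal_module R I).
          y \<oplus>\<^bsub>ideal_module R I\<^esub> x = \<zero>\<^bsub>ideal_module R I\<^esub>"
        unfolding ideal_module_def using I.a_inv_closed by auto
    qed (auto simp: ideal_module_def sub a_ac intro!: I.a_closed)
  qed (auto simp: ideal_module_def sub l_distr r_distr m_assoc is_cring I.I_l_closed)
qed

theorem injective_module_extension:
  fixes R :: "('a, 'm) ring_scheme" and E :: "('a, 'b) module"
    and M :: "('a, 'c) module" and N :: "('a, 'd) module"
  assumes inj: "injective_module R E" and M: "module R M" and N: "module R N"
    and i: "i \<in> mod_hom R M N" "inj_on i (carrier M)" and g: "g \<in> mod_hom R M E"
  shows "\<exists>h\<in>mod_hom R N E. \<forall>x\<in>carrier M. h (i x) = g x"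
proof -
  interpret M: module R M by fact
  interpret N: module R N by fact
  interpret E: module R E using inj by (simp add: injective_module_def)
  define G0 where "G0 = (\<lambda>x. (i x, g x)) ` carrier M"
  define P where "P = (\<lambda>G. G \<subseteq> carrier N \<times> carrier E \<and> G0 \<subseteq> G \<and> single_valued G \<and>
     (\<forall>u v u' v'. (u, v) \<in> G \<longrightarrow> (u', v') \<in> G \<longrightarrow> (u \<oplus>\<^bsub>N\<^esub> u', v \<oplus>\<^bsub>E\<^esub> v') \<in> G) \<and>
     (\<forall>r u v. r \<in> carrier R \<longrightarrow> (u, v) \<in> G \<longrightarrow> (r \<odot>\<^bsub>N\<^esub> u, r \<odot>\<^bsub>E\<^esub> v) \<in> G))"
  have PG0: "P G0"
    unfolding P_def
  proof (intro conjI allI impI)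
    show "G0 \<subseteq> carrier N \<times> carrier E"
      using mod_homD(1)[OF i(1)] mod_homD(1)[OF g] by (auto simp: G0_def)
    show "single_valued G0"
      using i(2) by (auto simp: G0_def single_valued_def inj_on_def)
  next
    fix u v u' v' assume "(u, v) \<in> G0" "(u', v') \<in> G0"
    then obtain x x' where "x \<in> carrier M" "x' \<in> carrier M"
      "u = i x" "v = g x" "u' = i x'" "v' = g x'" by (auto simp: G0_def)
    then show "(u \<oplus>\<^bsub>N\<^esub> u', v \<oplus>\<^bsub>E\<^esub> v') \<in> G0"
      using mod_homD(2)[OF i(1)] mod_homD(2)[OF g]
      by (auto simp: G0_def intro!: image_eqI[where x = "x \<oplus>\<^bsub>M\<^esub> x'"])
  next
    fix r u v assume r: "r \<in> carrier R" and "(u, v) \<in> G0"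
    then obtain x where "x \<in> carrier M" "u = i x" "v = g x" by (auto simp: G0_def)
    then show "(r \<odot>\<^bsub>N\<^esub> u, r \<odot>\<^bsub>E\<^esub> v) \<in> G0"
      using r mod_homD(3)[OF i(1)] mod_homD(3)[OF g]
      by (auto simp: G0_def intro!: image_eqI[where x = "r \<odot>\<^bsub>M\<^esub> x"])
  qed auto
  have "\<exists>G\<in>{G. P G}. \<forall>X\<in>{G. P G}. G \<subseteq> X \<longrightarrow> X = G"
  proof (rule subset_Zorn_nonempty)
    show "{G. P G} \<noteq> {}" using PG0 by auto
  next
    fix \<C> assume ne: "\<C> \<noteq> {}" and ch: "subset.chain {G. P G} \<C>"
    have PC: "P X" if "X \<in> \<C>" for X using ch that by (auto simp: subset_chain_def)
    have lin: "X \<subseteq> Y \<or> Y \<subseteq> X" if "X \<in> \<C>" "Y \<in> \<C>" for X Y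
      using ch that by (auto simp: subset_chain_def)
    have common: "\<exists>Z\<in>\<C>. p \<in> Z \<and> q \<in> Z" if "p \<in> \<Union>\<C>" "q \<in> \<Union>\<C>" for p q
      using that lin by (meson UnionE subsetD)
    have "P (\<Union>\<C>)"
      unfolding P_def
    proof (intro conjI allI impI)
      show "\<Union>\<C> \<subseteq> carrier N \<times> carrier E" using PC unfolding P_def by blast
      show "G0 \<subseteq> \<Union>\<C>" using PC ne unfolding P_def by blast
      show "single_valued (\<Union>\<C>)"
      proof (rule single_valuedI)
        fix x y z assume "(x, y) \<in> \<Union>\<C>" "(x, z) \<in> \<Union>\<C>"
        then obtain Z where "Z \<in> \<C>" "(x, y) \<in> Z" "(x, z) \<in> Z" using common by meson
        then show "y = z" using PC[of Z] unfolding P_def single_valued_def by blast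
      qed
    next
      fix u v u' v' assume "(u, v) \<in> \<Union>\<C>" "(u', v') \<in> \<Union>\<C>"
      then obtain Z where "Z \<in> \<C>" "(u, v) \<in> Z" "(u', v') \<in> Z" using common by meson
      then show "(u \<oplus>\<^bsub>N\<^esub> u', v \<oplus>\<^bsub>E\<^esub> v') \<in> \<Union>\<C>"
        using PC[of Z] unfolding P_def by blast
    next
      fix r u v assume "r \<in> carrier R" "(u, v) \<in> \<Union>\<C>"
      then show "(r \<odot>\<^bsub>N\<^esub> u, r \<odot>\<^bsub>E\<^esub> v) \<in> \<Union>\<C>"
        using PC unfolding P_def by blast
    qed
    then show "\<Union>\<C> \<in> {G. P G}" by simp
  qed
  then obtain G where PG: "P G" and max: "\<And>X. P X \<Longrightarrow> G \<subseteq> X \<Longrightarrow> X = G" by blast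
  from PG have Gsub: "\<And>u v. (u, v) \<in> G \<Longrightarrow> u \<in> carrier N \<and> v \<in> carrier E"
    and G0G: "G0 \<subseteq> G" and sv: "\<And>u v v'. (u, v) \<in> G \<Longrightarrow> (u, v') \<in> G \<Longrightarrow> v = v'"
    and Gadd: "\<And>u v u' v'. (u, v) \<in> G \<Longrightarrow> (u', v') \<in> G \<Longrightarrow> (u \<oplus>\<^bsub>N\<^esub> u', v \<oplus>\<^bsub>E\<^esub> v') \<in> G"
    and Gsm: "\<And>r u v. r \<in> carrier R \<Longrightarrow> (u, v) \<in> G \<Longrightarrow> (r \<odot>\<^bsub>N\<^esub> u, r \<odot>\<^bsub>E\<^esub> v) \<in> G"
    unfolding P_def single_valued_def by blast+
  have Gz: "(\<zero>\<^bsub>N\<^esub>, \<zero>\<^bsub>E\<^esub>) \<in> G"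
  proof -
    have "(i \<zero>\<^bsub>M\<^esub>, g \<zero>\<^bsub>M\<^esub>) \<in> G" using G0G by (auto simp: G0_def)
    from Gsm[OF _ this, of "\<zero>\<^bsub>R\<^esub>"] Gsub[OF this] show ?thesis by simp
  qed
  have Gneg: "(\<ominus>\<^bsub>N\<^esub> u, \<ominus>\<^bsub>E\<^esub> v) \<in> G" if "(u, v) \<in> G" for u v
    using Gsm[OF _ that, of "\<ominus>\<^bsub>R\<^esub> \<one>\<^bsub>R\<^esub>"] Gsub[OF that]
    by (simp add: N.smult_l_minus E.smult_l_minus)
  have total: "\<exists>v. (y, v) \<in> G" if y: "y \<in> carrier N" for y
  proof -
    define I where "I = {r \<in> carrier R. \<exists>v. (r \<odot>\<^bsub>N\<^esub> y, v) \<in> G}"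
    define \<phi> where "\<phi> = (\<lambda>r. THE v. (r \<odot>\<^bsub>N\<^esub> y, v) \<in> G)"
    have \<phi>: "\<phi> r = v" if "(r \<odot>\<^bsub>N\<^esub> y, v) \<in> G" for r v
      unfolding \<phi>_def using that sv by blast
    have \<phi>G: "(r \<odot>\<^bsub>N\<^esub> y, \<phi> r) \<in> G" if "r \<in> I" for r
      using that \<phi> by (auto simp: I_def)
    have IR: "r \<in> carrier R" if "r \<in> I" for r using that by (simp add: I_def)
    have Iadd: "(((r \<oplus>\<^bsub>R\<^esub> s) \<odot>\<^bsub>N\<^esub> y), \<phi> r \<oplus>\<^bsub>E\<^esub> \<phi> s) \<in> G" if "r \<in> I" "s \<in> I" for r s
      using Gadd[OF \<phi>G \<phi>G] that IR y by (simp add: N.smult_l_distr)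
    have Ism: "((s \<otimes>\<^bsub>R\<^esub> r) \<odot>\<^bsub>N\<^esub> y, s \<odot>\<^bsub>E\<^esub> \<phi> r) \<in> G"
      if "r \<in> I" "s \<in> carrier R" for r s
      using Gsm[OF that(2) \<phi>G[OF that(1)]] that IR y by (simp add: N.smult_assoc1)
    have idI: "ideal I R"
    proof (rule idealI[OF M.R.ring_axioms])
      show "subgroup I (add_monoid R)"
      proof (rule subgroup.intro)
        fix x assume x: "x \<in> I"
        have "((\<ominus>\<^bsub>R\<^esub> x) \<odot>\<^bsub>N\<^esub> y, \<ominus>\<^bsub>E\<^esub> \<phi> x) \<in> G"
          using Gneg[OF \<phi>G[OF x]] IR[OF x] y by (simp add: N.smult_l_minus)
        then show "inv\<^bsub>add_monoid R\<^esub> x \<in> I"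
          using IR[OF x] M.R.a_inv_closed unfolding I_def a_inv_def by auto
      qed (use Gz y Iadd in \<open>auto simp: I_def\<close>)
      fix a x assume a: "a \<in> I" and x: "x \<in> carrier R"
      show "x \<otimes>\<^bsub>R\<^esub> a \<in> I" using Ism[OF a x] IR[OF a] x by (auto simp: I_def)
      then show "a \<otimes>\<^bsub>R\<^esub> x \<in> I" using IR[OF a] x by (simp add: M.R.m_comm)
    qed
    have "\<phi> \<in> mod_hom R (ideal_module R I) E"
      using \<phi>G Gsub \<phi>[OF Iadd] \<phi>[OF Ism] by (auto simp: mod_hom_def ideal_module_def)
    moreover have "(\<lambda>x. x) \<in> mod_hom R (ideal_module R I) (regular_module R)"
      using IR by (auto simp: mod_hom_def ideal_module_def)
    moreover have "module R (ideal_module R I)" "module R (regular_module R)"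
      using ideal_module_is_module[OF M.R.is_cring] idI M.R.oneideal by auto
    ultimately have "\<exists>h\<in>mod_hom R (regular_module R) E.
        \<forall>x\<in>carrier (ideal_module R I). h x = \<phi> x"
      using inj unfolding injective_module_def by (metis inj_on_id2)
    then obtain \<psi> where \<psi>: "\<psi> \<in> mod_hom R (regular_module R) E"
      and \<psi>\<phi>: "\<And>r. r \<in> I \<Longrightarrow> \<psi> r = \<phi> r" by (auto simp: ideal_module_def)
    define e where "e = \<psi> \<one>\<^bsub>R\<^esub>"
    have e: "e \<in> carrier E"
      unfolding e_def using mod_homD(1)[OF \<psi>, of "\<one>\<^bsub>R\<^esub>"] by (simp add: ideal_module_def)
    have \<psi>e: "\<psi> r = r \<odot>\<^bsub>E\<^esub> e" if "r \<in> carrier R" for r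
      unfolding e_def using mod_homD(3)[OF \<psi>, of r "\<one>\<^bsub>R\<^esub>"] that by (simp add: ideal_module_def)
    define G' where "G' = {(u \<oplus>\<^bsub>N\<^esub> r \<odot>\<^bsub>N\<^esub> y, v \<oplus>\<^bsub>E\<^esub> r \<odot>\<^bsub>E\<^esub> e) | u v r. (u, v) \<in> G \<and> r \<in> carrier R}"
    have GG': "G \<subseteq> G'"
    proof
      fix p assume "p \<in> G"
      moreover obtain u v where "p = (u, v)" by force
      ultimately show "p \<in> G'"
        using Gsub[of u v] y e unfolding G'_def
        by (auto intro!: exI[of _ u] exI[of _ v] exI[of _ "\<zero>\<^bsub>R\<^esub>"])
    qed
    have "P G'"
      unfolding P_def
    proof (intro conjI allI impI)
      show "G' \<subseteq> carrier N \<times> carrier E" using Gsub y e by (auto simp: G'_def)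
      show "G0 \<subseteq> G'" using G0G GG' by auto
      show "single_valued G'"
      proof (rule single_valuedI)
        fix x z z' assume "(x, z) \<in> G'" "(x, z') \<in> G'"
        then obtain u v r u' v' r' where 1: "(u, v) \<in> G" "(u', v') \<in> G"
          "r \<in> carrier R" "r' \<in> carrier R"
          and x: "x = u \<oplus>\<^bsub>N\<^esub> r \<odot>\<^bsub>N\<^esub> y" "x = u' \<oplus>\<^bsub>N\<^esub> r' \<odot>\<^bsub>N\<^esub> y"
          and z: "z = v \<oplus>\<^bsub>E\<^esub> r \<odot>\<^bsub>E\<^esub> e" "z' = v' \<oplus>\<^bsub>E\<^esub> r' \<odot>\<^bsub>E\<^esub> e"
          by (auto simp: G'_def)
        have c: "u \<in> carrier N" "v \<in> carrier E" "u' \<in> carrier N" "v' \<in> carrier E"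
          using 1 Gsub by auto
        define d where "d = r \<oplus>\<^bsub>R\<^esub> \<ominus>\<^bsub>R\<^esub> r'"
        have d: "d \<in> carrier R" using 1 by (simp add: d_def)
        have dy: "d \<odot>\<^bsub>N\<^esub> y = r \<odot>\<^bsub>N\<^esub> y \<oplus>\<^bsub>N\<^esub> \<ominus>\<^bsub>N\<^esub> (r' \<odot>\<^bsub>N\<^esub> y)"
          using 1 y by (simp add: d_def N.smult_l_distr N.smult_l_minus)
        have de: "d \<odot>\<^bsub>E\<^esub> e = r \<odot>\<^bsub>E\<^esub> e \<oplus>\<^bsub>E\<^esub> \<ominus>\<^bsub>E\<^esub> (r' \<odot>\<^bsub>E\<^esub> e)"
          using 1 e by (simp add: d_def E.smult_l_distr E.smult_l_minus)
        have "u' \<oplus>\<^bsub>N\<^esub> \<ominus>\<^bsub>N\<^esub> u = d \<odot>\<^bsub>N\<^esub> y"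
        proof -
          have "u' = u \<oplus>\<^bsub>N\<^esub> (r \<odot>\<^bsub>N\<^esub> y \<oplus>\<^bsub>N\<^esub> \<ominus>\<^bsub>N\<^esub> (r' \<odot>\<^bsub>N\<^esub> y))"
          proof -
            have "u' = (u' \<oplus>\<^bsub>N\<^esub> r' \<odot>\<^bsub>N\<^esub> y) \<oplus>\<^bsub>N\<^esub> \<ominus>\<^bsub>N\<^esub> (r' \<odot>\<^bsub>N\<^esub> y)"
              using c 1 y by (simp add: N.M.a_assoc N.M.r_neg)
            also have "\<dots> = (u \<oplus>\<^bsub>N\<^esub> r \<odot>\<^bsub>N\<^esub> y) \<oplus>\<^bsub>N\<^esub> \<ominus>\<^bsub>N\<^esub> (r' \<odot>\<^bsub>N\<^esub> y)"
              using x by simp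
            finally show ?thesis using c 1 y by (simp add: N.M.a_assoc)
          qed
          then show ?thesis
            using c 1 y d dy by (simp add: N.M.a_ac N.M.r_neg2)
        qed
        moreover have "(u' \<oplus>\<^bsub>N\<^esub> \<ominus>\<^bsub>N\<^esub> u, v' \<oplus>\<^bsub>E\<^esub> \<ominus>\<^bsub>E\<^esub> v) \<in> G"
          using 1 Gadd Gneg by blast
        ultimately have dG: "(d \<odot>\<^bsub>N\<^esub> y, v' \<oplus>\<^bsub>E\<^esub> \<ominus>\<^bsub>E\<^esub> v) \<in> G" by simp
        then have "d \<in> I" using d by (auto simp: I_def)
        then have eq: "d \<odot>\<^bsub>E\<^esub> e = v' \<oplus>\<^bsub>E\<^esub> \<ominus>\<^bsub>E\<^esub> v"
          using \<psi>\<phi> \<psi>e[OF d] \<phi>[OF dG] by simp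
        have "v \<oplus>\<^bsub>E\<^esub> r \<odot>\<^bsub>E\<^esub> e = v \<oplus>\<^bsub>E\<^esub> (d \<odot>\<^bsub>E\<^esub> e \<oplus>\<^bsub>E\<^esub> r' \<odot>\<^bsub>E\<^esub> e)"
          using de c 1 e by (simp add: E.M.a_assoc E.M.l_neg)
        also have "\<dots> = v' \<oplus>\<^bsub>E\<^esub> r' \<odot>\<^bsub>E\<^esub> e"
          using c 1 e by (simp add: eq E.M.a_ac E.M.r_neg2)
        finally show "z = z'" using z by simp
      qed
    next
      fix a b a' b' assume "(a, b) \<in> G'" "(a', b') \<in> G'"
      then obtain u v r u' v' r' where 1: "(u, v) \<in> G" "(u', v') \<in> G"
        "r \<in> carrier R" "r' \<in> carrier R"
        and a: "a = u \<oplus>\<^bsub>N\<^esub> r \<odot>\<^bsub>N\<^esub> y" "a' = u' \<oplus>\<^bsub>N\<^esub> r' \<odot>\<^bsub>N\<^esub> y"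
        and b: "b = v \<oplus>\<^bsub>E\<^esub> r \<odot>\<^bsub>E\<^esub> e" "b' = v' \<oplus>\<^bsub>E\<^esub> r' \<odot>\<^bsub>E\<^esub> e"
        by (auto simp: G'_def)
      have c: "u \<in> carrier N" "v \<in> carrier E" "u' \<in> carrier N" "v' \<in> carrier E"
        using 1 Gsub by auto
      have "a \<oplus>\<^bsub>N\<^esub> a' = (u \<oplus>\<^bsub>N\<^esub> u') \<oplus>\<^bsub>N\<^esub> (r \<oplus>\<^bsub>R\<^esub> r') \<odot>\<^bsub>N\<^esub> y"
        using 1 c a y by (simp add: N.smult_l_distr N.M.a_ac)
      moreover have "b \<oplus>\<^bsub>E\<^esub> b' = (v \<oplus>\<^bsub>E\<^esub> v') \<oplus>\<^bsub>E\<^esub> (r \<oplus>\<^bsub>R\<^esub> r') \<odot>\<^bsub>E\<^esub> e"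
        using 1 c b e by (simp add: E.smult_l_distr E.M.a_ac)
      moreover have "(u \<oplus>\<^bsub>N\<^esub> u', v \<oplus>\<^bsub>E\<^esub> v') \<in> G" "r \<oplus>\<^bsub>R\<^esub> r' \<in> carrier R"
        using 1 Gadd by auto
      ultimately show "(a \<oplus>\<^bsub>N\<^esub> a', b \<oplus>\<^bsub>E\<^esub> b') \<in> G'"
        unfolding G'_def by blast
    next
      fix s a b assume s: "s \<in> carrier R" and "(a, b) \<in> G'"
      then obtain u v r where 1: "(u, v) \<in> G" "r \<in> carrier R"
        and a: "a = u \<oplus>\<^bsub>N\<^esub> r \<odot>\<^bsub>N\<^esub> y" and b: "b = v \<oplus>\<^bsub>E\<^esub> r \<odot>\<^bsub>E\<^esub> e"
        by (auto simp: G'_def)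
      have c: "u \<in> carrier N" "v \<in> carrier E" using 1 Gsub by auto
      have "s \<odot>\<^bsub>N\<^esub> a = s \<odot>\<^bsub>N\<^esub> u \<oplus>\<^bsub>N\<^esub> (s \<otimes>\<^bsub>R\<^esub> r) \<odot>\<^bsub>N\<^esub> y"
        using 1 c a y s by (simp add: N.smult_r_distr N.smult_assoc1)
      moreover have "s \<odot>\<^bsub>E\<^esub> b = s \<odot>\<^bsub>E\<^esub> v \<oplus>\<^bsub>E\<^esub> (s \<otimes>\<^bsub>R\<^esub> r) \<odot>\<^bsub>E\<^esub> e"
        using 1 c b e s by (simp add: E.smult_r_distr E.smult_assoc1)
      moreover have "(s \<odot>\<^bsub>N\<^esub> u, s \<odot>\<^bsub>E\<^esub> v) \<in> G" "s \<otimes>\<^bsub>R\<^esub> r \<in> carrier R"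
        using 1 Gsm s by auto
      ultimately show "(s \<odot>\<^bsub>N\<^esub> a, s \<odot>\<^bsub>E\<^esub> b) \<in> G'"
        unfolding G'_def by blast
    qed
    then have "G' = G" using max GG' by blast
    moreover have "(\<zero>\<^bsub>N\<^esub> \<oplus>\<^bsub>N\<^esub> \<one>\<^bsub>R\<^esub> \<odot>\<^bsub>N\<^esub> y, \<zero>\<^bsub>E\<^esub> \<oplus>\<^bsub>E\<^esub> \<one>\<^bsub>R\<^esub> \<odot>\<^bsub>E\<^esub> e) \<in> G'"
      unfolding G'_def using Gz by blast
    ultimately show ?thesis using y by auto
  qed
  define h where "h = (\<lambda>y. THE v. (y, v) \<in> G)"
  have hI: "h y = v" if "(y, v) \<in> G" for y v
    unfolding h_def using that sv by blast
  have hG: "(y, h y) \<in> G" if "y \<in> carrier N" for y using total[OF that] hI by auto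
  have "h \<in> mod_hom R N E"
    unfolding mod_hom_def using hG Gsub hI[OF Gadd[OF hG hG]] hI[OF Gsm[OF _ hG]] by auto
  moreover have "h (i x) = g x" if "x \<in> carrier M" for x
    using G0G that by (intro hI) (auto simp: G0_def)
  ultimately show ?thesis by blast
qed

lemma (in noetherian_ring) ideal_family_has_maximal:
  assumes "F \<noteq> {}" "\<And>I. I \<in> F \<Longrightarrow> ideal I R"
  shows "\<exists>I\<in>F. \<forall>J\<in>F. I \<subseteq> J \<longrightarrow> J = I"
proof (rule subset_Zorn_nonempty)
  fix \<C> assume ne: "\<C> \<noteq> {}" and ch: "subset.chain F \<C>"
  then have "subset.chain {I. ideal I R} \<C>"
    using assms(2) by (auto simp: subset_chain_def)
  from ideal_chain_is_trivial[OF ne this] show "\<Union>\<C> \<in> F"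
    using ch by (auto simp: subset_chain_def)
qed fact

lemma (in artinian_local_ring) unit_if_not_in_maximal:
  assumes s: "s \<in> carrier R" "s \<notin> \<mm>"
  shows "s \<in> Units R"
proof (rule ccontr)
  assume nu: "s \<notin> Units R"
  define F where "F = {I. ideal I R \<and> s \<in> I \<and> I \<noteq> carrier R}"
  have "\<one> \<notin> PIdl s"
  proof
    assume "\<one> \<in> PIdl s"
    then obtain x where x: "x \<in> carrier R" "x \<otimes> s = \<one>" unfolding cgenideal_def by auto
    moreover have "s \<otimes> x = \<one>" using m_comm[OF s(1) x(1)] x(2) by (rule trans)
    ultimately have "s \<in> Units R" using s(1) unfolding Units_def by blast
    with nu show False ..
  qed
  then have "PIdl s \<in> F"
    using s cgenideal_ideal cgenideal_self by (auto simp: F_def)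
  then have "\<exists>I\<in>F. \<forall>J\<in>F. I \<subseteq> J \<longrightarrow> J = I"
    by (intro ideal_family_has_maximal) (auto simp: F_def)
  then obtain M where M: "M \<in> F" and max: "\<forall>J\<in>F. M \<subseteq> J \<longrightarrow> J = M" by blast
  have "maximalideal M R"
  proof (rule maximalidealI)
    show "ideal M R" "carrier R \<noteq> M" using M by (auto simp: F_def)
    fix J assume J: "ideal J R" "M \<subseteq> J"
    then have "J \<in> F" if "J \<noteq> carrier R" using M that by (auto simp: F_def)
    then show "J = M \<or> J = carrier R" using max J by blast
  qed
  then have "M = \<mm>" by (rule unique_maximal)
  with M s show False by (simp add: F_def)
qed

theorem artinian_local_cover_list_coding:
  fixes S :: "('s, 'n) ring_scheme" and R :: "('a, 'm) ring_scheme"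
  assumes S: "artinian_local_ring S \<nn>" and R: "ring R" "\<one>\<^bsub>R\<^esub> \<noteq> \<zero>\<^bsub>R\<^esub>"
    and h: "h \<in> ring_hom S R" "h ` carrier S = carrier R"
  shows "\<exists>f :: 's \<Rightarrow> 'a list. inj_on f (carrier S)"
proof -
  interpret S: artinian_local_ring S \<nn> by fact
  interpret R: ring R by fact
  interpret h: ring_hom_ring S R h
    by (rule ring_hom_ringI2) (use S.ring_axioms R.ring_axioms h in auto)
  have ker: "k \<in> \<nn>" if k: "k \<in> carrier S" "h k = \<zero>\<^bsub>R\<^esub>" for k
  proof (rule ccontr)
    assume "k \<notin> \<nn>"
    then have "k \<in> Units S" using S.unit_if_not_in_maximal k by blast
    then obtain l where l: "l \<in> carrier S" "l \<otimes>\<^bsub>S\<^esub> k = \<one>\<^bsub>S\<^esub>" by (auto simp: Units_def)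
    then have "\<one>\<^bsub>R\<^esub> = h l \<otimes>\<^bsub>R\<^esub> h k" using k by (metis h.hom_mult h.hom_one)
    then show False using k l R by simp
  qed
  define sec where "sec = (\<lambda>b. SOME s. s \<in> carrier S \<and> h s = b)"
  have sec: "sec b \<in> carrier S" "h (sec b) = b" if "b \<in> carrier R" for b
  proof -
    have "b \<in> h ` carrier S" unfolding h(2) by (rule that)
    then have "\<exists>s. s \<in> carrier S \<and> h s = b" by blast
    from someI_ex[OF this] show "sec b \<in> carrier S" "h (sec b) = b" by (auto simp: sec_def)
  qed
  define Q where "Q = (\<lambda>J. \<exists>f :: 's \<Rightarrow> 'a list. inj_on f J)"
  have step: "\<exists>J'. ideal J' S \<and> J' \<subset> J \<and> \<not> Q J'" if J: "ideal J S" "\<not> Q J" for J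
  proof -
    interpret J: ideal J S by fact
    have Jc: "\<And>z. z \<in> J \<Longrightarrow> z \<in> carrier S" using J.a_subset by auto
    have "J \<noteq> {\<zero>\<^bsub>S\<^esub>}" using J(2) by (auto simp: Q_def)
    define F where "F = {I. ideal I S \<and> I \<subset> J}"
    have "{\<zero>\<^bsub>S\<^esub>} \<in> F"
      using \<open>J \<noteq> {\<zero>\<^bsub>S\<^esub>}\<close> S.zeroideal J.zero_closed by (auto simp: F_def)
    then have "\<exists>I\<in>F. \<forall>J\<in>F. I \<subseteq> J \<longrightarrow> J = I"
      by (intro S.ideal_family_has_maximal) (auto simp: F_def)
    then obtain J' where "J' \<in> F" and maxF: "\<forall>I\<in>F. J' \<subseteq> I \<longrightarrow> I = J'" by blast
    then have J': "ideal J' S" "J' \<subset> J" by (simp_all add: F_def)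
    have max: "I = J'" if "ideal I S" "I \<subset> J" "J' \<subseteq> I" for I
      using maxF that by (simp add: F_def)
    interpret J': ideal J' S by fact
    have J'c: "\<And>z. z \<in> J' \<Longrightarrow> z \<in> carrier S" using J'.a_subset by auto
    obtain x where x: "x \<in> J" "x \<notin> J'" using J' by auto
    have xc: "x \<in> carrier S" using x Jc by simp
    have gen: "\<exists>j\<in>J'. \<exists>r\<in>carrier S. z = j \<oplus>\<^bsub>S\<^esub> r \<otimes>\<^bsub>S\<^esub> y"
      if y: "y \<in> J" "y \<notin> J'" and z: "z \<in> J" for y z
    proof -
      define K where "K = J' <+>\<^bsub>S\<^esub> PIdl\<^bsub>S\<^esub> y"
      have yc: "y \<in> carrier S" using y Jc by simp
      have Kmem: "\<And>w. w \<in> K \<longleftrightarrow> (\<exists>j\<in>J'. \<exists>r\<in>carrier S. w = j \<oplus>\<^bsub>S\<^esub> r \<otimes>\<^bsub>S\<^esub> y)"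
        by (auto simp: K_def set_add_def' cgenideal_def)
      have "ideal K S"
        unfolding K_def using J'(1) S.cgenideal_ideal[OF yc] by (rule S.add_ideals)
      moreover have "K \<subseteq> J"
      proof
        fix w assume "w \<in> K"
        then obtain j r where jr: "j \<in> J'" "r \<in> carrier S" and w: "w = j \<oplus>\<^bsub>S\<^esub> r \<otimes>\<^bsub>S\<^esub> y"
          using Kmem by blast
        have "j \<in> J" using jr J'(2) by blast
        moreover have "r \<otimes>\<^bsub>S\<^esub> y \<in> J" using y(1) jr(2) by (rule J.I_l_closed)
        ultimately show "w \<in> J" unfolding w by (rule J.a_closed)
      qed
      moreover have "J' \<subseteq> K"
      proof
        fix w assume w: "w \<in> J'"
        have "w = w \<oplus>\<^bsub>S\<^esub> \<zero>\<^bsub>S\<^esub> \<otimes>\<^bsub>S\<^esub> y" using J'c[OF w] yc by simp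
        then show "w \<in> K" using w S.zero_closed Kmem by blast
      qed
      moreover have "y \<in> K"
      proof -
        have "y = \<zero>\<^bsub>S\<^esub> \<oplus>\<^bsub>S\<^esub> \<one>\<^bsub>S\<^esub> \<otimes>\<^bsub>S\<^esub> y" using yc by simp
        then show ?thesis using J'.zero_closed S.one_closed Kmem by blast
      qed
      ultimately have "K = J" using max[of K] y(2) by blast
      then show ?thesis using z Kmem by blast
    qed
    have nx: "n \<otimes>\<^bsub>S\<^esub> x \<in> J'" if n: "n \<in> \<nn>" for n
    proof (rule ccontr)
      assume no: "n \<otimes>\<^bsub>S\<^esub> x \<notin> J'"
      have nc: "n \<in> carrier S" using n S.a_subset by auto
      have "n \<otimes>\<^bsub>S\<^esub> x \<in> J" using nc x J.I_l_closed by simp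
      then obtain j r where j: "j \<in> J'" and r: "r \<in> carrier S"
        and eq: "x = j \<oplus>\<^bsub>S\<^esub> r \<otimes>\<^bsub>S\<^esub> (n \<otimes>\<^bsub>S\<^esub> x)"
        using gen[OF _ no x(1)] by blast
      define u where "u = \<one>\<^bsub>S\<^esub> \<ominus>\<^bsub>S\<^esub> r \<otimes>\<^bsub>S\<^esub> n"
      have uc: "u \<in> carrier S" using r nc by (simp add: u_def)
      have "u \<otimes>\<^bsub>S\<^esub> x = x \<ominus>\<^bsub>S\<^esub> r \<otimes>\<^bsub>S\<^esub> (n \<otimes>\<^bsub>S\<^esub> x)"
        using r nc xc by (simp add: u_def S.minus_eq S.l_distr S.l_minus S.m_assoc)
      also have "\<dots> = (j \<oplus>\<^bsub>S\<^esub> r \<otimes>\<^bsub>S\<^esub> (n \<otimes>\<^bsub>S\<^esub> x)) \<ominus>\<^bsub>S\<^esub> r \<otimes>\<^bsub>S\<^esub> (n \<otimes>\<^bsub>S\<^esub> x)"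
        by (rule arg_cong[OF eq, of "\<lambda>t. t \<ominus>\<^bsub>S\<^esub> r \<otimes>\<^bsub>S\<^esub> (n \<otimes>\<^bsub>S\<^esub> x)"])
      also have "\<dots> = j"
        using J'c[OF j] r nc xc by (simp add: S.minus_eq S.a_assoc S.r_neg)
      finally have ux: "u \<otimes>\<^bsub>S\<^esub> x = j" .
      have "u \<notin> \<nn>"
      proof
        assume "u \<in> \<nn>"
        then have "u \<oplus>\<^bsub>S\<^esub> r \<otimes>\<^bsub>S\<^esub> n \<in> \<nn>" using S.I_l_closed[OF n r] by (rule S.a_closed)
        moreover have "u \<oplus>\<^bsub>S\<^esub> r \<otimes>\<^bsub>S\<^esub> n = \<one>\<^bsub>S\<^esub>"
          using r nc by (simp add: u_def S.minus_eq S.a_assoc S.l_neg)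
        ultimately show False using S.one_imp_carrier S.I_notcarr by simp
      qed
      then have "u \<in> Units S" using uc S.unit_if_not_in_maximal by blast
      then obtain v where v: "v \<in> carrier S" "v \<otimes>\<^bsub>S\<^esub> u = \<one>\<^bsub>S\<^esub>" by (auto simp: Units_def)
      have "x = v \<otimes>\<^bsub>S\<^esub> (u \<otimes>\<^bsub>S\<^esub> x)"
        using v uc xc by (simp flip: S.m_assoc)
      also have "\<dots> \<in> J'" unfolding ux using j v(1) by (rule J'.I_l_closed)
      finally show False using x by simp
    qed
    have "\<forall>z\<in>J. \<exists>b j. j \<in> J' \<and> z = j \<oplus>\<^bsub>S\<^esub> sec b \<otimes>\<^bsub>S\<^esub> x"
    proof
      fix z assume "z \<in> J"
      then obtain j r where j: "j \<in> J'" and r: "r \<in> carrier S" and z: "z = j \<oplus>\<^bsub>S\<^esub> r \<otimes>\<^bsub>S\<^esub> x"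
        using gen[OF x] by blast
      have s: "sec (h r) \<in> carrier S" "h (sec (h r)) = h r" using sec r by auto
      define n where "n = r \<ominus>\<^bsub>S\<^esub> sec (h r)"
      have nc: "n \<in> carrier S" using r s by (simp add: n_def)
      have "h n = \<zero>\<^bsub>R\<^esub>" using r s by (simp add: n_def S.minus_eq R.r_neg)
      then have nJ: "n \<otimes>\<^bsub>S\<^esub> x \<in> J'" using ker nx nc by blast
      have rn: "r = n \<oplus>\<^bsub>S\<^esub> sec (h r)"
        unfolding n_def using r s(1) by (simp add: S.minus_eq S.a_assoc S.l_neg)
      have "z = j \<oplus>\<^bsub>S\<^esub> (n \<oplus>\<^bsub>S\<^esub> sec (h r)) \<otimes>\<^bsub>S\<^esub> x"
        unfolding z by (rule arg_cong[OF rn, of "\<lambda>t. j \<oplus>\<^bsub>S\<^esub> t \<otimes>\<^bsub>S\<^esub> x"])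
      also have "\<dots> = (j \<oplus>\<^bsub>S\<^esub> n \<otimes>\<^bsub>S\<^esub> x) \<oplus>\<^bsub>S\<^esub> sec (h r) \<otimes>\<^bsub>S\<^esub> x"
        using J'c[OF j] nc s xc by (simp add: S.l_distr S.a_assoc)
      finally show "\<exists>b j. j \<in> J' \<and> z = j \<oplus>\<^bsub>S\<^esub> sec b \<otimes>\<^bsub>S\<^esub> x"
        using J'.a_closed[OF j nJ] by blast
    qed
    then obtain B K where BK: "\<forall>z\<in>J. K z \<in> J' \<and> z = K z \<oplus>\<^bsub>S\<^esub> sec (B z) \<otimes>\<^bsub>S\<^esub> x"
      by metis
    have KJ: "K z \<in> J'" if "z \<in> J" for z using BK that by blast
    have decode: "K z \<oplus>\<^bsub>S\<^esub> sec (B z) \<otimes>\<^bsub>S\<^esub> x = z" if "z \<in> J" for z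
      using BK that by (metis (no_types))
    have "\<not> Q J'"
    proof
      assume "Q J'"
      then obtain f :: "'s \<Rightarrow> 'a list" where f: "inj_on f J'" by (auto simp: Q_def)
      have "inj_on (\<lambda>z. B z # f (K z)) J"
      proof (rule inj_onI)
        fix z z' assume z: "z \<in> J" "z' \<in> J" and eq: "B z # f (K z) = B z' # f (K z')"
        have B: "B z = B z'" using eq by simp
        have K: "K z = K z'" using eq inj_onD[OF f _ KJ[OF z(1)] KJ[OF z(2)]] by simp
        have "z = K z' \<oplus>\<^bsub>S\<^esub> sec (B z') \<otimes>\<^bsub>S\<^esub> x"
          using decode[OF z(1), symmetric] unfolding B K .
        also note decode[OF z(2)]
        finally show "z = z'" .
      qed
      then show False using J(2) unfolding Q_def by blast
    qed
    with J' show ?thesis by blast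
  qed
  have "Q (carrier S)"
  proof (rule ccontr)
    assume nQ: "\<not> Q (carrier S)"
    have "\<exists>I :: nat \<Rightarrow> 's set. \<forall>n. (ideal (I n) S \<and> \<not> Q (I n)) \<and> I (Suc n) \<subset> I n"
      by (rule dependent_nat_choice) (use nQ S.oneideal step in blast)+
    then obtain I :: "nat \<Rightarrow> 's set" where I: "\<And>n. ideal (I n) S" "\<And>n. I (Suc n) \<subset> I n"
      by blast
    have "\<exists>n. \<forall>k\<ge>n. I k = I n"
    proof (rule S.descending_chain)
      show "ideal (I n) S" for n by (rule I(1))
      show "I (Suc n) \<subseteq> I n" for n using I(2)[of n] by (rule psubset_imp_subset)
    qed
    then obtain n where n: "\<forall>k\<ge>n. I k = I n" by blast
    have "I (Suc n) = I n" by (rule n[rule_format]) simp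
    with I(2)[of n] show False by simp
  qed
  then show ?thesis by (simp add: Q_def)
qed

end

theory Submission
  imports Defs "HOL-Algebra.Weak_Morphisms"
begin

text \<open>
  Write \<open>\<tau>\<close> for the retraction of \<open>R\<close> onto \<open>T\<close> along \<open>\<aa>\<close>, put \<open>\<alpha> r = r - \<tau> r \<in> \<aa>\<close>, and let \<open>E\<close> be the
  submodule of \<open>\<omega>\<close> killed by \<open>\<aa>\<close>, which is the canonical module of \<open>T\<close>.  Self-duality of \<open>\<aa>\<close>
  provides a nondegenerate bilinear form \<open>\<aa> \<times> \<aa> \<rightarrow> \<omega>\<close>; as \<open>2\<close> is invertible and \<open>(0 : \<aa>) \<subseteq> \<aa>\<^sup>2\<close>, it
  may be replaced by a symmetric one, \<open>B\<close>.  Composing with a \<open>T\<close>-linear retraction \<open>\<pi>: \<omega> \<rightarrow> E\<close> gives a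
  symmetric cocycle \<open>\<beta>(r, s) = \<pi> (B (\<alpha> r) (\<alpha> s))\<close>, and \<open>S = R \<times> E\<close> with
  \<open>(r, e)(s, d) = (rs, rd + se + \<beta>(r, s))\<close> is a local ring mapping onto \<open>R\<close> with kernel \<open>E\<close>.  The
  projection \<open>\<Lambda>: S \<rightarrow> E\<close> makes \<open>(s, t) \<mapsto> \<Lambda>(st)\<close> nondegenerate, so \<open>S\<close> embeds into the injective
  \<open>S\<close>-module \<open>Hom\<^sub>T(S, E)\<close>.  The latter has a simple socle, hence all its endomorphisms are
  multiplications by elements of \<open>S\<close>, which forces the embedding to be onto; thus \<open>S\<close> is Gorenstein.
  Finally, annihilators turn strict chains of submodules of \<open>E\<close> into strict chains of ideals
  containing \<open>\<aa>\<close>, so the length of \<open>E\<close> is at most that of \<open>R/\<aa>\<close>.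
\<close>

section \<open>Lengths of chains\<close>

text \<open>A \<open>T\<close>-module is treated as an \<open>R\<close>-module, through
  \<open>\<tau>\<close> or because \<open>\<aa>\<close> kills it; so Hom over \<open>T\<close> into
  \<open>E\<close> becomes Hom over \<open>R\<close> into \<open>\<omega>\<close>, and every
  extension of homomorphisms comes from injectivity of \<open>\<omega>\<close>. The map
  \<open>\<pi>\<close> is needed because the form takes values in \<open>\<omega>\<close>, while the
  new kernel must be killed by \<open>\<aa>\<close>. It costs no nondegeneracy: a nonzero value of
  the form has the socle generator \<open>w0\<close> as a multiple, and \<open>w0\<close> lies in
  \<open>E\<close>, which \<open>\<pi>\<close> fixes. Symmetry serves commutativity and also
  associativity, since it makes B(xy, z) symmetric in all three arguments. The usual count, that
  \<open>S\<close> and its dual have equal length, is avoided: it needs additivity of length,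
  whereas only upper bounds for chains are proved here, and these suffice for the theorem. A further
  obstacle is the type: the colength ranges over rings of lists, while \<open>S\<close> consists of
  pairs. Everything about \<open>S\<close> is therefore derived from a few conditions on
  \<open>p\<close>, \<open>\<rho>\<close> and \<open>\<Lambda>\<close> that survive transport along
  an injection.\<close>

definition chains_bounded :: "'s set set \<Rightarrow> nat \<Rightarrow> bool" where
  "chains_bounded C N \<longleftrightarrow>
     (\<forall>n F. (\<forall>i\<le>n. F i \<in> C) \<and> (\<forall>i<n. F i \<subset> F (Suc i)) \<longrightarrow> n \<le> N)"

text \<open>Dropping repetitions from a weak chain keeps all of its strict steps. The clause
  \<open>G k = F n\<close> is what the induction needs in order to append the next set.\<close>

lemma strict_subchain:
  fixes F :: "nat \<Rightarrow> 's set"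
  assumes "\<And>i. i < n \<Longrightarrow> F i \<subseteq> F (Suc i)"
  defines "k \<equiv> card {i. i < n \<and> F i \<noteq> F (Suc i)}"
  shows "\<exists>G. (\<forall>i\<le>k. G i \<in> F ` {..n}) \<and> (\<forall>i<k. G i \<subset> G (Suc i)) \<and> G k = F n"
  using assms(1) unfolding k_def
proof (induction n)
  case 0
  show ?case by (intro exI[of _ F]) auto
next
  case (Suc n)
  define k where "k = card {i. i < n \<and> F i \<noteq> F (Suc i)}"
  have prem: "F i \<subseteq> F (Suc i)" if "i < n" for i
    using Suc.prems[of i] that by simp
  obtain G where G: "\<And>i. i \<le> k \<Longrightarrow> G i \<in> F ` {..n}" "\<And>i. i < k \<Longrightarrow> G i \<subset> G (Suc i)" "G k = F n"
    using Suc.IH[OF prem] unfolding k_def[symmetric] by blast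
  show ?case
  proof (cases "F n = F (Suc n)")
    case True
    then have "{i. i < Suc n \<and> F i \<noteq> F (Suc i)} = {i. i < n \<and> F i \<noteq> F (Suc i)}"
      by (auto simp: less_Suc_eq)
    then have c: "card {i. i < Suc n \<and> F i \<noteq> F (Suc i)} = k"
      by (simp add: k_def)
    show ?thesis
      unfolding c using G True by (intro exI[of _ G]) (auto simp: atMost_Suc)
  next
    case False
    then have "{i. i < Suc n \<and> F i \<noteq> F (Suc i)} = insert n {i. i < n \<and> F i \<noteq> F (Suc i)}"
      by (auto simp: less_Suc_eq)
    then have c: "card {i. i < Suc n \<and> F i \<noteq> F (Suc i)} = Suc k"
      by (simp add: k_def)
    have "F n \<subset> F (Suc n)" using False Suc.prems[of n] by auto
    then show ?thesis
      unfolding c using G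
      by (intro exI[of _ "G(Suc k := F (Suc n))"]) (auto simp: le_Suc_eq less_Suc_eq atMost_Suc)
  qed
qed

text \<open>Monotone maps send strict chains to weak ones only, so the bound is needed for the
  number of genuine steps.\<close>

lemma chains_boundedD_weak:
  assumes "chains_bounded C N" "\<And>i. i \<le> n \<Longrightarrow> F i \<in> C" "\<And>i. i < n \<Longrightarrow> F i \<subseteq> F (Suc i)"
  shows "card {i. i < n \<and> F i \<noteq> F (Suc i)} \<le> N"
proof -
  let ?k = "card {i. i < n \<and> F i \<noteq> F (Suc i)}"
  obtain G where "\<forall>i\<le>?k. G i \<in> F ` {..n}" "\<forall>i<?k. G i \<subset> G (Suc i)"
    using strict_subchain[of n F] assms(3) by blast
  moreover from this(1) assms(2) have "\<forall>i\<le>?k. G i \<in> C" by auto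
  ultimately show ?thesis using assms(1) unfolding chains_bounded_def by blast
qed

text \<open>Subadditivity of length without quotient modules: \<open>f\<close> stands for the
  intersection with a kernel and \<open>g\<close> for the image, and each strict step is visible in
  at least one of them.\<close>

lemma chains_bounded_add:
  assumes A: "chains_bounded A a" and B: "chains_bounded B b"
    and f: "\<And>K. K \<in> C \<Longrightarrow> f K \<in> A" "\<And>K L. K \<in> C \<Longrightarrow> L \<in> C \<Longrightarrow> K \<subseteq> L \<Longrightarrow> f K \<subseteq> f L"
    and g: "\<And>K. K \<in> C \<Longrightarrow> g K \<in> B" "\<And>K L. K \<in> C \<Longrightarrow> L \<in> C \<Longrightarrow> K \<subseteq> L \<Longrightarrow> g K \<subseteq> g L"
    and strict: "\<And>K L. K \<in> C \<Longrightarrow> L \<in> C \<Longrightarrow> K \<subset> L \<Longrightarrow> f K \<noteq> f L \<or> g K \<noteq> g L"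
  shows "chains_bounded C (a + b)"
  unfolding chains_bounded_def
proof (intro allI impI, elim conjE)
  fix n F assume F: "\<forall>i\<le>n. F i \<in> C" "\<forall>i<n. F i \<subset> F (Suc i)"
  let ?X = "{i. i < n \<and> f (F i) \<noteq> f (F (Suc i))}" and ?Y = "{i. i < n \<and> g (F i) \<noteq> g (F (Suc i))}"
  have "{..<n} \<subseteq> ?X \<union> ?Y" using strict F by fastforce
  then have "card {..<n} \<le> card (?X \<union> ?Y)" by (intro card_mono) auto
  also have "\<dots> \<le> card ?X + card ?Y" by (rule card_Un_le)
  also have "card ?X \<le> a"
    using F f by (intro chains_boundedD_weak[OF A, of n "\<lambda>i. f (F i)"]) (simp_all add: psubset_imp_subset)
  also have "card ?Y \<le> b"
    using F g by (intro chains_boundedD_weak[OF B, of n "\<lambda>i. g (F i)"]) (simp_all add: psubset_imp_subset)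
  finally show "n \<le> a + b" by simp
qed

lemma chains_bounded_antimono:
  assumes A: "chains_bounded A a" and f: "\<And>K. K \<in> C \<Longrightarrow> f K \<in> A"
    and strict: "\<And>K L. K \<in> C \<Longrightarrow> L \<in> C \<Longrightarrow> K \<subset> L \<Longrightarrow> f L \<subset> f K"
  shows "chains_bounded C a"
  unfolding chains_bounded_def
proof (intro allI impI, elim conjE)
  fix n F assume F: "\<forall>i\<le>n. F i \<in> C" "\<forall>i<n. F i \<subset> F (Suc i)"
  \<comment> \<open>Read backwards, the images form an increasing chain again.\<close>
  have "f (F (n - i)) \<subset> f (F (n - Suc i))" if "i < n" for i
  proof -
    have "Suc (n - Suc i) = n - i" "n - Suc i < n" using that by auto
    then show ?thesis using F strict by (metis diff_le_self)
  qed
  moreover have "f (F (n - i)) \<in> A" for i using F f by simp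
  ultimately show "n \<le> a"
    using A[unfolded chains_bounded_def, rule_format, of n "\<lambda>i. f (F (n - i))"] by blast
qed

text \<open>The number of strict steps before \<open>n\<close> is bounded by \<open>N\<close>
  uniformly in \<open>n\<close>, so there are only finitely many strict steps in all.\<close>

lemma chains_bounded_stationary:
  assumes C: "chains_bounded C N" and I: "\<And>n. I n \<in> C"
    and mono: "(\<forall>n. I n \<subseteq> I (Suc n)) \<or> (\<forall>n. I (Suc n) \<subseteq> I n)"
  shows "\<exists>n. \<forall>k\<ge>n. I k = I n"
proof -
  let ?X = "{i. I i \<noteq> I (Suc i)}"
  have bound: "card {i. i < n \<and> I i \<noteq> I (Suc i)} \<le> N" for n
    using mono
  proof
    assume "\<forall>n. I n \<subseteq> I (Suc n)"
    then show ?thesis using I by (intro chains_boundedD_weak[OF C, of n I]) auto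
  next
    assume dec: "\<forall>n. I (Suc n) \<subseteq> I n"
    let ?J = "\<lambda>i. I (n - i)"
    have step: "Suc (n - Suc i) = n - i" if "i < n" for i using that by simp
    have "card {i. i < n \<and> ?J i \<noteq> ?J (Suc i)} \<le> N"
    proof (rule chains_boundedD_weak[OF C])
      show "I (n - i) \<in> C" for i by (rule I)
      show "I (n - i) \<subseteq> I (n - Suc i)" if "i < n" for i
        using dec[rule_format, of "n - Suc i"] step[OF that] by simp
    qed
    \<comment> \<open>The step from \<open>I i\<close> to \<open>I (Suc i)\<close> is step number
      \<open>n - Suc i\<close> of the reversed chain \<open>?J\<close>.\<close>
    moreover have "card {i. i < n \<and> I i \<noteq> I (Suc i)} \<le> card {i. i < n \<and> ?J i \<noteq> ?J (Suc i)}"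
    proof (rule card_inj_on_le[of "\<lambda>i. n - Suc i"])
      show "inj_on (\<lambda>i. n - Suc i) {i. i < n \<and> I i \<noteq> I (Suc i)}" by (auto simp: inj_on_def)
      show "(\<lambda>i. n - Suc i) ` {i. i < n \<and> I i \<noteq> I (Suc i)} \<subseteq> {i. i < n \<and> ?J i \<noteq> ?J (Suc i)}"
        by (auto simp: Suc_diff_Suc)
    qed simp
    ultimately show ?thesis by simp
  qed
  have "finite ?X"
  proof (rule ccontr)
    assume "infinite ?X"
    then obtain Y where Y: "Y \<subseteq> ?X" "finite Y" "card Y = Suc N"
      using infinite_arbitrarily_large by blast
    obtain n where "\<forall>i\<in>Y. i < n" using Y(2) finite_nat_set_iff_bounded by blast
    then have "card Y \<le> card {i. i < n \<and> I i \<noteq> I (Suc i)}"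
      using Y(1) by (intro card_mono) auto
    with bound[of n] Y(3) show False by simp
  qed
  then obtain n where "\<forall>i\<in>?X. i < n" using finite_nat_set_iff_bounded by blast
  then have n: "I (Suc i) = I i" if "n \<le> i" for i using that by (force simp: not_less)
  have "I k = I n" if "n \<le> k" for k
    using that by (induction k rule: dec_induct) (use n in auto)
  then show ?thesis by blast
qed

lemma ring_length_le_iff: "ring_length R \<le> enat N \<longleftrightarrow> chains_bounded {I. ideal I R} N"
proof -
  have eq: "(\<forall>a\<in>{enat n | n. P n}. a \<le> enat N) \<longleftrightarrow> (\<forall>n. P n \<longrightarrow> n \<le> N)" for P
    by auto
  have "ring_length R \<le> enat N \<longleftrightarrow>
      (\<forall>n. (\<exists>I. (\<forall>i\<le>n. ideal (I i) R) \<and> (\<forall>i<n. I i \<subset> I (Suc i))) \<longrightarrow> n \<le> N)"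
    unfolding ring_length_def Sup_le_iff eq ..
  then show ?thesis unfolding chains_bounded_def by blast
qed

section \<open>Artinian local rings\<close>

lemma (in noetherian_ring) ideal_predicate_has_maximal:
  assumes "P I0" "\<And>I. P I \<Longrightarrow> ideal I R"
  shows "\<exists>I. P I \<and> (\<forall>J. P J \<longrightarrow> I \<subseteq> J \<longrightarrow> J = I)"
proof -
  have "\<exists>I\<in>Collect P. \<forall>J\<in>Collect P. I \<subseteq> J \<longrightarrow> J = I"
  proof (rule ideal_family_has_maximal)
    show "Collect P \<noteq> {}" using assms(1) by blast
    show "ideal I R" if "I \<in> Collect P" for I using that by (intro assms(2)) simp
  qed
  then show ?thesis by simp
qed

lemma (in cring) mem_add_PIdl:
  assumes "x \<in> carrier R"
  shows "z \<in> I <+>\<^bsub>R\<^esub> PIdl x \<longleftrightarrow> (\<exists>j\<in>I. \<exists>r\<in>carrier R. z = j \<oplus> r \<otimes> x)"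
  by (auto simp: set_add_def' cgenideal_def)

lemma (in cring) ideal_add_PIdl:
  assumes I: "ideal I R" and x: "x \<in> carrier R"
  shows "ideal (I <+>\<^bsub>R\<^esub> PIdl x) R" "I \<subseteq> I <+>\<^bsub>R\<^esub> PIdl x" "x \<in> I <+>\<^bsub>R\<^esub> PIdl x"
    and "\<And>J. ideal J R \<Longrightarrow> I \<subseteq> J \<Longrightarrow> x \<in> J \<Longrightarrow> I <+>\<^bsub>R\<^esub> PIdl x \<subseteq> J"
proof -
  interpret I: ideal I R by fact
  show "ideal (I <+>\<^bsub>R\<^esub> PIdl x) R" using I cgenideal_ideal[OF x] by (rule add_ideals)
  show "I \<subseteq> I <+>\<^bsub>R\<^esub> PIdl x"
  proof
    fix j assume j: "j \<in> I"
    have "j = j \<oplus> \<zero> \<otimes> x" using j I.a_subset x by auto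
    then show "j \<in> I <+>\<^bsub>R\<^esub> PIdl x" using j unfolding mem_add_PIdl[OF x] by blast
  qed
  have "x = \<zero> \<oplus> \<one> \<otimes> x" using x by simp
  then show "x \<in> I <+>\<^bsub>R\<^esub> PIdl x" using I.zero_closed unfolding mem_add_PIdl[OF x] by blast
  fix J assume J: "ideal J R" "I \<subseteq> J" "x \<in> J"
  interpret J: ideal J R by fact
  show "I <+>\<^bsub>R\<^esub> PIdl x \<subseteq> J"
  proof
    fix z assume "z \<in> I <+>\<^bsub>R\<^esub> PIdl x"
    then obtain j r where "j \<in> I" "r \<in> carrier R" "z = j \<oplus> r \<otimes> x"
      unfolding mem_add_PIdl[OF x] by blast
    then show "z \<in> J" using J(2,3) J.I_l_closed J.a_closed by blast
  qed
qed

context artinian_local_ring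
begin

lemma ideal_family_has_minimal:
  assumes "P I0" "\<And>I. P I \<Longrightarrow> ideal I R"
  shows "\<exists>I. P I \<and> (\<forall>J. P J \<longrightarrow> J \<subseteq> I \<longrightarrow> J = I)"
proof (rule ccontr)
  assume no: "\<not> ?thesis"
  then have step: "\<exists>J. P J \<and> J \<subset> I" if "P I" for I using that by blast
  have "\<exists>I :: nat \<Rightarrow> 'a set. \<forall>n. P (I n) \<and> I (Suc n) \<subset> I n"
  proof (rule dependent_nat_choice)
    show "\<exists>I. P I" using assms(1) by (rule exI)
    show "\<exists>J. P J \<and> J \<subset> I" if "P I" for I n using step[OF that] .
  qed
  then obtain I :: "nat \<Rightarrow> 'a set" where I: "\<And>n. P (I n)" "\<And>n. I (Suc n) \<subset> I n"
    by blast
  have "\<exists>n. \<forall>k\<ge>n. I k = I n"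
  proof (rule descending_chain)
    show "ideal (I n) R" for n using I(1) by (rule assms(2))
    show "I (Suc n) \<subseteq> I n" for n using I(2) by (rule psubset_imp_subset)
  qed
  then obtain n where n: "\<forall>k\<ge>n. I k = I n" by blast
  have "I (Suc n) = I n" by (rule n[rule_format]) simp
  with I(2)[of n] show False by simp
qed

lemma unit_inverse:
  assumes "s \<in> carrier R" "s \<notin> \<mm>"
  obtains v where "v \<in> carrier R" "v \<otimes> s = \<one>"
  using unit_if_not_in_maximal[OF assms] by (auto simp: Units_def)

lemma one_notin_maximal: "\<one> \<notin> \<mm>"
  using one_imp_carrier I_notcarr by blast

lemma one_minus_notin_maximal:
  assumes "r \<in> carrier R" "y \<in> \<mm>"
  shows "\<one> \<ominus> r \<otimes> y \<notin> \<mm>"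
proof
  assume *: "\<one> \<ominus> r \<otimes> y \<in> \<mm>"
  have y: "y \<in> carrier R" using assms a_subset by auto
  have "(\<one> \<ominus> r \<otimes> y) \<oplus> r \<otimes> y \<in> \<mm>" using * I_l_closed[OF assms(2,1)] by (rule a_closed)
  moreover have "(\<one> \<ominus> r \<otimes> y) \<oplus> r \<otimes> y = \<one>"
    using assms y by (simp add: minus_eq a_assoc l_neg)
  ultimately show False using one_notin_maximal by simp
qed

text \<open>Take \<open>x\<close> in an ideal \<open>J\<close> minimal among those strictly above
  \<open>I\<close>. If \<open>y \<otimes> x\<close> were outside \<open>I\<close>, it would generate
  \<open>J\<close> over \<open>I\<close>, so
  \<open>x = j \<oplus> r \<otimes> (y \<otimes> x)\<close> with \<open>j \<in> I\<close>, and the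
  unit \<open>\<one> \<ominus> r \<otimes> y\<close> would carry \<open>x\<close> into
  \<open>I\<close>.\<close>

lemma exists_socle_mod:
  assumes I: "ideal I R" "I \<noteq> carrier R"
  shows "\<exists>x\<in>carrier R - I. \<forall>y\<in>\<mm>. y \<otimes> x \<in> I"
proof -
  interpret I: ideal I R by fact
  have "I \<subset> carrier R" using I(2) I.a_subset by auto
  with oneideal have "ideal (carrier R) R \<and> I \<subset> carrier R" ..
  then have "\<exists>J. (ideal J R \<and> I \<subset> J) \<and> (\<forall>K. ideal K R \<and> I \<subset> K \<longrightarrow> K \<subseteq> J \<longrightarrow> K = J)"
    by (rule ideal_family_has_minimal[OF _ conjunct1])
  then obtain J where J: "ideal J R" "I \<subset> J"
    and min: "\<And>K. ideal K R \<and> I \<subset> K \<Longrightarrow> K \<subseteq> J \<Longrightarrow> K = J"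
    by blast
  interpret J: ideal J R by fact
  obtain x where x: "x \<in> J" "x \<notin> I" using J by auto
  have xc: "x \<in> carrier R" using x J.a_subset by auto
  have "y \<otimes> x \<in> I" if y: "y \<in> \<mm>" for y
  proof (rule ccontr)
    assume n: "y \<otimes> x \<notin> I"
    have yc: "y \<in> carrier R" using y a_subset by auto
    have yx: "y \<otimes> x \<in> carrier R" "y \<otimes> x \<in> J" using yc xc x J.I_l_closed by auto
    note K = ideal_add_PIdl[OF I(1) yx(1)]
    have "I <+>\<^bsub>R\<^esub> PIdl (y \<otimes> x) = J"
      using K n J yx by (intro min) blast+
    then obtain j r where j: "j \<in> I" and r: "r \<in> carrier R" and eq: "x = j \<oplus> r \<otimes> (y \<otimes> x)"
      using x(1) mem_add_PIdl[OF yx(1)] by blast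
    have jc: "j \<in> carrier R" using j I.a_subset by auto
    have "(\<one> \<ominus> r \<otimes> y) \<otimes> x = x \<ominus> r \<otimes> (y \<otimes> x)"
      using r yc xc by (simp add: minus_eq l_distr l_minus m_assoc)
    also have "\<dots> = (j \<oplus> r \<otimes> (y \<otimes> x)) \<ominus> r \<otimes> (y \<otimes> x)"
      by (rule arg_cong[OF eq, of "\<lambda>t. t \<ominus> r \<otimes> (y \<otimes> x)"])
    also have "\<dots> = j" using jc r yx by (simp add: minus_eq a_assoc r_neg)
    finally have ux: "(\<one> \<ominus> r \<otimes> y) \<otimes> x = j" .
    obtain v where v: "v \<in> carrier R" "v \<otimes> (\<one> \<ominus> r \<otimes> y) = \<one>"
      using unit_inverse[OF _ one_minus_notin_maximal[OF r y]] r yc by auto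
    have "x = v \<otimes> ((\<one> \<ominus> r \<otimes> y) \<otimes> x)"
      using v r yc xc by (simp flip: m_assoc)
    also have "\<dots> \<in> I" unfolding ux using j v(1) by (rule I.I_l_closed)
    finally show False using x by simp
  qed
  then show ?thesis using xc x by blast
qed

text \<open>The descending chain condition gives an ideal \<open>J\<close> minimal among those with
  unbounded chains below them. The ascending one gives \<open>K\<close> maximal strictly inside
  \<open>J\<close>, and the simple quotient \<open>J/K\<close> adds only one step to a bound for
  \<open>K\<close>.\<close>

lemma finite_length: "\<exists>N. chains_bounded {I. ideal I R} N"
proof -
  define Q where "Q = (\<lambda>J. \<exists>N. chains_bounded {I. ideal I R \<and> I \<subseteq> J} N)"
  have step: "Q J" if J: "ideal J R" and IH: "\<And>K. ideal K R \<Longrightarrow> K \<subset> J \<Longrightarrow> Q K" for J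
  proof (cases "J = {\<zero>}")
    case True
    have "F 0 = {\<zero>} \<and> F (Suc 0) = {\<zero>}"
      if "\<forall>i\<le>n. F i \<in> {I. ideal I R \<and> I \<subseteq> J}" "0 < n" for F and n :: nat
    proof -
      have "ideal (F 0) R" "F 0 \<subseteq> {\<zero>}" "ideal (F (Suc 0)) R" "F (Suc 0) \<subseteq> {\<zero>}"
        using that True by auto
      then show ?thesis
        using additive_subgroup.zero_closed ideal.axioms(1) by blast
    qed
    then have "chains_bounded {I. ideal I R \<and> I \<subseteq> J} 0"
      unfolding chains_bounded_def by (metis bot_nat_0.not_eq_extremum le_refl psubset_eq)
    then show ?thesis unfolding Q_def by blast
  next
    case False
    interpret J: ideal J R by fact
    have "{\<zero>} \<subset> J" using J.zero_closed False by auto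
    with zeroideal have "ideal {\<zero>} R \<and> {\<zero>} \<subset> J" ..
    then have "\<exists>K. (ideal K R \<and> K \<subset> J) \<and> (\<forall>L. ideal L R \<and> L \<subset> J \<longrightarrow> K \<subseteq> L \<longrightarrow> L = K)"
      by (rule ideal_predicate_has_maximal[OF _ conjunct1])
    then obtain K where K: "ideal K R" "K \<subset> J"
      and max: "\<And>L. ideal L R \<and> L \<subset> J \<Longrightarrow> K \<subseteq> L \<Longrightarrow> L = K"
      by blast
    obtain N where N: "chains_bounded {I. ideal I R \<and> I \<subseteq> K} N"
      using IH[OF K] unfolding Q_def by blast
    have two: "chains_bounded {K, J} 1"
      unfolding chains_bounded_def
    proof (intro allI impI, elim conjE, rule ccontr)
      fix n F assume F: "\<forall>i\<le>n. F i \<in> {K, J}" "\<forall>i<n. F i \<subset> F (Suc i)" and "\<not> n \<le> 1"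
      then have "F 0 \<in> {K, J}" "F 1 \<in> {K, J}" "F 2 \<in> {K, J}" "F 0 \<subset> F 1" "F 1 \<subset> F 2"
        by (auto simp: numeral_2_eq_2)
      then show False using K by auto
    qed
    \<comment> \<open>The map \<open>g\<close> takes the place of the sum of \<open>I\<close> with
      \<open>K\<close>: as \<open>J/K\<close> is simple, that sum can only be \<open>K\<close> or
      \<open>J\<close>.\<close>
    have "chains_bounded {I. ideal I R \<and> I \<subseteq> J} (N + 1)"
    proof (rule chains_bounded_add[OF N two, where f = "\<lambda>I. I \<inter> K" and g = "\<lambda>I. if I \<subseteq> K then K else J"])
      fix A B assume A: "A \<in> {I. ideal I R \<and> I \<subseteq> J}" and B: "B \<in> {I. ideal I R \<and> I \<subseteq> J}" and AB: "A \<subset> B"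
      show "A \<inter> K \<noteq> B \<inter> K \<or> (if A \<subseteq> K then K else J) \<noteq> (if B \<subseteq> K then K else J)"
      proof (rule ccontr)
        assume "\<not> ?thesis"
        then have eq: "A \<inter> K = B \<inter> K" and "A \<subseteq> K \<longleftrightarrow> B \<subseteq> K" using K by (auto split: if_splits)
        then have nA: "\<not> A \<subseteq> K" using AB by blast
        then obtain x where x: "x \<in> A" "x \<notin> K" by blast
        interpret A: ideal A R using A by simp
        interpret B: ideal B R using B by simp
        have xc: "x \<in> carrier R" using x A.a_subset by auto
        note KX = ideal_add_PIdl[OF K(1) xc]
        have "K <+>\<^bsub>R\<^esub> PIdl x \<subseteq> J" using A x K J by (intro KX(4)) auto
        moreover have "\<not> K <+>\<^bsub>R\<^esub> PIdl x \<subset> J" using max KX x by blast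
        ultimately have KXJ: "K <+>\<^bsub>R\<^esub> PIdl x = J" by blast
        \<comment> \<open>Modular law: \<open>K\<close> and \<open>x\<close> generate
          \<open>J\<close>, so \<open>b = k \<oplus> r \<otimes> x\<close>, and \<open>k\<close>
          lies in \<open>B \<inter> K = A \<inter> K\<close>.\<close>
        have "b \<in> A" if b: "b \<in> B" for b
        proof -
          have "b \<in> J" using b B by auto
          then obtain k r where k: "k \<in> K" and r: "r \<in> carrier R" and br: "b = k \<oplus> r \<otimes> x"
            using mem_add_PIdl[OF xc] KXJ by blast
          have kc: "k \<in> carrier R" using k ideal.Icarr[OF K(1)] by blast
          have rx: "r \<otimes> x \<in> A" using r x A.I_l_closed by auto
          have "b \<ominus> r \<otimes> x \<in> B" using b rx AB B.a_inv_closed B.a_closed by (auto simp: minus_eq)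
          moreover have "b \<ominus> r \<otimes> x = k" unfolding br using kc r xc by (simp add: minus_eq a_assoc r_neg)
          ultimately have "k \<in> A" using k eq by blast
          then show "b \<in> A" unfolding br using rx by (rule A.a_closed)
        qed
        then show False using AB by auto
      qed
    qed (use K in \<open>auto intro: i_intersect\<close>)
    then show ?thesis unfolding Q_def by blast
  qed
  have "Q (carrier R)"
  proof (rule ccontr)
    assume "\<not> Q (carrier R)"
    with oneideal have "ideal (carrier R) R \<and> \<not> Q (carrier R)" ..
    then have "\<exists>J. (ideal J R \<and> \<not> Q J) \<and> (\<forall>K. ideal K R \<and> \<not> Q K \<longrightarrow> K \<subseteq> J \<longrightarrow> K = J)"
      by (rule ideal_family_has_minimal[OF _ conjunct1])
    then obtain J where J: "ideal J R \<and> \<not> Q J"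
      and min: "\<And>K. ideal K R \<and> \<not> Q K \<Longrightarrow> K \<subseteq> J \<Longrightarrow> K = J"
      by blast
    have "Q K" if "ideal K R" "K \<subset> J" for K
      using that min by blast
    moreover have "ideal J R" using J by simp
    ultimately have "Q J" using step by simp
    then show False using J by simp
  qed
  moreover have "{I. ideal I R \<and> I \<subseteq> carrier R} = {I. ideal I R}"
    using ideal.Icarr by auto
  ultimately show ?thesis unfolding Q_def by simp
qed

end

section \<open>Endomorphisms of modules with a cyclic socle\<close>

lemma mod_hom_zero:
  assumes "module R M" "module R N" "f \<in> mod_hom R M N"
  shows "f \<zero>\<^bsub>M\<^esub> = \<zero>\<^bsub>N\<^esub>"
proof -
  interpret M: module R M by fact
  interpret N: module R N by fact
  have "f \<zero>\<^bsub>M\<^esub> = f (\<zero>\<^bsub>R\<^esub> \<odot>\<^bsub>M\<^esub> \<zero>\<^bsub>M\<^esub>)" by simp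
  also have "\<dots> = \<zero>\<^bsub>R\<^esub> \<odot>\<^bsub>N\<^esub> f \<zero>\<^bsub>M\<^esub>"
    by (rule mod_homD(3)[OF assms(3)]) simp_all
  also have "\<dots> = \<zero>\<^bsub>N\<^esub>" using mod_homD(1)[OF assms(3)] by simp
  finally show ?thesis .
qed

lemma (in module) smult_minus_distr:
  assumes "r \<in> carrier R" "x \<in> carrier M" "y \<in> carrier M"
  shows "r \<odot>\<^bsub>M\<^esub> (x \<ominus>\<^bsub>M\<^esub> y) = r \<odot>\<^bsub>M\<^esub> x \<ominus>\<^bsub>M\<^esub> r \<odot>\<^bsub>M\<^esub> y"
  using assms by (simp add: M.minus_eq smult_r_distr smult_r_minus)

lemma (in module) minus_add_cancel:
  assumes "x \<in> carrier M" "y \<in> carrier M"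
  shows "(x \<ominus>\<^bsub>M\<^esub> y) \<oplus>\<^bsub>M\<^esub> y = x"
  using assms by (simp add: M.minus_eq M.a_assoc M.l_neg)

lemma (in module) smult_commute:
  assumes "r \<in> carrier R" "s \<in> carrier R" "x \<in> carrier M"
  shows "r \<odot>\<^bsub>M\<^esub> (s \<odot>\<^bsub>M\<^esub> x) = s \<odot>\<^bsub>M\<^esub> (r \<odot>\<^bsub>M\<^esub> x)"
  using assms by (metis R.m_comm smult_assoc1)

text \<open>The part of Matlis duality saying that endomorphisms are homotheties. Noetherian
  induction enlarges the submodule \<open>Z I\<close> killed by \<open>I\<close> while
  \<open>I\<close> shrinks from \<open>carrier R\<close> to \<open>{\<zero>}\<close>. If
  \<open>x\<close> is a socle element modulo \<open>I\<close>, multiplication by \<open>x\<close>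
  sends \<open>Z I\<close> into the socle \<open>R w0\<close> with kernel \<open>Z ?J\<close>; so
  over \<open>Z ?J\<close> the module \<open>Z I\<close> needs at most one more generator
  \<open>w1\<close>, with \<open>x w1 = w0\<close>.\<close>

lemma (in artinian_local_ring) endomorphism_is_smult:
  fixes M :: "('a, 'c) module"
  assumes M: "module R M" and w0: "w0 \<in> carrier M" "\<And>y. y \<in> \<mm> \<Longrightarrow> y \<odot>\<^bsub>M\<^esub> w0 = \<zero>\<^bsub>M\<^esub>"
    and socle: "\<And>w. w \<in> carrier M \<Longrightarrow> \<forall>y\<in>\<mm>. y \<odot>\<^bsub>M\<^esub> w = \<zero>\<^bsub>M\<^esub> \<Longrightarrow> \<exists>c\<in>carrier R. w = c \<odot>\<^bsub>M\<^esub> w0"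
    and \<Phi>: "\<Phi> \<in> mod_hom R M M"
  shows "\<exists>s\<in>carrier R. \<forall>w\<in>carrier M. \<Phi> w = s \<odot>\<^bsub>M\<^esub> w"
proof -
  interpret M: module R M by fact
  note \<Phi>s = mod_homD[OF \<Phi>]
  define Z where "Z = (\<lambda>I. {w \<in> carrier M. \<forall>y\<in>I. y \<odot>\<^bsub>M\<^esub> w = \<zero>\<^bsub>M\<^esub>})"
  define P where "P = (\<lambda>I. \<exists>s\<in>carrier R. \<forall>w\<in>Z I. \<Phi> w = s \<odot>\<^bsub>M\<^esub> w)"
  have step: "P I" if I: "ideal I R" and IH: "\<And>J. ideal J R \<Longrightarrow> I \<subset> J \<Longrightarrow> P J" for I
  proof (cases "I = carrier R")
    case True
    have Z0: "w = \<zero>\<^bsub>M\<^esub>" if "w \<in> Z I" for w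
    proof -
      have w: "w \<in> carrier M" using that by (simp add: Z_def)
      have "\<one> \<odot>\<^bsub>M\<^esub> w = \<zero>\<^bsub>M\<^esub>" using that True one_closed unfolding Z_def by blast
      then show ?thesis using w by simp
    qed
    have "\<Phi> w = \<zero> \<odot>\<^bsub>M\<^esub> w" if "w \<in> Z I" for w
      unfolding Z0[OF that] using mod_hom_zero[OF M M \<Phi>] by simp
    then show ?thesis unfolding P_def by blast
  next
    case False
    interpret I: ideal I R by fact
    have Ic: "y \<in> carrier R" if "y \<in> I" for y using that I.a_subset by auto
    have mc: "y \<in> carrier R" if "y \<in> \<mm>" for y using that a_subset by auto
    obtain x where x: "x \<in> carrier R" "x \<notin> I" and mx: "\<And>y. y \<in> \<mm> \<Longrightarrow> y \<otimes> x \<in> I"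
      using exists_socle_mod[OF I False] by blast
    let ?J = "I <+>\<^bsub>R\<^esub> PIdl x"
    have "P ?J" using ideal_add_PIdl[OF I x(1)] x(2) by (intro IH) blast+
    then obtain s where s: "s \<in> carrier R" and sZ: "\<And>w. w \<in> Z ?J \<Longrightarrow> \<Phi> w = s \<odot>\<^bsub>M\<^esub> w"
      unfolding P_def by blast
    have Zc: "w \<in> carrier M" if "w \<in> Z I" for w using that by (simp add: Z_def)
    have ZI: "y \<odot>\<^bsub>M\<^esub> w = \<zero>\<^bsub>M\<^esub>" if "w \<in> Z I" "y \<in> I" for w y
      using that by (simp add: Z_def)
    have ZJ: "w \<in> Z ?J" if w: "w \<in> Z I" and xw: "x \<odot>\<^bsub>M\<^esub> w = \<zero>\<^bsub>M\<^esub>" for w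
    proof -
      have "y \<odot>\<^bsub>M\<^esub> w = \<zero>\<^bsub>M\<^esub>" if "y \<in> ?J" for y
      proof -
        from that have "\<exists>j\<in>I. \<exists>r\<in>carrier R. y = j \<oplus> r \<otimes> x"
          unfolding mem_add_PIdl[OF x(1)] .
        then obtain j r where j: "j \<in> I" and r: "r \<in> carrier R" and y: "y = j \<oplus> r \<otimes> x"
          by (elim bexE)
        show ?thesis
          unfolding y using j r x Zc[OF w] Ic[OF j] ZI[OF w j] xw
          by (simp add: M.smult_l_distr M.smult_assoc1)
      qed
      then show ?thesis using Zc[OF w] by (simp add: Z_def)
    qed
    have Zsm: "r \<odot>\<^bsub>M\<^esub> w \<in> Z I" if r: "r \<in> carrier R" and w: "w \<in> Z I" for r w
    proof -
      have "y \<odot>\<^bsub>M\<^esub> (r \<odot>\<^bsub>M\<^esub> w) = \<zero>\<^bsub>M\<^esub>" if "y \<in> I" for y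
        using M.smult_commute[OF Ic[OF that] r Zc[OF w]] ZI[OF w that] r by simp
      then show ?thesis using r Zc[OF w] by (simp add: Z_def)
    qed
    have Zmin: "w \<ominus>\<^bsub>M\<^esub> w' \<in> Z I" if w: "w \<in> Z I" "w' \<in> Z I" for w w'
    proof -
      have "y \<odot>\<^bsub>M\<^esub> (w \<ominus>\<^bsub>M\<^esub> w') = \<zero>\<^bsub>M\<^esub>" if "y \<in> I" for y
        using M.smult_minus_distr[OF Ic[OF that] Zc[OF w(1)] Zc[OF w(2)]] ZI[OF _ that] w
        by (simp add: M.minus_eq)
      then show ?thesis using Zc w by (simp add: Z_def)
    qed
    have xw: "\<exists>c\<in>carrier R. x \<odot>\<^bsub>M\<^esub> w = c \<odot>\<^bsub>M\<^esub> w0" if w: "w \<in> Z I" for w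
    proof (rule socle)
      show "x \<odot>\<^bsub>M\<^esub> w \<in> carrier M" using x Zc[OF w] by simp
      show "\<forall>y\<in>\<mm>. y \<odot>\<^bsub>M\<^esub> (x \<odot>\<^bsub>M\<^esub> w) = \<zero>\<^bsub>M\<^esub>"
        using M.smult_assoc1[OF mc x(1) Zc[OF w]] ZI[OF w mx] by simp
    qed
    show ?thesis
    proof (cases "\<forall>w\<in>Z I. x \<odot>\<^bsub>M\<^esub> w = \<zero>\<^bsub>M\<^esub>")
      case True
      then have "\<forall>w\<in>Z I. \<Phi> w = s \<odot>\<^bsub>M\<^esub> w" using ZJ sZ by blast
      then show ?thesis unfolding P_def using s by blast
    next
      case False
      then obtain w2 where w2: "w2 \<in> Z I" "x \<odot>\<^bsub>M\<^esub> w2 \<noteq> \<zero>\<^bsub>M\<^esub>" by blast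
      obtain c2 where c2: "c2 \<in> carrier R" "x \<odot>\<^bsub>M\<^esub> w2 = c2 \<odot>\<^bsub>M\<^esub> w0" using xw[OF w2(1)] by blast
      have "c2 \<notin> \<mm>" using w2(2) w0(2) unfolding c2(2) by blast
      then obtain v where v: "v \<in> carrier R" "v \<otimes> c2 = \<one>" using unit_inverse c2(1) by blast
      \<comment> \<open>Normalized so that \<open>x\<close> sends \<open>w1\<close> to
        \<open>w0\<close> itself and not just to a multiple.\<close>
      define w1 where "w1 = v \<odot>\<^bsub>M\<^esub> w2"
      have w1: "w1 \<in> Z I" unfolding w1_def using v(1) w2(1) by (rule Zsm)
      have xw1: "x \<odot>\<^bsub>M\<^esub> w1 = w0"
        unfolding w1_def using M.smult_commute[OF x(1) v(1) Zc[OF w2(1)]] c2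
          M.smult_assoc1[OF v(1) c2(1) w0(1)] v w0(1) by simp
      \<comment> \<open>For \<open>y \<in> \<mm>\<close> the vector \<open>y w1\<close> lies in
        \<open>Z ?J\<close>, where \<open>\<Phi>\<close> is already multiplication by
        \<open>s\<close>; hence the defect of \<open>s\<close> at \<open>w1\<close> is in the
        socle.\<close>
      have "\<exists>d\<in>carrier R. \<Phi> w1 \<ominus>\<^bsub>M\<^esub> s \<odot>\<^bsub>M\<^esub> w1 = d \<odot>\<^bsub>M\<^esub> w0"
      proof (rule socle)
        show "\<Phi> w1 \<ominus>\<^bsub>M\<^esub> s \<odot>\<^bsub>M\<^esub> w1 \<in> carrier M" using \<Phi>s(1) Zc[OF w1] s by simp
        show "\<forall>y\<in>\<mm>. y \<odot>\<^bsub>M\<^esub> (\<Phi> w1 \<ominus>\<^bsub>M\<^esub> s \<odot>\<^bsub>M\<^esub> w1) = \<zero>\<^bsub>M\<^esub>"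
        proof
          fix y assume y: "y \<in> \<mm>"
          have "x \<odot>\<^bsub>M\<^esub> (y \<odot>\<^bsub>M\<^esub> w1) = \<zero>\<^bsub>M\<^esub>"
            using M.smult_commute[OF x(1) mc[OF y] Zc[OF w1]] xw1 w0(2)[OF y] by simp
          then have "\<Phi> (y \<odot>\<^bsub>M\<^esub> w1) = s \<odot>\<^bsub>M\<^esub> (y \<odot>\<^bsub>M\<^esub> w1)"
            by (intro sZ ZJ Zsm mc y w1)
          then have "y \<odot>\<^bsub>M\<^esub> \<Phi> w1 = y \<odot>\<^bsub>M\<^esub> (s \<odot>\<^bsub>M\<^esub> w1)"
            using \<Phi>s(3)[OF mc[OF y] Zc[OF w1]] M.smult_commute[OF s mc[OF y] Zc[OF w1]] by simp
          then show "y \<odot>\<^bsub>M\<^esub> (\<Phi> w1 \<ominus>\<^bsub>M\<^esub> s \<odot>\<^bsub>M\<^esub> w1) = \<zero>\<^bsub>M\<^esub>"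
            using M.smult_minus_distr[OF mc[OF y] \<Phi>s(1) M.smult_closed[OF s]] Zc[OF w1] mc[OF y] s
            by (simp add: M.r_neg M.minus_eq)
        qed
      qed
      then obtain d where d: "d \<in> carrier R" "\<Phi> w1 \<ominus>\<^bsub>M\<^esub> s \<odot>\<^bsub>M\<^esub> w1 = d \<odot>\<^bsub>M\<^esub> w0" by blast
      have \<Phi>w1: "\<Phi> w1 = d \<odot>\<^bsub>M\<^esub> w0 \<oplus>\<^bsub>M\<^esub> s \<odot>\<^bsub>M\<^esub> w1"
        using M.minus_add_cancel[of "\<Phi> w1" "s \<odot>\<^bsub>M\<^esub> w1"] d s Zc[OF w1] \<Phi>s(1) by simp
      \<comment> \<open>The correction \<open>d \<otimes> x\<close> vanishes on \<open>Z ?J\<close>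
        and contributes \<open>d w0\<close> at \<open>w1\<close>, which is exactly the
        defect.\<close>
      have "\<Phi> w = (s \<oplus> d \<otimes> x) \<odot>\<^bsub>M\<^esub> w" if w: "w \<in> Z I" for w
      proof -
        note wc = Zc[OF w] and w1c = Zc[OF w1]
        obtain c where c: "c \<in> carrier R" "x \<odot>\<^bsub>M\<^esub> w = c \<odot>\<^bsub>M\<^esub> w0" using xw[OF w] by blast
        define u where "u = w \<ominus>\<^bsub>M\<^esub> c \<odot>\<^bsub>M\<^esub> w1"
        have cw1: "c \<odot>\<^bsub>M\<^esub> w1 \<in> carrier M" using c w1c by simp
        have uI: "u \<in> Z I" unfolding u_def by (intro Zmin Zsm w w1 c)
        note uc = Zc[OF uI]
        have "x \<odot>\<^bsub>M\<^esub> u = \<zero>\<^bsub>M\<^esub>"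
          unfolding u_def M.smult_minus_distr[OF x(1) wc cw1] M.smult_commute[OF x(1) c(1) w1c]
          using c xw1 w0(1) by (simp add: M.r_neg M.minus_eq)
        then have \<Phi>u: "\<Phi> u = s \<odot>\<^bsub>M\<^esub> u" by (intro sZ ZJ uI)
        have wu: "w = u \<oplus>\<^bsub>M\<^esub> c \<odot>\<^bsub>M\<^esub> w1"
          unfolding u_def using M.minus_add_cancel[OF wc cw1] by simp
        have "\<Phi> w = \<Phi> u \<oplus>\<^bsub>M\<^esub> c \<odot>\<^bsub>M\<^esub> \<Phi> w1"
          using \<Phi>s(2)[OF uc cw1] \<Phi>s(3)[OF c(1) w1c] wu by simp
        also have "\<dots> = s \<odot>\<^bsub>M\<^esub> u \<oplus>\<^bsub>M\<^esub> (c \<odot>\<^bsub>M\<^esub> (d \<odot>\<^bsub>M\<^esub> w0) \<oplus>\<^bsub>M\<^esub> c \<odot>\<^bsub>M\<^esub> (s \<odot>\<^bsub>M\<^esub> w1))"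
          unfolding \<Phi>u \<Phi>w1 using c d s w0(1) w1c by (simp add: M.smult_r_distr)
        also have "\<dots> = (s \<odot>\<^bsub>M\<^esub> u \<oplus>\<^bsub>M\<^esub> s \<odot>\<^bsub>M\<^esub> (c \<odot>\<^bsub>M\<^esub> w1)) \<oplus>\<^bsub>M\<^esub> d \<odot>\<^bsub>M\<^esub> (c \<odot>\<^bsub>M\<^esub> w0)"
          unfolding M.smult_commute[OF c(1) d(1) w0(1)] M.smult_commute[OF c(1) s w1c]
          using c d s w0(1) w1c uc by (simp add: M.a_ac)
        also have "s \<odot>\<^bsub>M\<^esub> u \<oplus>\<^bsub>M\<^esub> s \<odot>\<^bsub>M\<^esub> (c \<odot>\<^bsub>M\<^esub> w1) = s \<odot>\<^bsub>M\<^esub> w"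
          using M.smult_r_distr[OF s uc cw1] wu by simp
        also have "d \<odot>\<^bsub>M\<^esub> (c \<odot>\<^bsub>M\<^esub> w0) = (d \<otimes> x) \<odot>\<^bsub>M\<^esub> w"
          using M.smult_assoc1[OF d(1) x(1) wc] c by simp
        also have "s \<odot>\<^bsub>M\<^esub> w \<oplus>\<^bsub>M\<^esub> (d \<otimes> x) \<odot>\<^bsub>M\<^esub> w = (s \<oplus> d \<otimes> x) \<odot>\<^bsub>M\<^esub> w"
          using M.smult_l_distr[OF s _ wc, of "d \<otimes> x"] d x by simp
        finally show ?thesis .
      qed
      moreover have "s \<oplus> d \<otimes> x \<in> carrier R" using s d x by simp
      ultimately show ?thesis unfolding P_def by blast
    qed
  qed
  have "P {\<zero>}"
  proof (rule ccontr)
    assume "\<not> P {\<zero>}"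
    with zeroideal have "ideal {\<zero>} R \<and> \<not> P {\<zero>}" ..
    then have "\<exists>I. (ideal I R \<and> \<not> P I) \<and> (\<forall>J. ideal J R \<and> \<not> P J \<longrightarrow> I \<subseteq> J \<longrightarrow> J = I)"
      by (rule ideal_predicate_has_maximal[OF _ conjunct1])
    then show False using step by blast
  qed
  moreover have "Z {\<zero>} = carrier M" by (auto simp: Z_def)
  ultimately show ?thesis unfolding P_def by simp
qed

section \<open>Dualizing modules\<close>

lemma chains_bounded_mono:
  assumes A: "chains_bounded A a" and f: "\<And>K. K \<in> C \<Longrightarrow> f K \<in> A"
    and strict: "\<And>K L. K \<in> C \<Longrightarrow> L \<in> C \<Longrightarrow> K \<subset> L \<Longrightarrow> f K \<subset> f L"
  shows "chains_bounded C a"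
  unfolding chains_bounded_def
proof (intro allI impI, elim conjE)
  fix n F assume F: "\<forall>i\<le>n. F i \<in> C" "\<forall>i<n. F i \<subset> F (Suc i)"
  have "\<forall>i\<le>n. f (F i) \<in> A" using F f by blast
  moreover have "\<forall>i<n. f (F i) \<subset> f (F (Suc i))"
    using F strict by (metis Suc_leI less_imp_le_nat)
  ultimately show "n \<le> a"
    using A[unfolded chains_bounded_def, rule_format, of n "\<lambda>i. f (F i)"] by blast
qed

lemma (in ring) chains_bounded_above_ideal:
  assumes I: "ideal I R" and N: "ring_length (R Quot I) \<le> enat N"
  shows "chains_bounded {J. ideal J R \<and> I \<subseteq> J} N"
proof (rule chains_bounded_mono)
  have corr: "inj_on ((`) ((+>) I)) {J. ideal J R \<and> I \<subseteq> J}"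
    "(`) ((+>) I) ` {J. ideal J R \<and> I \<subseteq> J} = {J. ideal J (R Quot I)}"
    using quot_ideal_correspondence[OF I] by (auto simp: bij_betw_def)
  show "chains_bounded {J. ideal J (R Quot I)} N"
    using N ring_length_le_iff by blast
  show "(+>) I ` J \<in> {J. ideal J (R Quot I)}" if "J \<in> {J. ideal J R \<and> I \<subseteq> J}" for J
    using corr(2) that by blast
  show "(+>) I ` J \<subset> (+>) I ` K"
    if "J \<in> {J. ideal J R \<and> I \<subseteq> J}" "K \<in> {J. ideal J R \<and> I \<subseteq> J}" "J \<subset> K" for J K
    using inj_onD[OF corr(1) _ that(1,2)] that(3) by blast
qed

text \<open>The injective hull of the residue field in elementwise terms: \<open>w0\<close> is the
  image of the class of one, and essentiality says that every nonzero element has \<open>w0\<close>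
  as a multiple. Only the two lemmas converting from and to \<open>canonical_module\<close> then
  have to handle cosets of \<open>\<mm>\<close>.\<close>

locale dualizing_module = artinian_local_ring R \<mm> + W: module R W
  for R :: "('a, 'm) ring_scheme" (structure) and \<mm> and W :: "('a, 'b) module" +
  fixes w0 :: 'b
  assumes injective: "injective_module R W"
    and w0_closed [simp]: "w0 \<in> carrier W"
    and w0_nonzero: "w0 \<noteq> \<zero>\<^bsub>W\<^esub>"
    and maximal_smult_w0: "y \<in> \<mm> \<Longrightarrow> y \<odot>\<^bsub>W\<^esub> w0 = \<zero>\<^bsub>W\<^esub>"
    and essential: "w \<in> carrier W \<Longrightarrow> w \<noteq> \<zero>\<^bsub>W\<^esub> \<Longrightarrow> \<exists>r\<in>carrier R. r \<odot>\<^bsub>W\<^esub> w = w0"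

context dualizing_module
begin

lemma m_carrier: "y \<in> \<mm> \<Longrightarrow> y \<in> carrier R"
  using a_subset by blast

lemma smult_cancel_unit:
  assumes r: "r \<in> carrier R" "r \<notin> \<mm>" and w: "w \<in> carrier W"
  obtains v where "v \<in> carrier R" "v \<odot>\<^bsub>W\<^esub> (r \<odot>\<^bsub>W\<^esub> w) = w"
proof -
  obtain v where v: "v \<in> carrier R" "v \<otimes> r = \<one>" using unit_inverse[OF r] by blast
  then have "v \<odot>\<^bsub>W\<^esub> (r \<odot>\<^bsub>W\<^esub> w) = w" using r w W.smult_assoc1[of v r w] by simp
  then show thesis using v that by blast
qed

lemma socle:
  assumes w: "w \<in> carrier W" "\<forall>y\<in>\<mm>. y \<odot>\<^bsub>W\<^esub> w = \<zero>\<^bsub>W\<^esub>"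
  shows "\<exists>c\<in>carrier R. w = c \<odot>\<^bsub>W\<^esub> w0"
proof (cases "w = \<zero>\<^bsub>W\<^esub>")
  case True
  then have "w = \<zero> \<odot>\<^bsub>W\<^esub> w0" by simp
  then show ?thesis by blast
next
  case False
  then obtain r where r: "r \<in> carrier R" "r \<odot>\<^bsub>W\<^esub> w = w0" using essential w by blast
  then have "r \<notin> \<mm>" using w w0_nonzero by auto
  then show ?thesis using smult_cancel_unit[OF r(1) _ w(1)] r(2) by metis
qed

text \<open>On \<open>H + R w\<close> the map \<open>u + r w \<mapsto> r w0\<close> is well defined:
  if \<open>r w\<close> is in \<open>H\<close>, then \<open>r\<close> lies in \<open>\<mm>\<close>,
  since a unit would put \<open>w\<close> into \<open>H\<close>, and \<open>\<mm>\<close> kills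
  \<open>w0\<close>. Injectivity extends this map to \<open>N\<close>.\<close>

lemma cogenerator:
  fixes N :: "('a, 'c) module"
  assumes N: "module R N" and H: "submodule H R N" and w: "w \<in> carrier N" "w \<notin> H"
  shows "\<exists>\<theta>\<in>mod_hom R N W. (\<forall>u\<in>H. \<theta> u = \<zero>\<^bsub>W\<^esub>) \<and> \<theta> w = w0"
proof -
  interpret N: module R N by fact
  note Hs = N.submoduleE[OF H]
  have Hc: "u \<in> carrier N" if "u \<in> H" for u using that Hs(1) by blast
  have Hz: "\<zero>\<^bsub>N\<^esub> \<in> H" using submodule.axioms(1)[OF H] subgroup.one_closed by fastforce
  define K where "K = {u \<oplus>\<^bsub>N\<^esub> r \<odot>\<^bsub>N\<^esub> w | u r. u \<in> H \<and> r \<in> carrier R}"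
  have K: "submodule K R N"
  proof (rule N.submoduleI)
    show "K \<subseteq> carrier N" using w Hc by (auto simp: K_def)
    have "\<zero>\<^bsub>N\<^esub> = \<zero>\<^bsub>N\<^esub> \<oplus>\<^bsub>N\<^esub> \<zero> \<odot>\<^bsub>N\<^esub> w" using w by simp
    then show "\<zero>\<^bsub>N\<^esub> \<in> K" unfolding K_def using Hz by blast
  next
    fix a assume "a \<in> K"
    then obtain u r where ur: "u \<in> H" "r \<in> carrier R" and a: "a = u \<oplus>\<^bsub>N\<^esub> r \<odot>\<^bsub>N\<^esub> w"
      unfolding K_def by blast
    have "\<ominus>\<^bsub>N\<^esub> a = \<ominus>\<^bsub>N\<^esub> u \<oplus>\<^bsub>N\<^esub> (\<ominus> r) \<odot>\<^bsub>N\<^esub> w"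
      unfolding a using ur w Hc by (simp add: N.smult_l_minus N.minus_add)
    then show "\<ominus>\<^bsub>N\<^esub> a \<in> K" unfolding K_def using ur Hs(3) by blast
  next
    fix a b assume "a \<in> K" "b \<in> K"
    then obtain u r u' r' where ur: "u \<in> H" "r \<in> carrier R" "u' \<in> H" "r' \<in> carrier R"
      and a: "a = u \<oplus>\<^bsub>N\<^esub> r \<odot>\<^bsub>N\<^esub> w" and b: "b = u' \<oplus>\<^bsub>N\<^esub> r' \<odot>\<^bsub>N\<^esub> w"
      unfolding K_def by blast
    have "a \<oplus>\<^bsub>N\<^esub> b = (u \<oplus>\<^bsub>N\<^esub> u') \<oplus>\<^bsub>N\<^esub> (r \<oplus> r') \<odot>\<^bsub>N\<^esub> w"
      unfolding a b using ur w Hc by (simp add: N.smult_l_distr N.a_ac)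
    then show "a \<oplus>\<^bsub>N\<^esub> b \<in> K" unfolding K_def using ur Hs(5) by blast
  next
    fix s a assume s: "s \<in> carrier R" and "a \<in> K"
    then obtain u r where ur: "u \<in> H" "r \<in> carrier R" and a: "a = u \<oplus>\<^bsub>N\<^esub> r \<odot>\<^bsub>N\<^esub> w"
      unfolding K_def by blast
    have "s \<odot>\<^bsub>N\<^esub> a = s \<odot>\<^bsub>N\<^esub> u \<oplus>\<^bsub>N\<^esub> (s \<otimes> r) \<odot>\<^bsub>N\<^esub> w"
      unfolding a using ur w Hc s by (simp add: N.smult_r_distr N.smult_assoc1)
    then show "s \<odot>\<^bsub>N\<^esub> a \<in> K" unfolding K_def using ur s Hs(4) by blast
  qed
  \<comment> \<open>An arbitrary coefficient; it is its product with \<open>w0\<close> that does not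
    depend on the choice.\<close>
  define c where "c = (\<lambda>a. SOME r. r \<in> carrier R \<and> (\<exists>u\<in>H. a = u \<oplus>\<^bsub>N\<^esub> r \<odot>\<^bsub>N\<^esub> w))"
  define g where "g = (\<lambda>a. c a \<odot>\<^bsub>W\<^esub> w0)"
  have unique: "r \<odot>\<^bsub>W\<^esub> w0 = r' \<odot>\<^bsub>W\<^esub> w0"
    if ur: "u \<in> H" "u' \<in> H" "r \<in> carrier R" "r' \<in> carrier R"
      and eq: "u \<oplus>\<^bsub>N\<^esub> r \<odot>\<^bsub>N\<^esub> w = u' \<oplus>\<^bsub>N\<^esub> r' \<odot>\<^bsub>N\<^esub> w" for u u' r r'
  proof -
    have c: "u \<in> carrier N" "u' \<in> carrier N" "r \<odot>\<^bsub>N\<^esub> w \<in> carrier N" "r' \<odot>\<^bsub>N\<^esub> w \<in> carrier N"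
      using ur Hc w by auto
    have "(r \<ominus> r') \<odot>\<^bsub>N\<^esub> w = r \<odot>\<^bsub>N\<^esub> w \<ominus>\<^bsub>N\<^esub> r' \<odot>\<^bsub>N\<^esub> w"
      using ur w by (simp add: minus_eq N.minus_eq N.smult_l_distr N.smult_l_minus)
    also have "\<dots> = (\<ominus>\<^bsub>N\<^esub> u \<oplus>\<^bsub>N\<^esub> (u \<oplus>\<^bsub>N\<^esub> r \<odot>\<^bsub>N\<^esub> w)) \<ominus>\<^bsub>N\<^esub> r' \<odot>\<^bsub>N\<^esub> w"
      using c by (simp add: N.a_assoc[symmetric] N.l_neg)
    also have "\<dots> = (\<ominus>\<^bsub>N\<^esub> u \<oplus>\<^bsub>N\<^esub> (u' \<oplus>\<^bsub>N\<^esub> r' \<odot>\<^bsub>N\<^esub> w)) \<ominus>\<^bsub>N\<^esub> r' \<odot>\<^bsub>N\<^esub> w"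
      by (simp add: eq)
    also have "\<dots> = \<ominus>\<^bsub>N\<^esub> u \<oplus>\<^bsub>N\<^esub> u'"
      using c by (simp add: N.minus_eq N.a_assoc N.r_neg)
    also have "\<dots> \<in> H" using ur Hs by blast
    finally have inH: "(r \<ominus> r') \<odot>\<^bsub>N\<^esub> w \<in> H" .
    have "r \<ominus> r' \<in> \<mm>"
    proof (rule ccontr)
      assume "r \<ominus> r' \<notin> \<mm>"
      then obtain v where v: "v \<in> carrier R" "v \<otimes> (r \<ominus> r') = \<one>"
        using unit_inverse ur by (metis minus_closed)
      then have "v \<odot>\<^bsub>N\<^esub> ((r \<ominus> r') \<odot>\<^bsub>N\<^esub> w) = w"
        using N.smult_assoc1[of v "r \<ominus> r'" w] ur w by simp
      then show False using Hs(4)[OF v(1) inH] w by simp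
    qed
    then have "(r \<ominus> r') \<odot>\<^bsub>W\<^esub> w0 = \<zero>\<^bsub>W\<^esub>" by (rule maximal_smult_w0)
    then have "r \<odot>\<^bsub>W\<^esub> w0 \<ominus>\<^bsub>W\<^esub> r' \<odot>\<^bsub>W\<^esub> w0 = \<zero>\<^bsub>W\<^esub>"
      using ur by (simp add: minus_eq W.minus_eq W.smult_l_distr W.smult_l_minus)
    then show ?thesis
      using ur W.minus_add_cancel[of "r \<odot>\<^bsub>W\<^esub> w0" "r' \<odot>\<^bsub>W\<^esub> w0"] by simp
  qed
  have g: "g (u \<oplus>\<^bsub>N\<^esub> r \<odot>\<^bsub>N\<^esub> w) = r \<odot>\<^bsub>W\<^esub> w0" if ur: "u \<in> H" "r \<in> carrier R" for u r
  proof -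
    define a where "a = u \<oplus>\<^bsub>N\<^esub> r \<odot>\<^bsub>N\<^esub> w"
    have "r \<in> carrier R \<and> (\<exists>u\<in>H. a = u \<oplus>\<^bsub>N\<^esub> r \<odot>\<^bsub>N\<^esub> w)" using ur a_def by blast
    then have "c a \<in> carrier R \<and> (\<exists>u\<in>H. a = u \<oplus>\<^bsub>N\<^esub> c a \<odot>\<^bsub>N\<^esub> w)" unfolding c_def by (rule someI)
    then obtain u' where u': "u' \<in> H" "c a \<in> carrier R" "a = u' \<oplus>\<^bsub>N\<^esub> c a \<odot>\<^bsub>N\<^esub> w" by blast
    have "c a \<odot>\<^bsub>W\<^esub> w0 = r \<odot>\<^bsub>W\<^esub> w0"
      using u'(3) a_def by (intro unique[OF u'(1) ur(1) u'(2) ur(2)]) simp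
    then show ?thesis unfolding g_def a_def .
  qed
  have M: "module R (N\<lparr>carrier := K\<rparr>)" using submodule.submodule_is_module[OF K N] .
  have g_hom: "g \<in> mod_hom R (N\<lparr>carrier := K\<rparr>) W"
    unfolding mod_hom_def
  proof (intro CollectI conjI ballI funcsetI)
    fix a assume "a \<in> carrier (N\<lparr>carrier := K\<rparr>)"
    then show "g a \<in> carrier W" by (auto simp: K_def g)
  next
    fix a b assume "a \<in> carrier (N\<lparr>carrier := K\<rparr>)" "b \<in> carrier (N\<lparr>carrier := K\<rparr>)"
    then obtain u r u' r' where ur: "u \<in> H" "r \<in> carrier R" "u' \<in> H" "r' \<in> carrier R"
      and a: "a = u \<oplus>\<^bsub>N\<^esub> r \<odot>\<^bsub>N\<^esub> w" and b: "b = u' \<oplus>\<^bsub>N\<^esub> r' \<odot>\<^bsub>N\<^esub> w"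
      by (auto simp: K_def)
    have ab: "a \<oplus>\<^bsub>N\<^esub> b = (u \<oplus>\<^bsub>N\<^esub> u') \<oplus>\<^bsub>N\<^esub> (r \<oplus> r') \<odot>\<^bsub>N\<^esub> w"
      unfolding a b using ur w Hc by (simp add: N.smult_l_distr N.a_ac)
    have "g (a \<oplus>\<^bsub>N\<^esub> b) = (r \<oplus> r') \<odot>\<^bsub>W\<^esub> w0"
      unfolding ab using ur Hs by (intro g) auto
    then show "g (a \<oplus>\<^bsub>N\<lparr>carrier := K\<rparr>\<^esub> b) = g a \<oplus>\<^bsub>W\<^esub> g b"
      using g[OF ur(1,2)] g[OF ur(3,4)] ur a b by (simp add: W.smult_l_distr)
  next
    fix s a assume s: "s \<in> carrier R" and "a \<in> carrier (N\<lparr>carrier := K\<rparr>)"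
    then obtain u r where ur: "u \<in> H" "r \<in> carrier R" and a: "a = u \<oplus>\<^bsub>N\<^esub> r \<odot>\<^bsub>N\<^esub> w"
      by (auto simp: K_def)
    have sa: "s \<odot>\<^bsub>N\<^esub> a = s \<odot>\<^bsub>N\<^esub> u \<oplus>\<^bsub>N\<^esub> (s \<otimes> r) \<odot>\<^bsub>N\<^esub> w"
      unfolding a using ur w Hc s by (simp add: N.smult_r_distr N.smult_assoc1)
    have "g (s \<odot>\<^bsub>N\<^esub> a) = (s \<otimes> r) \<odot>\<^bsub>W\<^esub> w0"
      unfolding sa using ur s Hs by (intro g) auto
    then show "g (s \<odot>\<^bsub>N\<lparr>carrier := K\<rparr>\<^esub> a) = s \<odot>\<^bsub>W\<^esub> g a"
      using g[OF ur] ur a s by (simp add: W.smult_assoc1)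
  qed
  have i: "(\<lambda>x. x) \<in> mod_hom R (N\<lparr>carrier := K\<rparr>) N" "inj_on (\<lambda>x. x) (carrier (N\<lparr>carrier := K\<rparr>))"
    using N.submoduleE(1)[OF K] by (auto simp: mod_hom_def)
  obtain h where h: "h \<in> mod_hom R N W" and hg: "\<And>x. x \<in> K \<Longrightarrow> h x = g x"
    using injective_module_extension[OF injective M N i g_hom] by auto
  have "h u = \<zero>\<^bsub>W\<^esub>" if u: "u \<in> H" for u
  proof -
    have "u = u \<oplus>\<^bsub>N\<^esub> \<zero> \<odot>\<^bsub>N\<^esub> w" using Hc[OF u] w by simp
    then have "u \<in> K" "g u = \<zero> \<odot>\<^bsub>W\<^esub> w0" using u g[OF u, of \<zero>] by (auto simp: K_def)
    then show ?thesis using hg by simp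
  qed
  moreover have "h w = w0"
  proof -
    have "w = \<zero>\<^bsub>N\<^esub> \<oplus>\<^bsub>N\<^esub> \<one> \<odot>\<^bsub>N\<^esub> w" using w by simp
    then have "w \<in> K" "g w = \<one> \<odot>\<^bsub>W\<^esub> w0" using Hz g[OF Hz one_closed] by (auto simp: K_def)
    then show ?thesis using hg by simp
  qed
  ultimately show ?thesis using h by blast
qed

text \<open>Annihilators decrease strictly. For \<open>w\<close> in \<open>L\<close> outside
  \<open>K\<close>, the cogenerator property gives an endomorphism of \<open>W\<close> that kills
  \<open>K\<close> but not \<open>w\<close>; it is multiplication by some \<open>s\<close>, which
  annihilates \<open>K\<close> but not \<open>L\<close>. The annihilator of a submodule killed by
  \<open>I\<close> contains \<open>I\<close>, whence the bound by chains above
  \<open>I\<close>.\<close>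

lemma chains_bounded_submodules:
  assumes I: "chains_bounded {J. ideal J R \<and> I \<subseteq> J} b" "I \<subseteq> carrier R"
  shows "chains_bounded {K. submodule K R W \<and> (\<forall>x\<in>I. \<forall>u\<in>K. x \<odot>\<^bsub>W\<^esub> u = \<zero>\<^bsub>W\<^esub>)} b"
proof (rule chains_bounded_antimono[OF I(1), where f = "\<lambda>K. {r \<in> carrier R. \<forall>u\<in>K. r \<odot>\<^bsub>W\<^esub> u = \<zero>\<^bsub>W\<^esub>}"])
  fix K assume K: "K \<in> {K. submodule K R W \<and> (\<forall>x\<in>I. \<forall>u\<in>K. x \<odot>\<^bsub>W\<^esub> u = \<zero>\<^bsub>W\<^esub>)}"
  then have Kc: "u \<in> carrier W" if "u \<in> K" for u using W.submoduleE(1) that by blast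
  have "ideal {r \<in> carrier R. \<forall>u\<in>K. r \<odot>\<^bsub>W\<^esub> u = \<zero>\<^bsub>W\<^esub>} R"
  proof (intro idealI[OF ring_axioms] subgroup.intro)
    fix x assume "x \<in> {r \<in> carrier R. \<forall>u\<in>K. r \<odot>\<^bsub>W\<^esub> u = \<zero>\<^bsub>W\<^esub>}"
    then have "\<ominus> x \<in> {r \<in> carrier R. \<forall>u\<in>K. r \<odot>\<^bsub>W\<^esub> u = \<zero>\<^bsub>W\<^esub>}"
      using Kc by (auto simp: W.smult_l_minus)
    then show "inv\<^bsub>add_monoid R\<^esub> x \<in> {r \<in> carrier R. \<forall>u\<in>K. r \<odot>\<^bsub>W\<^esub> u = \<zero>\<^bsub>W\<^esub>}"
      by (simp add: a_inv_def)
  next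
    fix a x assume "a \<in> {r \<in> carrier R. \<forall>u\<in>K. r \<odot>\<^bsub>W\<^esub> u = \<zero>\<^bsub>W\<^esub>}" "x \<in> carrier R"
    then show "x \<otimes> a \<in> {r \<in> carrier R. \<forall>u\<in>K. r \<odot>\<^bsub>W\<^esub> u = \<zero>\<^bsub>W\<^esub>}"
      "a \<otimes> x \<in> {r \<in> carrier R. \<forall>u\<in>K. r \<odot>\<^bsub>W\<^esub> u = \<zero>\<^bsub>W\<^esub>}"
      using Kc m_comm[of a x] by (auto simp: W.smult_assoc1)
  qed (use Kc in \<open>auto simp: W.smult_l_distr\<close>)
  then show "{r \<in> carrier R. \<forall>u\<in>K. r \<odot>\<^bsub>W\<^esub> u = \<zero>\<^bsub>W\<^esub>} \<in> {J. ideal J R \<and> I \<subseteq> J}"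
    using K I(2) by blast
next
  fix K L assume K: "K \<in> {K. submodule K R W \<and> (\<forall>x\<in>I. \<forall>u\<in>K. x \<odot>\<^bsub>W\<^esub> u = \<zero>\<^bsub>W\<^esub>)}"
    and L: "L \<in> {K. submodule K R W \<and> (\<forall>x\<in>I. \<forall>u\<in>K. x \<odot>\<^bsub>W\<^esub> u = \<zero>\<^bsub>W\<^esub>)}" and "K \<subset> L"
  then obtain w where w: "w \<in> L" "w \<notin> K" by blast
  have wc: "w \<in> carrier W" using w(1) L W.submoduleE(1) by blast
  obtain \<theta> where \<theta>: "\<theta> \<in> mod_hom R W W" "\<forall>u\<in>K. \<theta> u = \<zero>\<^bsub>W\<^esub>" "\<theta> w = w0"
    using cogenerator[OF W.module_axioms _ wc w(2)] K by blast
  obtain s where s: "s \<in> carrier R" "\<forall>w\<in>carrier W. \<theta> w = s \<odot>\<^bsub>W\<^esub> w"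
    using endomorphism_is_smult[OF W.module_axioms w0_closed maximal_smult_w0 socle \<theta>(1)] by blast
  have "\<forall>u\<in>K. s \<odot>\<^bsub>W\<^esub> u = \<zero>\<^bsub>W\<^esub>" using s \<theta>(2) K W.submoduleE(1) by fastforce
  moreover have "s \<odot>\<^bsub>W\<^esub> w \<noteq> \<zero>\<^bsub>W\<^esub>" using s \<theta>(3) wc w0_nonzero by simp
  ultimately show "{r \<in> carrier R. \<forall>u\<in>L. r \<odot>\<^bsub>W\<^esub> u = \<zero>\<^bsub>W\<^esub>} \<subset> {r \<in> carrier R. \<forall>u\<in>K. r \<odot>\<^bsub>W\<^esub> u = \<zero>\<^bsub>W\<^esub>}"
    using \<open>K \<subset> L\<close> w(1) s(1) by blast
qed

end

lemma quotient_module_simps: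
  "carrier (quotient_module R I) = carrier (R Quot I)"
  "X \<oplus>\<^bsub>quotient_module R I\<^esub> Y = X \<oplus>\<^bsub>R Quot I\<^esub> Y"
  "r \<odot>\<^bsub>quotient_module R I\<^esub> X = (I +>\<^bsub>R\<^esub> r) \<otimes>\<^bsub>R Quot I\<^esub> X"
  by (simp_all add: quotient_module_def)

lemma canonical_module_dualizing:
  fixes R :: "('a, 'm) ring_scheme" (structure) and W :: "('a, 'b) module"
  assumes R: "artinian_local_ring R \<mm>" and W: "canonical_module R \<mm> W"
  shows "\<exists>w0. dualizing_module R \<mm> W w0"
proof -
  interpret artinian_local_ring R \<mm> by fact
  have inj: "injective_module R W"
    using W by (simp add: canonical_module_def injective_hull_def)
  then have modW: "module R W" by (simp add: injective_module_def)
  interpret W: module R W by fact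
  let ?Q = "quotient_module R \<mm>"
  obtain i where i: "i \<in> mod_hom R ?Q W" "inj_on i (carrier ?Q)"
    and ess: "\<And>N. submodule N R W \<Longrightarrow> N \<noteq> {\<zero>\<^bsub>W\<^esub>} \<Longrightarrow> N \<inter> i ` carrier ?Q \<noteq> {\<zero>\<^bsub>W\<^esub>}"
    using W unfolding canonical_module_def injective_hull_def by blast
  have mc: "y \<in> carrier R" if "y \<in> \<mm>" for y using that a_subset by blast
  have zc: "\<zero> \<in> carrier R" by simp
  have coset: "\<mm> +> r \<in> carrier ?Q" if "r \<in> carrier R" for r
    using that by (auto simp: quotient_module_simps FactRing_def A_RCOSETS_def')
  have Qc: "\<exists>r\<in>carrier R. X = \<mm> +> r" if "X \<in> carrier ?Q" for X
    using that by (auto simp: quotient_module_simps FactRing_def A_RCOSETS_def')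
  define w0 where "w0 = i (\<mm> +> \<one>)"
  have w0: "w0 \<in> carrier W" unfolding w0_def by (intro mod_homD(1)[OF i(1)] coset one_closed)
  have iw0: "i (\<mm> +> r) = r \<odot>\<^bsub>W\<^esub> w0" if r: "r \<in> carrier R" for r
  proof -
    have "r \<odot>\<^bsub>?Q\<^esub> (\<mm> +> \<one>) = \<mm> +> r"
      using r rcoset_mult_add[OF r one_closed] by (simp add: quotient_module_simps FactRing_def)
    then show ?thesis
      using mod_homD(3)[OF i(1) r coset[OF one_closed]] by (simp add: w0_def)
  qed
  have eq: "r \<odot>\<^bsub>W\<^esub> w0 = \<zero>\<^bsub>W\<^esub> \<longleftrightarrow> r \<in> \<mm>" if r: "r \<in> carrier R" for r
  proof -
    have "r \<odot>\<^bsub>W\<^esub> w0 = \<zero>\<^bsub>W\<^esub> \<longleftrightarrow> i (\<mm> +> r) = i (\<mm> +> \<zero>)"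
      using r w0 by (simp add: iw0)
    also have "\<dots> \<longleftrightarrow> \<mm> +> r = \<mm> +> \<zero>"
      using inj_onD[OF i(2) _ coset[OF r] coset[OF zc]] by (auto simp only:)
    also have "\<dots> \<longleftrightarrow> r \<in> \<mm>"
      using quotient_eq_iff_same_a_r_cos[OF is_ideal r zc] r by (simp add: minus_eq)
    finally show ?thesis .
  qed
  have "dualizing_module R \<mm> W w0"
  proof (intro dualizing_module.intro dualizing_module_axioms.intro R modW inj w0)
    show "w0 \<noteq> \<zero>\<^bsub>W\<^esub>" using eq[OF one_closed] w0 one_notin_maximal by simp
    show "y \<odot>\<^bsub>W\<^esub> w0 = \<zero>\<^bsub>W\<^esub>" if "y \<in> \<mm>" for y using eq[OF mc[OF that]] that by simp
    fix w assume w: "w \<in> carrier W" "w \<noteq> \<zero>\<^bsub>W\<^esub>"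
    \<comment> \<open>Essentiality is applied to the cyclic submodule \<open>R w\<close>. It yields
      a nonzero element \<open>r w = s w0\<close>, and such an \<open>s\<close> is a unit.\<close>
    let ?N = "(\<lambda>r. r \<odot>\<^bsub>W\<^esub> w) ` carrier R"
    have N: "submodule ?N R W"
    proof (rule W.submoduleI)
      show "?N \<subseteq> carrier W" using w by auto
      show "\<zero>\<^bsub>W\<^esub> \<in> ?N" using w by (intro image_eqI[of _ _ \<zero>]) simp_all
      fix a assume "a \<in> ?N"
      then obtain r where r: "r \<in> carrier R" "a = r \<odot>\<^bsub>W\<^esub> w" by blast
      show "\<ominus>\<^bsub>W\<^esub> a \<in> ?N"
        using r w by (intro image_eqI[of _ _ "\<ominus> r"]) (simp_all add: W.smult_l_minus)
      show "s \<odot>\<^bsub>W\<^esub> a \<in> ?N" if "s \<in> carrier R" for s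
        using r w that by (intro image_eqI[of _ _ "s \<otimes> r"]) (simp_all add: W.smult_assoc1)
      fix b assume "b \<in> ?N"
      then obtain s where s: "s \<in> carrier R" "b = s \<odot>\<^bsub>W\<^esub> w" by blast
      show "a \<oplus>\<^bsub>W\<^esub> b \<in> ?N"
        using r s w by (intro image_eqI[of _ _ "r \<oplus> s"]) (simp_all add: W.smult_l_distr)
    qed
    have "w \<in> ?N" using w by (intro image_eqI[of _ _ \<one>]) simp_all
    then have "?N \<noteq> {\<zero>\<^bsub>W\<^esub>}" using w by blast
    then have "?N \<inter> i ` carrier ?Q \<noteq> {\<zero>\<^bsub>W\<^esub>}" by (rule ess[OF N])
    \<comment> \<open>Zero lies in both sets, so an intersection different from
      \<open>{\<zero>}\<close> is not empty and has a nonzero element.\<close>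
    moreover have "\<zero>\<^bsub>W\<^esub> \<in> i ` carrier ?Q"
      using iw0[OF zc] w0 coset[OF zc] by (metis W.smult_l_null image_eqI)
    moreover have "\<zero>\<^bsub>W\<^esub> \<in> ?N" using w by (intro image_eqI[of _ _ \<zero>]) simp_all
    ultimately obtain z where z: "z \<in> ?N" "z \<in> i ` carrier ?Q" "z \<noteq> \<zero>\<^bsub>W\<^esub>" by blast
    then obtain r X where r: "r \<in> carrier R" "z = r \<odot>\<^bsub>W\<^esub> w" and X: "X \<in> carrier ?Q" "z = i X"
      by blast
    obtain s where s: "s \<in> carrier R" "X = \<mm> +> s" using Qc[OF X(1)] by blast
    have zs: "z = s \<odot>\<^bsub>W\<^esub> w0" using X(2) s iw0 by simp
    then have "s \<notin> \<mm>" using z(3) eq[OF s(1)] by blast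
    then obtain v where v: "v \<in> carrier R" "v \<otimes> s = \<one>" using unit_inverse s(1) by blast
    have "(v \<otimes> r) \<odot>\<^bsub>W\<^esub> w = v \<odot>\<^bsub>W\<^esub> (s \<odot>\<^bsub>W\<^esub> w0)"
      using zs r(2) W.smult_assoc1[OF v(1) r(1) w(1)] by simp
    also have "\<dots> = w0" using W.smult_assoc1[OF v(1) s(1) w0] v w0 by simp
    finally show "\<exists>r\<in>carrier R. r \<odot>\<^bsub>W\<^esub> w = w0" using v r by blast
  qed
  then show ?thesis ..
qed

text \<open>The class of \<open>r\<close> goes to \<open>r w0\<close>: independent of the
  representative because \<open>\<mm>\<close> kills \<open>w0\<close>, injective because units do
  not. This direction is applied to the cover as a module over itself.\<close>

lemma (in dualizing_module) canonical: "canonical_module R \<mm> W"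
proof -
  let ?Q = "quotient_module R \<mm>"
  define i where "i = (\<lambda>X. (SOME s. s \<in> X) \<odot>\<^bsub>W\<^esub> w0)"
  have coset: "\<mm> +> r \<in> carrier ?Q" if "r \<in> carrier R" for r
    using that by (auto simp: quotient_module_simps FactRing_def A_RCOSETS_def')
  have Qc: "\<exists>r\<in>carrier R. X = \<mm> +> r" if "X \<in> carrier ?Q" for X
    using that by (auto simp: quotient_module_simps FactRing_def A_RCOSETS_def')
  have i: "i (\<mm> +> r) = r \<odot>\<^bsub>W\<^esub> w0" if r: "r \<in> carrier R" for r
  proof -
    have "(SOME s. s \<in> \<mm> +> r) \<in> \<mm> +> r" using a_rcos_self[OF r] by (rule someI)
    then obtain y where y: "y \<in> \<mm>" "(SOME s. s \<in> \<mm> +> r) = y \<oplus> r"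
      by (auto simp: a_r_coset_def')
    then show ?thesis
      unfolding i_def using r m_carrier by (simp add: W.smult_l_distr maximal_smult_w0)
  qed
  have "i \<in> mod_hom R ?Q W"
    unfolding mod_hom_def
  proof (intro CollectI conjI ballI funcsetI)
    fix X assume "X \<in> carrier ?Q"
    then show "i X \<in> carrier W" using Qc i by fastforce
  next
    fix X Y assume "X \<in> carrier ?Q" "Y \<in> carrier ?Q"
    then obtain r s where "r \<in> carrier R" "X = \<mm> +> r" "s \<in> carrier R" "Y = \<mm> +> s"
      using Qc by meson
    then show "i (X \<oplus>\<^bsub>?Q\<^esub> Y) = i X \<oplus>\<^bsub>W\<^esub> i Y"
      using i by (simp add: quotient_module_simps FactRing_def a_rcos_sum W.smult_l_distr)
  next
    fix s X assume "s \<in> carrier R" "X \<in> carrier ?Q"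
    moreover from this obtain r where "r \<in> carrier R" "X = \<mm> +> r" using Qc by meson
    ultimately show "i (s \<odot>\<^bsub>?Q\<^esub> X) = s \<odot>\<^bsub>W\<^esub> i X"
      using i by (simp add: quotient_module_simps FactRing_def rcoset_mult_add W.smult_assoc1)
  qed
  moreover have "inj_on i (carrier ?Q)"
  proof (rule inj_onI)
    fix X Y assume "X \<in> carrier ?Q" "Y \<in> carrier ?Q" and eq: "i X = i Y"
    then obtain r s where r: "r \<in> carrier R" "X = \<mm> +> r" and s: "s \<in> carrier R" "Y = \<mm> +> s"
      using Qc by meson
    have "r \<odot>\<^bsub>W\<^esub> w0 = s \<odot>\<^bsub>W\<^esub> w0" using eq i r s by simp
    then have z: "(r \<ominus> s) \<odot>\<^bsub>W\<^esub> w0 = \<zero>\<^bsub>W\<^esub>"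
      using r s by (simp add: minus_eq W.smult_l_distr W.smult_l_minus W.r_neg)
    have "r \<ominus> s \<in> \<mm>"
    proof (rule ccontr)
      assume "r \<ominus> s \<notin> \<mm>"
      then obtain v where "v \<in> carrier R" "v \<odot>\<^bsub>W\<^esub> ((r \<ominus> s) \<odot>\<^bsub>W\<^esub> w0) = w0"
        using smult_cancel_unit[of "r \<ominus> s" w0] r s by auto
      then show False using z w0_nonzero by simp
    qed
    then show "X = Y" using quotient_eq_iff_same_a_r_cos[OF is_ideal] r s by simp
  qed
  moreover have "N \<inter> i ` carrier ?Q \<noteq> {\<zero>\<^bsub>W\<^esub>}"
    if N: "submodule N R W" "N \<noteq> {\<zero>\<^bsub>W\<^esub>}" for N
  proof -
    note Ns = W.submoduleE[OF N(1)]
    obtain w where w: "w \<in> N" "w \<noteq> \<zero>\<^bsub>W\<^esub>" using N(2) Ns(2) by blast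
    then obtain r where "r \<in> carrier R" "r \<odot>\<^bsub>W\<^esub> w = w0" using essential Ns(1) by blast
    then have "w0 \<in> N" using Ns(4) w(1) by metis
    moreover have "w0 \<in> i ` carrier ?Q"
      using i[OF one_closed] coset[OF one_closed] by (metis W.smult_one w0_closed image_eqI)
    ultimately show ?thesis using w0_nonzero by blast
  qed
  ultimately show ?thesis
    unfolding canonical_module_def injective_hull_def using injective by blast
qed

section \<open>Gorenstein covers\<close>

text \<open>Bounded chains give both chain conditions. The ascending one is obtained through unions
  of chains: a chain missing its union would contain an endless strictly increasing
  sequence.\<close>

lemma artinian_local_ringI:
  assumes S: "cring S" and b: "chains_bounded {J. ideal J S} N"
    and \<nn>: "maximalideal \<nn> S" "\<And>J. maximalideal J S \<Longrightarrow> J = \<nn>"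
  shows "artinian_local_ring S \<nn>"
proof -
  interpret cring S by fact
  have "noetherian_ring S"
  proof (rule trivial_ideal_chain_imp_noetherian)
    fix C assume C: "C \<noteq> {}" "subset.chain {J. ideal J S} C"
    have id: "ideal I S" if "I \<in> C" for I using C(2) that by (auto simp: subset_chain_def)
    show "\<Union>C \<in> C"
    proof (rule ccontr)
      assume no: "\<Union>C \<notin> C"
      have step: "\<exists>J. J \<in> C \<and> I \<subset> J" if "I \<in> C" for I
      proof -
        have "\<not> \<Union>C \<subseteq> I" using no that by (metis Union_upper subset_antisym)
        then obtain J where J: "J \<in> C" "\<not> J \<subseteq> I" by blast
        then have "I \<subseteq> J" using C(2) that by (auto simp: subset_chain_def)
        then show ?thesis using J by blast
      qed
      have "\<exists>I. \<forall>n::nat. I n \<in> C \<and> I n \<subset> I (Suc n)"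
      proof (rule dependent_nat_choice)
        show "\<exists>I. I \<in> C" using C(1) by blast
        show "\<exists>J. J \<in> C \<and> I \<subset> J" if "I \<in> C" for I n using step[OF that] .
      qed
      then obtain I where I: "\<And>n::nat. I n \<in> C" "\<And>n. I n \<subset> I (Suc n)" by blast
      have "\<exists>n. \<forall>k\<ge>n. I k = I n"
        using I id by (intro chains_bounded_stationary[OF b]) blast+
      then obtain n where n: "\<forall>k\<ge>n. I k = I n" by blast
      have "I (Suc n) = I n" by (rule n[rule_format]) simp
      with I(2)[of n] show False by simp
    qed
  qed
  moreover have "\<exists>n. \<forall>k\<ge>n. I k = I n" if "\<And>n::nat. ideal (I n) S" "\<And>n. I (Suc n) \<subseteq> I n" for I
    using that by (intro chains_bounded_stationary[OF b]) auto
  ultimately show ?thesis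
    using S \<nn>
    by (intro artinian_local_ring.intro artinian_local_ring_axioms.intro) blast+
qed

text \<open>
  \<open>\<rho>\<close> is the structure map of \<open>S\<close> as an algebra over the retract, precomposed with \<open>\<tau>\<close>.  The
  conditions are phrased so that they carry over along ring isomorphisms of \<open>S\<close>.
\<close>

locale gorenstein_cover = R: dualizing_module R \<mm> W w0 + S: cring S
  for R :: "('a, 'm) ring_scheme" and \<mm> and W :: "('a, 'b) module" and w0
    and S :: "('s, 'n) ring_scheme" +
  fixes I :: "'a set" and p :: "'s \<Rightarrow> 'a" and \<rho> :: "'a \<Rightarrow> 's" and \<Lambda> :: "'s \<Rightarrow> 'b"
  assumes p_hom: "p \<in> ring_hom S R" and p_surj: "p ` carrier S = carrier R"
    and \<rho>_hom: "\<rho> \<in> ring_hom R S"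
    and I_ideal: "ideal I R" and I_maximal: "I \<subseteq> \<mm>"
    and \<rho>_I: "x \<in> I \<Longrightarrow> \<rho> x = \<zero>\<^bsub>S\<^esub>"
    and p_\<rho>: "r \<in> carrier R \<Longrightarrow> p (\<rho> r) \<ominus>\<^bsub>R\<^esub> r \<in> I"
    and \<Lambda>_closed [simp]: "s \<in> carrier S \<Longrightarrow> \<Lambda> s \<in> carrier W"
    and \<Lambda>_add: "s \<in> carrier S \<Longrightarrow> t \<in> carrier S \<Longrightarrow> \<Lambda> (s \<oplus>\<^bsub>S\<^esub> t) = \<Lambda> s \<oplus>\<^bsub>W\<^esub> \<Lambda> t"
    and \<Lambda>_\<rho>: "r \<in> carrier R \<Longrightarrow> s \<in> carrier S \<Longrightarrow> \<Lambda> (\<rho> r \<otimes>\<^bsub>S\<^esub> s) = r \<odot>\<^bsub>W\<^esub> \<Lambda> s"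
    and \<Lambda>_ker: "s \<in> carrier S \<Longrightarrow> k \<in> carrier S \<Longrightarrow> p k = \<zero>\<^bsub>R\<^esub> \<Longrightarrow> \<Lambda> (s \<otimes>\<^bsub>S\<^esub> k) = p s \<odot>\<^bsub>W\<^esub> \<Lambda> k"
    and nondegenerate: "s \<in> carrier S \<Longrightarrow> (\<And>t. t \<in> carrier S \<Longrightarrow> \<Lambda> (t \<otimes>\<^bsub>S\<^esub> s) = \<zero>\<^bsub>W\<^esub>) \<Longrightarrow> s = \<zero>\<^bsub>S\<^esub>"
begin

sublocale p: ring_hom_ring S R p
  by (rule ring_hom_ringI2[OF S.ring_axioms R.ring_axioms p_hom])

sublocale \<rho>: ring_hom_ring R S \<rho>
  by (rule ring_hom_ringI2[OF R.ring_axioms S.ring_axioms \<rho>_hom])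

definition \<nn> :: "'s set" where "\<nn> = {s \<in> carrier S. p s \<in> \<mm>}"

lemma p_lift:
  assumes "r \<in> carrier R"
  obtains s where "s \<in> carrier S" "p s = r"
proof -
  have "r \<in> p ` carrier S" unfolding p_surj by (rule assms)
  then show thesis using that by blast
qed

lemma \<Lambda>_zero: "\<Lambda> \<zero>\<^bsub>S\<^esub> = \<zero>\<^bsub>W\<^esub>"
  using \<Lambda>_\<rho>[of "\<zero>\<^bsub>R\<^esub>" "\<zero>\<^bsub>S\<^esub>"] by simp

lemma \<Lambda>_minus:
  assumes "s \<in> carrier S" "t \<in> carrier S"
  shows "\<Lambda> (s \<ominus>\<^bsub>S\<^esub> t) = \<Lambda> s \<ominus>\<^bsub>W\<^esub> \<Lambda> t"
proof -
  have "\<Lambda> s = \<Lambda> ((s \<ominus>\<^bsub>S\<^esub> t) \<oplus>\<^bsub>S\<^esub> t)"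
    using assms by (simp add: S.minus_eq S.a_assoc S.l_neg)
  also have "\<dots> = \<Lambda> (s \<ominus>\<^bsub>S\<^esub> t) \<oplus>\<^bsub>W\<^esub> \<Lambda> t"
    using assms by (simp add: \<Lambda>_add)
  finally show ?thesis
    using assms by (simp add: R.W.minus_eq R.W.a_assoc R.W.r_neg)
qed

lemma eq_if_\<Lambda>_eq:
  assumes st: "s \<in> carrier S" "t \<in> carrier S"
    and eq: "\<And>u. u \<in> carrier S \<Longrightarrow> \<Lambda> (u \<otimes>\<^bsub>S\<^esub> s) = \<Lambda> (u \<otimes>\<^bsub>S\<^esub> t)"
  shows "s = t"
proof -
  have "\<Lambda> (u \<otimes>\<^bsub>S\<^esub> (s \<ominus>\<^bsub>S\<^esub> t)) = \<zero>\<^bsub>W\<^esub>" if u: "u \<in> carrier S" for u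
  proof -
    have "u \<otimes>\<^bsub>S\<^esub> (s \<ominus>\<^bsub>S\<^esub> t) = u \<otimes>\<^bsub>S\<^esub> s \<ominus>\<^bsub>S\<^esub> u \<otimes>\<^bsub>S\<^esub> t"
      using st u by (simp add: S.minus_eq S.r_distr S.r_minus)
    then show ?thesis
      using st u eq[OF u] by (simp add: \<Lambda>_minus R.W.minus_eq R.W.r_neg)
  qed
  then have "s \<ominus>\<^bsub>S\<^esub> t = \<zero>\<^bsub>S\<^esub>" using st by (intro nondegenerate) auto
  then show ?thesis using st by simp
qed

text \<open>On the kernel of \<open>p\<close> the pairing is
  \<open>\<Lambda> (s k) = p s \<odot> \<Lambda> k\<close>. Hence \<open>\<Lambda>\<close> is
  injective there and identifies the kernel with a submodule of \<open>W\<close>.\<close>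

lemma ker_eq_zero:
  assumes k: "k \<in> carrier S" "p k = \<zero>\<^bsub>R\<^esub>" "\<Lambda> k = \<zero>\<^bsub>W\<^esub>"
  shows "k = \<zero>\<^bsub>S\<^esub>"
  by (rule nondegenerate[OF k(1)]) (simp add: \<Lambda>_ker k)

lemma ker_square_zero:
  assumes k: "k \<in> carrier S" "p k = \<zero>\<^bsub>R\<^esub>" and l: "l \<in> carrier S" "p l = \<zero>\<^bsub>R\<^esub>"
  shows "k \<otimes>\<^bsub>S\<^esub> l = \<zero>\<^bsub>S\<^esub>"
  by (rule ker_eq_zero) (simp_all add: \<Lambda>_ker k l)

text \<open>An inverse of \<open>p s\<close> lifts to some \<open>u\<close> with
  \<open>u s = 1 + k\<close>, where \<open>k\<close> is in the kernel of \<open>p\<close>. As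
  \<open>k\<close> squares to zero, the factor \<open>1 - k\<close> repairs the error.\<close>

lemma unit_if_p_unit:
  assumes s: "s \<in> carrier S" "p s \<notin> \<mm>"
  obtains u where "u \<in> carrier S" "u \<otimes>\<^bsub>S\<^esub> s = \<one>\<^bsub>S\<^esub>"
proof -
  obtain v where v: "v \<in> carrier R" "v \<otimes>\<^bsub>R\<^esub> p s = \<one>\<^bsub>R\<^esub>" 
    by (rule R.unit_inverse[OF p.hom_closed[OF s(1)] s(2)])
  obtain u where u: "u \<in> carrier S" "p u = v" using p_lift[OF v(1)] .
  define k where "k = u \<otimes>\<^bsub>S\<^esub> s \<ominus>\<^bsub>S\<^esub> \<one>\<^bsub>S\<^esub>"
  have k: "k \<in> carrier S" "p k = \<zero>\<^bsub>R\<^esub>"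
    using u v s by (simp_all add: k_def S.minus_eq R.r_neg)
  have us: "u \<otimes>\<^bsub>S\<^esub> s = \<one>\<^bsub>S\<^esub> \<oplus>\<^bsub>S\<^esub> k"
    using u s unfolding k_def by algebra
  have "(\<one>\<^bsub>S\<^esub> \<ominus>\<^bsub>S\<^esub> k) \<otimes>\<^bsub>S\<^esub> u \<otimes>\<^bsub>S\<^esub> s = (\<one>\<^bsub>S\<^esub> \<ominus>\<^bsub>S\<^esub> k) \<otimes>\<^bsub>S\<^esub> (\<one>\<^bsub>S\<^esub> \<oplus>\<^bsub>S\<^esub> k)"
    using u s k by (simp add: S.m_assoc us)
  also have "\<dots> = \<one>\<^bsub>S\<^esub> \<ominus>\<^bsub>S\<^esub> k \<otimes>\<^bsub>S\<^esub> k"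
    using k by algebra
  also have "\<dots> = \<one>\<^bsub>S\<^esub>" using ker_square_zero[OF k k] by (simp add: S.minus_eq)
  finally show thesis using u k that[of "(\<one>\<^bsub>S\<^esub> \<ominus>\<^bsub>S\<^esub> k) \<otimes>\<^bsub>S\<^esub> u"] by simp
qed

lemma \<nn>_ideal: "ideal \<nn> S"
  unfolding \<nn>_def by (rule p.ideal_vimage[OF R.is_ideal])

lemma ideal_eq_carrier_if_unit:
  assumes J: "ideal J S" and s: "s \<in> J" "s \<notin> \<nn>"
  shows "J = carrier S"
proof -
  have sc: "s \<in> carrier S" using ideal.Icarr[OF J s(1)] .
  then have "p s \<notin> \<mm>" using s by (simp add: \<nn>_def)
  then obtain u where "u \<in> carrier S" "u \<otimes>\<^bsub>S\<^esub> s = \<one>\<^bsub>S\<^esub>" using unit_if_p_unit[OF sc] by blast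
  then have "\<one>\<^bsub>S\<^esub> \<in> J" using ideal.I_l_closed[OF J s(1)] by metis
  then show ?thesis by (rule ideal.one_imp_carrier[OF J])
qed

lemma \<nn>_maximal: "maximalideal \<nn> S"
proof (rule maximalidealI[OF \<nn>_ideal])
  show "carrier S \<noteq> \<nn>" using R.one_notin_maximal p.hom_one S.one_closed unfolding \<nn>_def by force
  fix J assume "ideal J S" "\<nn> \<subseteq> J"
  then show "J = \<nn> \<or> J = carrier S" using ideal_eq_carrier_if_unit by blast
qed

lemma \<nn>_unique:
  assumes "maximalideal J S"
  shows "J = \<nn>"
proof -
  have J: "ideal J S" "J \<noteq> carrier S"
    using assms maximalideal.axioms(1) maximalideal.I_notcarr by auto
  then have "J \<subseteq> \<nn>" using ideal_eq_carrier_if_unit by blast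
  moreover have "\<nn> \<noteq> carrier S" using maximalideal.I_notcarr[OF \<nn>_maximal] by blast
  moreover have "\<nn> \<subseteq> carrier S" by (auto simp: \<nn>_def)
  ultimately show ?thesis using maximalideal.I_maximal[OF assms \<nn>_ideal] by blast
qed

lemma ideal_image:
  assumes J: "ideal J S"
  shows "ideal (p ` J) R"
proof (rule idealI[OF R.ring_axioms])
  show "subgroup (p ` J) (add_monoid R)"
    by (rule p.img_is_add_subgroup[OF additive_subgroup.a_subgroup[OF ideal.axioms(1)[OF J]]])
  fix a x assume "a \<in> p ` J" and x: "x \<in> carrier R"
  then obtain j where j: "j \<in> J" "a = p j" by blast
  have jc: "j \<in> carrier S" using ideal.Icarr[OF J j(1)] .
  obtain s where s: "s \<in> carrier S" "p s = x" using p_lift[OF x] .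
  have "x \<otimes>\<^bsub>R\<^esub> a = p (s \<otimes>\<^bsub>S\<^esub> j)" "a \<otimes>\<^bsub>R\<^esub> x = p (j \<otimes>\<^bsub>S\<^esub> s)" using s j jc by simp_all
  moreover have "s \<otimes>\<^bsub>S\<^esub> j \<in> J" "j \<otimes>\<^bsub>S\<^esub> s \<in> J"
    using ideal.I_l_closed[OF J j(1) s(1)] ideal.I_r_closed[OF J j(1) s(1)] by simp_all
  ultimately show "x \<otimes>\<^bsub>R\<^esub> a \<in> p ` J" "a \<otimes>\<^bsub>R\<^esub> x \<in> p ` J" by blast+
qed

text \<open>An ideal of \<open>S\<close> is measured by its image in \<open>R\<close> and its
  intersection with the kernel of \<open>p\<close>. The latter is moved into \<open>W\<close> by
  \<open>\<Lambda>\<close>, where it is killed by \<open>I\<close>, so that the bound by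
  annihilators applies.\<close>

lemma chains_bounded_ideals:
  assumes N: "chains_bounded {J. ideal J R} N" and b: "chains_bounded {J. ideal J R \<and> I \<subseteq> J} b"
  shows "chains_bounded {J. ideal J S} (b + N)"
proof (rule chains_bounded_add[where f = "\<lambda>J. \<Lambda> ` {k \<in> J. p k = \<zero>\<^bsub>R\<^esub>}" and g = "\<lambda>J. p ` J"])
  show "chains_bounded {K. submodule K R W \<and> (\<forall>x\<in>I. \<forall>u\<in>K. x \<odot>\<^bsub>W\<^esub> u = \<zero>\<^bsub>W\<^esub>)} b"
    using b ideal.Icarr[OF I_ideal] by (intro R.chains_bounded_submodules) auto
  show "chains_bounded {J. ideal J R} N" by fact
next
  fix K assume "K \<in> {J. ideal J S}"
  then interpret K: ideal K S by simp
  let ?K = "{k \<in> K. p k = \<zero>\<^bsub>R\<^esub>}"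
  have Kc: "k \<in> carrier S" if "k \<in> ?K" for k using that K.Icarr by simp
  have I: "x \<odot>\<^bsub>W\<^esub> \<Lambda> k = \<zero>\<^bsub>W\<^esub>" if "x \<in> I" "k \<in> ?K" for x k
    using \<Lambda>_\<rho>[OF ideal.Icarr[OF I_ideal that(1)] Kc[OF that(2)]] \<rho>_I[OF that(1)] Kc[OF that(2)] \<Lambda>_zero
    by simp
  have sm: "r \<odot>\<^bsub>W\<^esub> \<Lambda> k \<in> \<Lambda> ` ?K" if r: "r \<in> carrier R" and k: "k \<in> ?K" for r k
  proof (rule image_eqI)
    show "r \<odot>\<^bsub>W\<^esub> \<Lambda> k = \<Lambda> (\<rho> r \<otimes>\<^bsub>S\<^esub> k)" using \<Lambda>_\<rho> r Kc k by simp
    show "\<rho> r \<otimes>\<^bsub>S\<^esub> k \<in> ?K" using r k Kc K.I_l_closed by simp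
  qed
  have "submodule (\<Lambda> ` ?K) R W"
  proof (rule R.W.submoduleI)
    show "\<Lambda> ` ?K \<subseteq> carrier W" using Kc \<Lambda>_closed by blast
    have "\<zero>\<^bsub>S\<^esub> \<in> ?K" using K.zero_closed by simp
    then show "\<zero>\<^bsub>W\<^esub> \<in> \<Lambda> ` ?K" using \<Lambda>_zero by (metis image_eqI)
    fix a assume "a \<in> \<Lambda> ` ?K"
    then obtain k where k: "k \<in> ?K" "a = \<Lambda> k" by blast
    show "r \<odot>\<^bsub>W\<^esub> a \<in> \<Lambda> ` ?K" if "r \<in> carrier R" for r
      using sm[OF that k(1)] k(2) by simp
    have "\<ominus>\<^bsub>W\<^esub> a = (\<ominus>\<^bsub>R\<^esub> \<one>\<^bsub>R\<^esub>) \<odot>\<^bsub>W\<^esub> \<Lambda> k"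
      using k Kc by (simp add: R.W.smult_l_minus)
    also have "\<dots> \<in> \<Lambda> ` ?K" by (rule sm[OF _ k(1)]) simp
    finally show "\<ominus>\<^bsub>W\<^esub> a \<in> \<Lambda> ` ?K" .
    fix b assume "b \<in> \<Lambda> ` ?K"
    then obtain l where l: "l \<in> ?K" "b = \<Lambda> l" by blast
    show "a \<oplus>\<^bsub>W\<^esub> b \<in> \<Lambda> ` ?K"
    proof (rule image_eqI)
      show "a \<oplus>\<^bsub>W\<^esub> b = \<Lambda> (k \<oplus>\<^bsub>S\<^esub> l)" using k(2) l(2) \<Lambda>_add[OF Kc[OF k(1)] Kc[OF l(1)]] by simp
      show "k \<oplus>\<^bsub>S\<^esub> l \<in> ?K" using k(1) l(1) Kc K.a_closed by simp
    qed
  qed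
  then show "\<Lambda> ` ?K \<in> {K. submodule K R W \<and> (\<forall>x\<in>I. \<forall>u\<in>K. x \<odot>\<^bsub>W\<^esub> u = \<zero>\<^bsub>W\<^esub>)}"
    using I by auto
next
  fix K L assume K: "K \<in> {J. ideal J S}" and L: "L \<in> {J. ideal J S}" and "K \<subset> L"
  interpret K: ideal K S using K by simp
  interpret L: ideal L S using L by simp
  show "\<Lambda> ` {k \<in> K. p k = \<zero>\<^bsub>R\<^esub>} \<noteq> \<Lambda> ` {k \<in> L. p k = \<zero>\<^bsub>R\<^esub>} \<or> p ` K \<noteq> p ` L"
  proof (rule ccontr)
    assume "\<not> ?thesis"
    then have eq: "\<Lambda> ` {k \<in> K. p k = \<zero>\<^bsub>R\<^esub>} = \<Lambda> ` {k \<in> L. p k = \<zero>\<^bsub>R\<^esub>}" "p ` K = p ` L"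
      by simp_all
    obtain l where l: "l \<in> L" "l \<notin> K" using \<open>K \<subset> L\<close> by blast
    have "p l \<in> p ` K" unfolding eq(2) using l(1) by (rule imageI)
    then obtain k where k: "k \<in> K" "p l = p k" by blast
    have kc: "k \<in> carrier S" "l \<in> carrier S" using k l K.Icarr L.Icarr by auto
    \<comment> \<open>The difference lies in the kernel part of \<open>L\<close>; this is also the
      kernel part of \<open>K\<close>, because the images under \<open>\<Lambda>\<close> agree and
      \<open>\<Lambda>\<close> is injective on the kernel.\<close>
    define d where "d = l \<ominus>\<^bsub>S\<^esub> k"
    have d: "d \<in> carrier S" "p d = \<zero>\<^bsub>R\<^esub>" using kc k(2) by (simp_all add: d_def S.minus_eq R.r_neg)
    have "d \<in> L"
      unfolding d_def S.minus_eq using l(1) k(1) \<open>K \<subset> L\<close> L.a_inv_closed by (intro L.a_closed) auto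
    then have "\<Lambda> d \<in> \<Lambda> ` {k \<in> K. p k = \<zero>\<^bsub>R\<^esub>}" unfolding eq(1) using d by blast
    then obtain k' where k': "k' \<in> K" "p k' = \<zero>\<^bsub>R\<^esub>" "\<Lambda> d = \<Lambda> k'" by blast
    have k'c: "k' \<in> carrier S" using k' K.Icarr by auto
    have "d \<ominus>\<^bsub>S\<^esub> k' = \<zero>\<^bsub>S\<^esub>"
    proof (rule ker_eq_zero)
      show "d \<ominus>\<^bsub>S\<^esub> k' \<in> carrier S" using d k'c by simp
      show "p (d \<ominus>\<^bsub>S\<^esub> k') = \<zero>\<^bsub>R\<^esub>" using d k' k'c by (simp add: S.minus_eq)
      show "\<Lambda> (d \<ominus>\<^bsub>S\<^esub> k') = \<zero>\<^bsub>W\<^esub>" using d k' k'c by (simp add: \<Lambda>_minus R.W.minus_eq R.W.r_neg)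
    qed
    then have dk: "d = k'" using d k'c by simp
    have "l = d \<oplus>\<^bsub>S\<^esub> k" using kc by (simp add: d_def S.minus_eq S.a_assoc S.l_neg)
    also have "\<dots> \<in> K" unfolding dk using k'(1) k(1) by (rule K.a_closed)
    finally show False using l by simp
  qed
qed (use ideal_image in auto)

lemma artinian_local:
  assumes b: "chains_bounded {J. ideal J R \<and> I \<subseteq> J} b"
  shows "artinian_local_ring S \<nn>"
proof -
  obtain N where "chains_bounded {J. ideal J R} N" using R.finite_length by blast
  from chains_bounded_ideals[OF this b] show ?thesis
    by (rule artinian_local_ringI[OF S.is_cring _ \<nn>_maximal \<nn>_unique])
qed

end

section \<open>Restriction of scalars and the coinduced module\<close>

definition restrict_scalars :: "('a \<Rightarrow> 's) \<Rightarrow> ('s, 'c) module \<Rightarrow> ('a, 'c) module" where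
  "restrict_scalars \<rho> M =
     \<lparr>carrier = carrier M, monoid.mult = monoid.mult M, monoid.one = monoid.one M,
      ring.zero = \<zero>\<^bsub>M\<^esub>, ring.add = ring.add M, smult = (\<lambda>r x. \<rho> r \<odot>\<^bsub>M\<^esub> x)\<rparr>"

lemma restrict_scalars_simps [simp]:
  "carrier (restrict_scalars \<rho> M) = carrier M"
  "x \<oplus>\<^bsub>restrict_scalars \<rho> M\<^esub> y = x \<oplus>\<^bsub>M\<^esub> y"
  "\<zero>\<^bsub>restrict_scalars \<rho> M\<^esub> = \<zero>\<^bsub>M\<^esub>"
  "r \<odot>\<^bsub>restrict_scalars \<rho> M\<^esub> x = \<rho> r \<odot>\<^bsub>M\<^esub> x"
  by (simp_all add: restrict_scalars_def)

lemma restrict_scalars_module: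
  assumes R: "cring R" and \<rho>: "\<rho> \<in> ring_hom R S" and M: "module S M"
  shows "module R (restrict_scalars \<rho> M)"
proof -
  interpret M: module S M by fact
  have \<rho>s: "\<rho> r \<in> carrier S" if "r \<in> carrier R" for r using \<rho> that by (rule ring_hom_closed)
  show ?thesis
  proof (rule moduleI[OF R])
    show "abelian_group (restrict_scalars \<rho> M)"
    proof (rule abelian_groupI)
      fix x assume "x \<in> carrier (restrict_scalars \<rho> M)"
      then show "\<exists>y\<in>carrier (restrict_scalars \<rho> M).
          y \<oplus>\<^bsub>restrict_scalars \<rho> M\<^esub> x = \<zero>\<^bsub>restrict_scalars \<rho> M\<^esub>"
        by (intro bexI[of _ "\<ominus>\<^bsub>M\<^esub> x"]) (simp_all add: M.M.l_neg)
    qed (simp_all add: M.M.a_ac)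
  qed (use \<rho>s \<rho> in \<open>auto simp: M.smult_l_distr M.smult_r_distr M.smult_assoc1 ring_hom_add ring_hom_mult ring_hom_one\<close>)
qed

lemma regular_module_simps [simp]:
  "carrier (regular_module S) = carrier S"
  "x \<oplus>\<^bsub>regular_module S\<^esub> y = x \<oplus>\<^bsub>S\<^esub> y"
  "\<zero>\<^bsub>regular_module S\<^esub> = \<zero>\<^bsub>S\<^esub>"
  "x \<odot>\<^bsub>regular_module S\<^esub> y = x \<otimes>\<^bsub>S\<^esub> y"
  by (simp_all add: ideal_module_def)

context gorenstein_cover
begin

text \<open>The right adjoint of restriction of scalars along \<open>\<rho>\<close>, applied to
  \<open>W\<close>; \<open>S\<close> acts on the argument. As \<open>\<rho>\<close> kills
  \<open>I\<close>, all values are killed by \<open>I\<close>, so this is the module Hom over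
  \<open>T\<close> from \<open>S\<close> to \<open>E\<close> in disguise.\<close>

definition coinduced :: "('s, 's \<Rightarrow> 'b) module" where
  "coinduced =
     \<lparr>carrier = mod_hom R (restrict_scalars \<rho> (regular_module S)) W \<inter> extensional (carrier S),
      monoid.mult = undefined, monoid.one = undefined,
      ring.zero = (\<lambda>s\<in>carrier S. \<zero>\<^bsub>W\<^esub>),
      ring.add = (\<lambda>\<phi> \<psi>. \<lambda>s\<in>carrier S. \<phi> s \<oplus>\<^bsub>W\<^esub> \<psi> s),
      smult = (\<lambda>t \<phi>. \<lambda>s\<in>carrier S. \<phi> (s \<otimes>\<^bsub>S\<^esub> t))\<rparr>"

lemma coinduced_carrier_iff:
  "\<phi> \<in> carrier coinduced \<longleftrightarrow> \<phi> \<in> extensional (carrier S) \<and>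
     (\<forall>s\<in>carrier S. \<phi> s \<in> carrier W) \<and>
     (\<forall>s\<in>carrier S. \<forall>t\<in>carrier S. \<phi> (s \<oplus>\<^bsub>S\<^esub> t) = \<phi> s \<oplus>\<^bsub>W\<^esub> \<phi> t) \<and>
     (\<forall>r\<in>carrier R. \<forall>s\<in>carrier S. \<phi> (\<rho> r \<otimes>\<^bsub>S\<^esub> s) = r \<odot>\<^bsub>W\<^esub> \<phi> s)"
  by (auto simp: coinduced_def mod_hom_def)

lemma coinducedD:
  assumes "\<phi> \<in> carrier coinduced"
  shows "s \<in> carrier S \<Longrightarrow> \<phi> s \<in> carrier W"
    and "s \<in> carrier S \<Longrightarrow> t \<in> carrier S \<Longrightarrow> \<phi> (s \<oplus>\<^bsub>S\<^esub> t) = \<phi> s \<oplus>\<^bsub>W\<^esub> \<phi> t"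
    and "r \<in> carrier R \<Longrightarrow> s \<in> carrier S \<Longrightarrow> \<phi> (\<rho> r \<otimes>\<^bsub>S\<^esub> s) = r \<odot>\<^bsub>W\<^esub> \<phi> s"
  using assms by (auto simp: coinduced_carrier_iff)

lemma coinduced_eqI:
  assumes "\<phi> \<in> carrier coinduced" "\<psi> \<in> carrier coinduced"
    and "\<And>s. s \<in> carrier S \<Longrightarrow> \<phi> s = \<psi> s"
  shows "\<phi> = \<psi>"
  using assms by (auto simp: coinduced_carrier_iff intro: extensionalityI)

lemma coinduced_apply:
  assumes "s \<in> carrier S"
  shows "\<zero>\<^bsub>coinduced\<^esub> s = \<zero>\<^bsub>W\<^esub>"
    and "(\<phi> \<oplus>\<^bsub>coinduced\<^esub> \<psi>) s = \<phi> s \<oplus>\<^bsub>W\<^esub> \<psi> s"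
    and "(t \<odot>\<^bsub>coinduced\<^esub> \<phi>) s = \<phi> (s \<otimes>\<^bsub>S\<^esub> t)"
  using assms by (simp_all add: coinduced_def)

lemma coinduced_zero_closed: "\<zero>\<^bsub>coinduced\<^esub> \<in> carrier coinduced"
  unfolding coinduced_carrier_iff by (auto simp: coinduced_def)

lemma coinduced_add_closed:
  assumes "\<phi> \<in> carrier coinduced" "\<psi> \<in> carrier coinduced"
  shows "\<phi> \<oplus>\<^bsub>coinduced\<^esub> \<psi> \<in> carrier coinduced"
  unfolding coinduced_carrier_iff
  using coinducedD[OF assms(1)] coinducedD[OF assms(2)]
  by (auto simp: coinduced_def R.W.a_ac R.W.smult_r_distr)

lemma coinduced_smult_closed:
  assumes "t \<in> carrier S" "\<phi> \<in> carrier coinduced"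
  shows "t \<odot>\<^bsub>coinduced\<^esub> \<phi> \<in> carrier coinduced"
  unfolding coinduced_carrier_iff
  using coinducedD[OF assms(2)] assms(1)
  by (auto simp: coinduced_def S.l_distr S.m_assoc)

lemma coinduced_module: "module S coinduced"
proof (rule moduleI[OF S.is_cring])
  note closed = coinduced_zero_closed coinduced_add_closed coinduced_smult_closed
  show "abelian_group coinduced"
  proof (rule abelian_groupI)
    fix \<phi> assume \<phi>: "\<phi> \<in> carrier coinduced"
    have neg: "(\<lambda>s\<in>carrier S. \<ominus>\<^bsub>W\<^esub> \<phi> s) \<in> carrier coinduced"
      using coinducedD[OF \<phi>]
      by (auto simp: coinduced_carrier_iff R.W.minus_add R.W.smult_r_minus)
    moreover have "(\<lambda>s\<in>carrier S. \<ominus>\<^bsub>W\<^esub> \<phi> s) \<oplus>\<^bsub>coinduced\<^esub> \<phi> = \<zero>\<^bsub>coinduced\<^esub>"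
      by (rule coinduced_eqI[OF closed(2)[OF neg \<phi>] closed(1)])
        (simp add: coinduced_apply coinducedD(1)[OF \<phi>] R.W.l_neg)
    ultimately show "\<exists>\<psi>\<in>carrier coinduced. \<psi> \<oplus>\<^bsub>coinduced\<^esub> \<phi> = \<zero>\<^bsub>coinduced\<^esub>" by blast
  qed (auto intro!: coinduced_eqI closed simp: coinduced_apply coinducedD R.W.a_ac)
qed (auto intro!: coinduced_eqI coinduced_zero_closed coinduced_add_closed coinduced_smult_closed
    simp: coinduced_apply coinducedD S.r_distr S.m_ac)

sublocale E: module S coinduced by (rule coinduced_module)

text \<open>The projection of \<open>S\<close> onto the residue field followed by the inclusion of
  the socle of \<open>W\<close>; it turns out to generate the socle of
  \<open>coinduced\<close>.\<close>

definition \<psi>0 :: "'s \<Rightarrow> 'b" where "\<psi>0 = (\<lambda>s\<in>carrier S. p s \<odot>\<^bsub>W\<^esub> w0)"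

text \<open>\<open>p (\<rho> r)\<close> and \<open>r\<close> differ by an element of
  \<open>I\<close>, hence of \<open>\<mm>\<close>, which is invisible on the socle.\<close>

lemma p_\<rho>_smult:
  assumes r: "r \<in> carrier R" and w: "w \<in> carrier W" "\<forall>y\<in>\<mm>. y \<odot>\<^bsub>W\<^esub> w = \<zero>\<^bsub>W\<^esub>"
  shows "p (\<rho> r) \<odot>\<^bsub>W\<^esub> w = r \<odot>\<^bsub>W\<^esub> w"
proof -
  define d where "d = p (\<rho> r) \<ominus>\<^bsub>R\<^esub> r"
  have d: "d \<in> \<mm>" using p_\<rho>[OF r] I_maximal unfolding d_def by blast
  have dc: "d \<in> carrier R" using r by (simp add: d_def)
  have "p (\<rho> r) = d \<oplus>\<^bsub>R\<^esub> r"
    using r by (simp add: d_def R.minus_eq R.a_assoc R.l_neg)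
  then show ?thesis using r w dc d by (simp add: R.W.smult_l_distr)
qed

lemma \<rho>_maximal: "y \<in> \<mm> \<Longrightarrow> \<rho> y \<in> \<nn>"
proof -
  assume y: "y \<in> \<mm>"
  have yc: "y \<in> carrier R" using y by (rule R.m_carrier)
  define d where "d = p (\<rho> y) \<ominus>\<^bsub>R\<^esub> y"
  have d: "d \<in> \<mm>" using p_\<rho>[OF yc] I_maximal unfolding d_def by blast
  have "p (\<rho> y) = d \<oplus>\<^bsub>R\<^esub> y"
    using yc by (simp add: d_def R.minus_eq R.a_assoc R.l_neg)
  also have "\<dots> \<in> \<mm>" using d y by (rule R.a_closed)
  finally show "\<rho> y \<in> \<nn>" using yc by (simp add: \<nn>_def)
qed

text \<open>\<open>S\<close> and \<open>R\<close> share their residue field: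
  \<open>p (\<rho> (p s))\<close> and \<open>p s\<close> agree modulo \<open>I\<close>, so modulo
  \<open>\<nn>\<close> every element is represented by one from the image of \<open>\<rho>\<close>,
  where \<open>R\<close>-linear maps can be computed.\<close>

lemma residue_decomposition:
  assumes s: "s \<in> carrier S"
  obtains n where "n \<in> \<nn>" "s = \<rho> (p s) \<oplus>\<^bsub>S\<^esub> n"
proof
  have ps: "p s \<in> carrier R" using s by simp
  have "p (s \<ominus>\<^bsub>S\<^esub> \<rho> (p s)) = \<ominus>\<^bsub>R\<^esub> (p (\<rho> (p s)) \<ominus>\<^bsub>R\<^esub> p s)"
    using s by (simp add: S.minus_eq R.minus_eq R.minus_add R.a_comm)
  also have "\<dots> \<in> \<mm>" using p_\<rho>[OF ps] I_maximal by (intro R.a_inv_closed) blast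
  finally show "s \<ominus>\<^bsub>S\<^esub> \<rho> (p s) \<in> \<nn>" using s by (simp add: \<nn>_def)
  show "s = \<rho> (p s) \<oplus>\<^bsub>S\<^esub> (s \<ominus>\<^bsub>S\<^esub> \<rho> (p s))"
    using s ps by (simp add: S.minus_eq S.a_lcomm S.r_neg)
qed

lemma \<psi>0_closed: "\<psi>0 \<in> carrier coinduced"
  unfolding coinduced_carrier_iff
proof (intro conjI ballI)
  show "\<psi>0 \<in> extensional (carrier S)" by (simp add: \<psi>0_def)
  fix s assume s: "s \<in> carrier S"
  show "\<psi>0 s \<in> carrier W" using s by (simp add: \<psi>0_def)
  show "\<psi>0 (s \<oplus>\<^bsub>S\<^esub> t) = \<psi>0 s \<oplus>\<^bsub>W\<^esub> \<psi>0 t" if "t \<in> carrier S" for t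
    using s that by (simp add: \<psi>0_def R.W.smult_l_distr)
next
  fix r s assume r: "r \<in> carrier R" and s: "s \<in> carrier S"
  have ps: "p s \<in> carrier R" using s by simp
  have "y \<odot>\<^bsub>W\<^esub> (p s \<odot>\<^bsub>W\<^esub> w0) = \<zero>\<^bsub>W\<^esub>" if y: "y \<in> \<mm>" for y
    using R.W.smult_commute[OF R.m_carrier[OF y] ps R.w0_closed] R.maximal_smult_w0[OF y] ps by simp
  then show "\<psi>0 (\<rho> r \<otimes>\<^bsub>S\<^esub> s) = r \<odot>\<^bsub>W\<^esub> \<psi>0 s"
    using r s p_\<rho>_smult[OF r, of "p s \<odot>\<^bsub>W\<^esub> w0"] by (simp add: \<psi>0_def R.W.smult_assoc1)
qed

lemma \<nn>_carrier: "n \<in> \<nn> \<Longrightarrow> n \<in> carrier S"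
  by (simp add: \<nn>_def)

lemma \<nn>_smult_\<psi>0: "n \<in> \<nn> \<Longrightarrow> n \<odot>\<^bsub>coinduced\<^esub> \<psi>0 = \<zero>\<^bsub>coinduced\<^esub>"
proof (rule coinduced_eqI)
  assume n: "n \<in> \<nn>"
  note nc = \<nn>_carrier[OF n]
  show "n \<odot>\<^bsub>coinduced\<^esub> \<psi>0 \<in> carrier coinduced" using nc \<psi>0_closed by (rule coinduced_smult_closed)
  show "\<zero>\<^bsub>coinduced\<^esub> \<in> carrier coinduced" by (rule coinduced_zero_closed)
  show "(n \<odot>\<^bsub>coinduced\<^esub> \<psi>0) s = \<zero>\<^bsub>coinduced\<^esub> s" if s: "s \<in> carrier S" for s
    using n nc s R.maximal_smult_w0[of "p n"]
    by (simp add: coinduced_apply \<psi>0_def R.W.smult_assoc1 \<nn>_def)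
qed

text \<open>If \<open>n\<close> kills \<open>\<phi>\<close>, then
  \<open>\<phi> n = (n \<phi>) 1 = 0\<close>. So \<open>\<phi>\<close> factors through the residue
  field and is determined by its value at one, which is killed by \<open>\<mm>\<close> and hence is
  a multiple of \<open>w0\<close>.\<close>

lemma coinduced_socle:
  assumes \<phi>: "\<phi> \<in> carrier coinduced" and ann: "\<forall>n\<in>\<nn>. n \<odot>\<^bsub>coinduced\<^esub> \<phi> = \<zero>\<^bsub>coinduced\<^esub>"
  shows "\<exists>c\<in>carrier S. \<phi> = c \<odot>\<^bsub>coinduced\<^esub> \<psi>0"
proof -
  note \<phi>s = coinducedD[OF \<phi>]
  have n0: "\<phi> n = \<zero>\<^bsub>W\<^esub>" if n: "n \<in> \<nn>" for n
    using coinduced_apply(3)[OF S.one_closed, of n \<phi>] coinduced_apply(1)[OF S.one_closed] ann n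
      \<nn>_carrier[OF n] by simp
  have \<phi>\<rho>: "\<phi> (\<rho> r) = r \<odot>\<^bsub>W\<^esub> \<phi> \<one>\<^bsub>S\<^esub>" if "r \<in> carrier R" for r
    using \<phi>s(3)[OF that S.one_closed] that by simp
  have "\<forall>y\<in>\<mm>. y \<odot>\<^bsub>W\<^esub> \<phi> \<one>\<^bsub>S\<^esub> = \<zero>\<^bsub>W\<^esub>"
    using n0[OF \<rho>_maximal] \<phi>\<rho> R.m_carrier by simp
  then obtain c where c: "c \<in> carrier R" "\<phi> \<one>\<^bsub>S\<^esub> = c \<odot>\<^bsub>W\<^esub> w0"
    using R.socle \<phi>s(1)[OF S.one_closed] by blast
  have "\<phi> = \<rho> c \<odot>\<^bsub>coinduced\<^esub> \<psi>0"
  proof (rule coinduced_eqI[OF \<phi>])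
    show "\<rho> c \<odot>\<^bsub>coinduced\<^esub> \<psi>0 \<in> carrier coinduced"
      using c(1) \<psi>0_closed by (intro coinduced_smult_closed) simp_all
    fix s assume s: "s \<in> carrier S"
    obtain n where n: "n \<in> \<nn>" "s = \<rho> (p s) \<oplus>\<^bsub>S\<^esub> n" using residue_decomposition[OF s] .
    have ps: "p s \<in> carrier R" using s by simp
    have "\<phi> s = \<phi> (\<rho> (p s) \<oplus>\<^bsub>S\<^esub> n)" using n(2) by (rule arg_cong)
    also have "\<dots> = \<phi> (\<rho> (p s)) \<oplus>\<^bsub>W\<^esub> \<phi> n" using ps \<nn>_carrier[OF n(1)] by (intro \<phi>s(2)) simp_all
    also have "\<dots> = p s \<odot>\<^bsub>W\<^esub> (c \<odot>\<^bsub>W\<^esub> w0)" using n0[OF n(1)] \<phi>\<rho>[OF ps] c ps by simp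
    also have "\<dots> = p s \<odot>\<^bsub>W\<^esub> (p (\<rho> c) \<odot>\<^bsub>W\<^esub> w0)"
      using p_\<rho>_smult[OF c(1) R.w0_closed] R.maximal_smult_w0 by simp
    also have "\<dots> = (\<rho> c \<odot>\<^bsub>coinduced\<^esub> \<psi>0) s"
      using s c(1) by (simp add: coinduced_apply \<psi>0_def R.W.smult_assoc1)
    finally show "\<phi> s = (\<rho> c \<odot>\<^bsub>coinduced\<^esub> \<psi>0) s" .
  qed
  moreover have "\<rho> c \<in> carrier S" using c(1) by simp
  ultimately show ?thesis by blast
qed

lemma regular_module: "module S (regular_module S)"
  by (rule ideal_module_is_module[OF S.is_cring S.oneideal])

text \<open>
  Extending \<open>s \<mapsto> \<psi> s\<close> along the embedding \<open>s \<mapsto> \<Lambda> (\<cdot> s)\<close> of \<open>S\<close> into the coinduced module gives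
  an endomorphism of the latter, which is multiplication by some element of \<open>S\<close> because the
  coinduced module has a simple socle.
\<close>

lemma representable:
  assumes S: "artinian_local_ring S \<nn>" and \<psi>: "\<psi> \<in> carrier coinduced"
  shows "\<exists>a\<in>carrier S. \<forall>s\<in>carrier S. \<psi> s = \<Lambda> (s \<otimes>\<^bsub>S\<^esub> a)"
proof -
  define \<iota> where "\<iota> = (\<lambda>s. \<lambda>t\<in>carrier S. \<Lambda> (t \<otimes>\<^bsub>S\<^esub> s))"
  have \<iota>_closed: "\<iota> s \<in> carrier coinduced" if "s \<in> carrier S" for s
    using that by (auto simp: coinduced_carrier_iff \<iota>_def S.l_distr \<Lambda>_add S.m_assoc \<Lambda>_\<rho>)
  have \<iota>: "\<iota> \<in> mod_hom R (restrict_scalars \<rho> (regular_module S)) (restrict_scalars \<rho> coinduced)"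
    unfolding mod_hom_def
  proof (intro CollectI conjI ballI funcsetI)
    fix s t assume "s \<in> carrier (restrict_scalars \<rho> (regular_module S))"
      "t \<in> carrier (restrict_scalars \<rho> (regular_module S))"
    then have st: "s \<in> carrier S" "t \<in> carrier S" by simp_all
    have "\<iota> (s \<oplus>\<^bsub>S\<^esub> t) = \<iota> s \<oplus>\<^bsub>coinduced\<^esub> \<iota> t"
    proof (rule coinduced_eqI)
      show "\<iota> (s \<oplus>\<^bsub>S\<^esub> t) \<in> carrier coinduced" using st by (intro \<iota>_closed) simp
      show "\<iota> s \<oplus>\<^bsub>coinduced\<^esub> \<iota> t \<in> carrier coinduced" using st by (intro coinduced_add_closed \<iota>_closed)
    qed (use st in \<open>simp add: coinduced_apply \<iota>_def S.r_distr \<Lambda>_add\<close>)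
    then show "\<iota> (s \<oplus>\<^bsub>restrict_scalars \<rho> (regular_module S)\<^esub> t) =
        \<iota> s \<oplus>\<^bsub>restrict_scalars \<rho> coinduced\<^esub> \<iota> t" by simp
  next
    fix r s assume r: "r \<in> carrier R" and "s \<in> carrier (restrict_scalars \<rho> (regular_module S))"
    then have s: "s \<in> carrier S" by simp
    have "\<iota> (\<rho> r \<otimes>\<^bsub>S\<^esub> s) = \<rho> r \<odot>\<^bsub>coinduced\<^esub> \<iota> s"
    proof (rule coinduced_eqI)
      show "\<iota> (\<rho> r \<otimes>\<^bsub>S\<^esub> s) \<in> carrier coinduced" using r s by (intro \<iota>_closed) simp
      show "\<rho> r \<odot>\<^bsub>coinduced\<^esub> \<iota> s \<in> carrier coinduced"
        using r s by (intro coinduced_smult_closed \<iota>_closed) simp_all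
    qed (use r s in \<open>simp add: coinduced_apply \<iota>_def S.m_assoc\<close>)
    then show "\<iota> (r \<odot>\<^bsub>restrict_scalars \<rho> (regular_module S)\<^esub> s) =
        r \<odot>\<^bsub>restrict_scalars \<rho> coinduced\<^esub> \<iota> s" by simp
  qed (use \<iota>_closed in simp)
  have \<iota>_inj: "inj_on \<iota> (carrier (restrict_scalars \<rho> (regular_module S)))"
  proof (rule inj_onI)
    fix s t assume "s \<in> carrier (restrict_scalars \<rho> (regular_module S))"
      "t \<in> carrier (restrict_scalars \<rho> (regular_module S))" and eq: "\<iota> s = \<iota> t"
    then have st: "s \<in> carrier S" "t \<in> carrier S" by simp_all
    show "s = t"
    proof (rule eq_if_\<Lambda>_eq[OF st])
      show "\<Lambda> (u \<otimes>\<^bsub>S\<^esub> s) = \<Lambda> (u \<otimes>\<^bsub>S\<^esub> t)" if "u \<in> carrier S" for u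
        using fun_cong[OF eq, of u] that by (simp add: \<iota>_def)
    qed
  qed
  have \<psi>_hom: "\<psi> \<in> mod_hom R (restrict_scalars \<rho> (regular_module S)) W"
    using \<psi> by (simp add: coinduced_def)
  \<comment> \<open>This extension is only \<open>R\<close>-linear, as \<open>W\<close> is injective
    over \<open>R\<close>.\<close>
  obtain H where H: "H \<in> mod_hom R (restrict_scalars \<rho> coinduced) W"
    and H\<iota>: "\<And>s. s \<in> carrier S \<Longrightarrow> H (\<iota> s) = \<psi> s"
    using injective_module_extension[OF R.injective
        restrict_scalars_module[OF R.is_cring \<rho>_hom regular_module]
        restrict_scalars_module[OF R.is_cring \<rho>_hom coinduced_module] \<iota> \<iota>_inj \<psi>_hom] by auto
  have Hs: "\<phi> \<in> carrier coinduced \<Longrightarrow> H \<phi> \<in> carrier W"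
    "\<phi> \<in> carrier coinduced \<Longrightarrow> \<phi>' \<in> carrier coinduced \<Longrightarrow>
      H (\<phi> \<oplus>\<^bsub>coinduced\<^esub> \<phi>') = H \<phi> \<oplus>\<^bsub>W\<^esub> H \<phi>'"
    "r \<in> carrier R \<Longrightarrow> \<phi> \<in> carrier coinduced \<Longrightarrow> H (\<rho> r \<odot>\<^bsub>coinduced\<^esub> \<phi>) = r \<odot>\<^bsub>W\<^esub> H \<phi>"
    for \<phi> \<phi>' r
    using mod_homD[OF H] by simp_all
  \<comment> \<open>The adjoint of \<open>H\<close>: an \<open>S\<close>-linear endomorphism whose
    evaluation at one gives back \<open>H\<close>.\<close>
  define \<Phi> where "\<Phi> = (\<lambda>\<phi>. \<lambda>s\<in>carrier S. H (s \<odot>\<^bsub>coinduced\<^esub> \<phi>))"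
  have \<Phi>_closed: "\<Phi> \<phi> \<in> carrier coinduced" if \<phi>: "\<phi> \<in> carrier coinduced" for \<phi>
    unfolding coinduced_carrier_iff
  proof (intro conjI ballI)
    fix s assume s: "s \<in> carrier S"
    show "\<Phi> \<phi> s \<in> carrier W" using s \<phi> by (simp add: \<Phi>_def Hs)
    show "\<Phi> \<phi> (s \<oplus>\<^bsub>S\<^esub> t) = \<Phi> \<phi> s \<oplus>\<^bsub>W\<^esub> \<Phi> \<phi> t" if "t \<in> carrier S" for t
      using s \<phi> that by (simp add: \<Phi>_def Hs E.smult_l_distr)
  next
    fix r s assume "r \<in> carrier R" "s \<in> carrier S"
    then show "\<Phi> \<phi> (\<rho> r \<otimes>\<^bsub>S\<^esub> s) = r \<odot>\<^bsub>W\<^esub> \<Phi> \<phi> s"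
      using \<phi> by (simp add: \<Phi>_def Hs E.smult_assoc1)
  qed (simp add: \<Phi>_def)
  have \<Phi>: "\<Phi> \<in> mod_hom S coinduced coinduced"
    unfolding mod_hom_def
  proof (intro CollectI conjI ballI funcsetI)
    fix \<phi> \<phi>' assume \<phi>: "\<phi> \<in> carrier coinduced" "\<phi>' \<in> carrier coinduced"
    show "\<Phi> (\<phi> \<oplus>\<^bsub>coinduced\<^esub> \<phi>') = \<Phi> \<phi> \<oplus>\<^bsub>coinduced\<^esub> \<Phi> \<phi>'"
    proof (rule coinduced_eqI)
      show "\<Phi> (\<phi> \<oplus>\<^bsub>coinduced\<^esub> \<phi>') \<in> carrier coinduced"
        "\<Phi> \<phi> \<oplus>\<^bsub>coinduced\<^esub> \<Phi> \<phi>' \<in> carrier coinduced"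
        using \<phi> by (auto intro!: \<Phi>_closed)
    qed (use \<phi> in \<open>simp add: coinduced_apply \<Phi>_def E.smult_r_distr Hs\<close>)
  next
    fix t \<phi> assume t: "t \<in> carrier S" and \<phi>: "\<phi> \<in> carrier coinduced"
    show "\<Phi> (t \<odot>\<^bsub>coinduced\<^esub> \<phi>) = t \<odot>\<^bsub>coinduced\<^esub> \<Phi> \<phi>"
    proof (rule coinduced_eqI)
      show "\<Phi> (t \<odot>\<^bsub>coinduced\<^esub> \<phi>) \<in> carrier coinduced" "t \<odot>\<^bsub>coinduced\<^esub> \<Phi> \<phi> \<in> carrier coinduced"
        using t \<phi> by (auto intro!: \<Phi>_closed)
    qed (use t \<phi> in \<open>simp add: coinduced_apply \<Phi>_def E.smult_assoc1\<close>)
  qed (use \<Phi>_closed in simp)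
  obtain a where a: "a \<in> carrier S"
    and \<Phi>a: "\<And>\<phi>. \<phi> \<in> carrier coinduced \<Longrightarrow> \<Phi> \<phi> = a \<odot>\<^bsub>coinduced\<^esub> \<phi>"
    using artinian_local_ring.endomorphism_is_smult[OF S coinduced_module \<psi>0_closed
        \<nn>_smult_\<psi>0 coinduced_socle \<Phi>] by blast
  have "\<psi> s = \<Lambda> (s \<otimes>\<^bsub>S\<^esub> a)" if s: "s \<in> carrier S" for s
  proof -
    \<comment> \<open>\<open>\<psi>\<close> is the value of \<open>\<Phi>\<close> at the image of
      one, and there \<open>\<Phi>\<close> multiplies by \<open>a\<close>.\<close>
    have "\<psi> s = H (s \<odot>\<^bsub>coinduced\<^esub> \<iota> \<one>\<^bsub>S\<^esub>)"
    proof -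
      have "s \<odot>\<^bsub>coinduced\<^esub> \<iota> \<one>\<^bsub>S\<^esub> = \<iota> s"
      proof (rule coinduced_eqI)
        show "s \<odot>\<^bsub>coinduced\<^esub> \<iota> \<one>\<^bsub>S\<^esub> \<in> carrier coinduced" "\<iota> s \<in> carrier coinduced"
          using s by (auto intro!: \<iota>_closed)
      qed (use s in \<open>simp add: coinduced_apply \<iota>_def\<close>)
      then show ?thesis using H\<iota>[OF s] by simp
    qed
    also have "\<dots> = \<Phi> (\<iota> \<one>\<^bsub>S\<^esub>) s" using s by (simp add: \<Phi>_def)
    also have "\<dots> = \<Lambda> (s \<otimes>\<^bsub>S\<^esub> a)"
      using s a \<Phi>a[OF \<iota>_closed[OF S.one_closed]] by (simp add: coinduced_apply \<iota>_def)
    finally show ?thesis .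
  qed
  then show ?thesis using a by blast
qed

end

section \<open>Self-injectivity and socle of the cover\<close>

lemma (in cring) annihilator_of_element_ideal:
  assumes z: "z \<in> carrier R"
  shows "ideal {s \<in> carrier R. s \<otimes> z = \<zero>} R"
proof (intro idealI[OF ring_axioms] subgroup.intro)
  let ?J = "{s \<in> carrier R. s \<otimes> z = \<zero>}"
  fix x assume "x \<in> ?J"
  then have "\<ominus> x \<in> ?J" using z by (auto simp: l_minus)
  then show "inv\<^bsub>add_monoid R\<^esub> x \<in> ?J" by (simp add: a_inv_def)
next
  let ?J = "{s \<in> carrier R. s \<otimes> z = \<zero>}"
  fix a x assume a: "a \<in> ?J" and x: "x \<in> carrier R"
  have "x \<otimes> a \<in> ?J" using a x z by (auto simp: m_assoc)
  moreover have "a \<otimes> x = x \<otimes> a" using a x by (simp add: m_comm)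
  ultimately show "x \<otimes> a \<in> ?J" "a \<otimes> x \<in> ?J" by simp_all
qed (use z in \<open>auto simp: l_distr\<close>)

text \<open>A socle element \<open>x\<close> modulo the annihilator of \<open>z\<close> makes
  \<open>x z\<close> a socle element of \<open>R z\<close>.\<close>

lemma (in artinian_local_ring) exists_socle_multiple:
  assumes z: "z \<in> carrier R" "z \<noteq> \<zero>"
  shows "\<exists>x\<in>carrier R. x \<otimes> z \<noteq> \<zero> \<and> (\<forall>y\<in>\<mm>. y \<otimes> (x \<otimes> z) = \<zero>)"
proof -
  let ?J = "{s \<in> carrier R. s \<otimes> z = \<zero>}"
  have "?J \<noteq> carrier R"
  proof
    assume "?J = carrier R"
    then have "\<one> \<in> ?J" by simp
    then show False using z by simp
  qed
  with annihilator_of_element_ideal[OF z(1)] have "\<exists>x\<in>carrier R - ?J. \<forall>y\<in>\<mm>. y \<otimes> x \<in> ?J"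
    by (rule exists_socle_mod)
  then obtain x where x: "x \<in> carrier R" "x \<otimes> z \<noteq> \<zero>" and y: "\<And>y. y \<in> \<mm> \<Longrightarrow> y \<otimes> x \<otimes> z = \<zero>"
    by blast
  have "y \<otimes> (x \<otimes> z) = \<zero>" if "y \<in> \<mm>" for y
    using y[OF that] m_assoc[OF _ x(1) z(1), of y] that a_subset by auto
  then show ?thesis using x by blast
qed

context gorenstein_cover
begin

text \<open>Composing \<open>g\<close> with \<open>\<Lambda>\<close> leads into \<open>W\<close>,
  where extension over \<open>R\<close> is possible. For each \<open>x\<close>, the map
  \<open>s \<mapsto> h (s x)\<close> is in \<open>coinduced\<close>, hence of the form
  \<open>s \<mapsto> \<Lambda> (s a)\<close> for a unique \<open>a\<close>, which is taken as
  \<open>G x\<close>. Linearity of \<open>G\<close> and its agreement with \<open>g\<close> both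
  follow from this uniqueness.\<close>

lemma self_injective:
  assumes S: "artinian_local_ring S \<nn>"
  shows "injective_module S (regular_module S)"
  unfolding injective_module_def
proof (intro conjI regular_module allI impI, elim conjE)
  fix M N :: "('s, 's) module" and i g
  assume M: "module S M" and N: "module S N" and i: "i \<in> mod_hom S M N" "inj_on i (carrier M)"
    and g: "g \<in> mod_hom S M (regular_module S)"
  interpret M: module S M by fact
  interpret N: module S N by fact
  have ims: "i x \<in> carrier N" "y \<in> carrier M \<Longrightarrow> i (x \<oplus>\<^bsub>M\<^esub> y) = i x \<oplus>\<^bsub>N\<^esub> i y"
    "s \<in> carrier S \<Longrightarrow> i (s \<odot>\<^bsub>M\<^esub> x) = s \<odot>\<^bsub>N\<^esub> i x" if "x \<in> carrier M" for x y s
    using mod_homD[OF i(1)] that by simp_all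
  have gs: "g x \<in> carrier S" "y \<in> carrier M \<Longrightarrow> g (x \<oplus>\<^bsub>M\<^esub> y) = g x \<oplus>\<^bsub>S\<^esub> g y"
    "s \<in> carrier S \<Longrightarrow> g (s \<odot>\<^bsub>M\<^esub> x) = s \<otimes>\<^bsub>S\<^esub> g x" if "x \<in> carrier M" for x y s
    using mod_homD[OF g] that by simp_all
  have i': "i \<in> mod_hom R (restrict_scalars \<rho> M) (restrict_scalars \<rho> N)"
    using ims by (auto simp: mod_hom_def)
  have g': "(\<lambda>x. \<Lambda> (g x)) \<in> mod_hom R (restrict_scalars \<rho> M) W"
    using gs by (auto simp: mod_hom_def \<Lambda>_add \<Lambda>_\<rho>)
  have inj': "inj_on i (carrier (restrict_scalars \<rho> M))" using i(2) by simp
  obtain h where h: "h \<in> mod_hom R (restrict_scalars \<rho> N) W"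
    and hi: "\<And>x. x \<in> carrier M \<Longrightarrow> h (i x) = \<Lambda> (g x)"
    using injective_module_extension[OF R.injective
        restrict_scalars_module[OF R.is_cring \<rho>_hom M]
        restrict_scalars_module[OF R.is_cring \<rho>_hom N] i' inj' g'] by auto
  have hs: "x \<in> carrier N \<Longrightarrow> h x \<in> carrier W"
    "x \<in> carrier N \<Longrightarrow> y \<in> carrier N \<Longrightarrow> h (x \<oplus>\<^bsub>N\<^esub> y) = h x \<oplus>\<^bsub>W\<^esub> h y"
    "r \<in> carrier R \<Longrightarrow> x \<in> carrier N \<Longrightarrow> h (\<rho> r \<odot>\<^bsub>N\<^esub> x) = r \<odot>\<^bsub>W\<^esub> h x" for x y r
    using mod_homD[OF h] by simp_all
  have "\<exists>a\<in>carrier S. \<forall>s\<in>carrier S. h (s \<odot>\<^bsub>N\<^esub> x) = \<Lambda> (s \<otimes>\<^bsub>S\<^esub> a)" if x: "x \<in> carrier N" for x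
  proof -
    have "(\<lambda>s\<in>carrier S. h (s \<odot>\<^bsub>N\<^esub> x)) \<in> carrier coinduced"
      unfolding coinduced_carrier_iff using x
      by (auto simp: hs N.smult_l_distr N.smult_assoc1)
    from representable[OF S this] show ?thesis by simp
  qed
  then have "\<forall>x\<in>carrier N. \<exists>a. a \<in> carrier S \<and> (\<forall>s\<in>carrier S. h (s \<odot>\<^bsub>N\<^esub> x) = \<Lambda> (s \<otimes>\<^bsub>S\<^esub> a))"
    by blast
  from bchoice[OF this] obtain G where "\<forall>x\<in>carrier N. G x \<in> carrier S \<and>
      (\<forall>s\<in>carrier S. h (s \<odot>\<^bsub>N\<^esub> x) = \<Lambda> (s \<otimes>\<^bsub>S\<^esub> G x))" ..
  then have G: "\<And>x. x \<in> carrier N \<Longrightarrow> G x \<in> carrier S"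
    "\<And>x s. x \<in> carrier N \<Longrightarrow> s \<in> carrier S \<Longrightarrow> h (s \<odot>\<^bsub>N\<^esub> x) = \<Lambda> (s \<otimes>\<^bsub>S\<^esub> G x)"
    by simp_all
  have GI: "G x = a" if x: "x \<in> carrier N" and a: "a \<in> carrier S"
    and eq: "\<And>s. s \<in> carrier S \<Longrightarrow> h (s \<odot>\<^bsub>N\<^esub> x) = \<Lambda> (s \<otimes>\<^bsub>S\<^esub> a)" for x a
    by (rule eq_if_\<Lambda>_eq[OF G(1)[OF x] a]) (simp add: G(2)[OF x, symmetric] eq)
  have "G \<in> mod_hom S N (regular_module S)"
    unfolding mod_hom_def
  proof (intro CollectI conjI ballI funcsetI)
    fix x y assume x: "x \<in> carrier N" and y: "y \<in> carrier N"
    have "G (x \<oplus>\<^bsub>N\<^esub> y) = G x \<oplus>\<^bsub>S\<^esub> G y"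
      using x y by (intro GI) (simp_all add: G hs N.smult_r_distr S.r_distr \<Lambda>_add)
    then show "G (x \<oplus>\<^bsub>N\<^esub> y) = G x \<oplus>\<^bsub>regular_module S\<^esub> G y" by simp
  next
    fix t x assume t: "t \<in> carrier S" and x: "x \<in> carrier N"
    have "G (t \<odot>\<^bsub>N\<^esub> x) = t \<otimes>\<^bsub>S\<^esub> G x"
    proof (rule GI)
      fix s assume s: "s \<in> carrier S"
      have "h (s \<odot>\<^bsub>N\<^esub> (t \<odot>\<^bsub>N\<^esub> x)) = h ((s \<otimes>\<^bsub>S\<^esub> t) \<odot>\<^bsub>N\<^esub> x)"
        using s t x by (simp add: N.smult_assoc1)
      then show "h (s \<odot>\<^bsub>N\<^esub> (t \<odot>\<^bsub>N\<^esub> x)) = \<Lambda> (s \<otimes>\<^bsub>S\<^esub> (t \<otimes>\<^bsub>S\<^esub> G x))"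
        using s t x by (simp add: G S.m_assoc)
    qed (use t x G in simp_all)
    then show "G (t \<odot>\<^bsub>N\<^esub> x) = t \<odot>\<^bsub>regular_module S\<^esub> G x" by simp
  qed (use G in simp)
  moreover have "G (i x) = g x" if x: "x \<in> carrier M" for x
  proof (rule GI)
    fix s assume s: "s \<in> carrier S"
    have "h (s \<odot>\<^bsub>N\<^esub> i x) = h (i (s \<odot>\<^bsub>M\<^esub> x))" using ims(3)[OF x s] by simp
    also have "\<dots> = \<Lambda> (s \<otimes>\<^bsub>S\<^esub> g x)" using hi[OF M.smult_closed[OF s x]] gs(3)[OF x s] by simp
    finally show "h (s \<odot>\<^bsub>N\<^esub> i x) = \<Lambda> (s \<otimes>\<^bsub>S\<^esub> g x)" .
  qed (use x ims gs in simp_all)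
  ultimately show "\<exists>h\<in>mod_hom S N (regular_module S). \<forall>x\<in>carrier M. h (i x) = g x"
    by (intro bexI[of _ G] ballI)
qed

text \<open>The element \<open>\<sigma>\<close> representing the socle generator
  \<open>\<psi>0\<close> of \<open>coinduced\<close> generates the socle of \<open>S\<close>;
  together with self-injectivity this makes \<open>S\<close> its own canonical module.\<close>

lemma gorenstein:
  assumes S: "artinian_local_ring S \<nn>"
  shows "gorenstein_artinian_local S"
proof -
  from representable[OF S \<psi>0_closed]
  obtain \<sigma> where \<sigma>: "\<sigma> \<in> carrier S" and \<psi>0: "\<forall>s\<in>carrier S. \<psi>0 s = \<Lambda> (s \<otimes>\<^bsub>S\<^esub> \<sigma>)"
    by (elim bexE)
  then have \<Lambda>\<sigma>: "\<Lambda> (s \<otimes>\<^bsub>S\<^esub> \<sigma>) = p s \<odot>\<^bsub>W\<^esub> w0" if "s \<in> carrier S" for s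
    using that by (simp add: \<psi>0_def)
  have "dualizing_module S \<nn> (regular_module S) \<sigma>"
  proof (intro dualizing_module.intro dualizing_module_axioms.intro S regular_module self_injective)
    show "\<sigma> \<in> carrier (regular_module S)" using \<sigma> by simp
    have "\<sigma> \<noteq> \<zero>\<^bsub>S\<^esub>" using \<Lambda>\<sigma>[OF S.one_closed] \<sigma> R.w0_nonzero \<Lambda>_zero by auto
    then show "\<sigma> \<noteq> \<zero>\<^bsub>regular_module S\<^esub>" by simp
    have "n \<otimes>\<^bsub>S\<^esub> \<sigma> = \<zero>\<^bsub>S\<^esub>" if n: "n \<in> \<nn>" for n
    proof (rule nondegenerate)
      note nc = \<nn>_carrier[OF n]
      show "n \<otimes>\<^bsub>S\<^esub> \<sigma> \<in> carrier S" using nc \<sigma> by simp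
      show "\<Lambda> (t \<otimes>\<^bsub>S\<^esub> (n \<otimes>\<^bsub>S\<^esub> \<sigma>)) = \<zero>\<^bsub>W\<^esub>" if t: "t \<in> carrier S" for t
      proof -
        have "\<Lambda> (t \<otimes>\<^bsub>S\<^esub> (n \<otimes>\<^bsub>S\<^esub> \<sigma>)) = p (t \<otimes>\<^bsub>S\<^esub> n) \<odot>\<^bsub>W\<^esub> w0"
          using \<Lambda>\<sigma>[of "t \<otimes>\<^bsub>S\<^esub> n"] t nc \<sigma> by (simp add: S.m_assoc)
        also have "\<dots> = p t \<odot>\<^bsub>W\<^esub> (p n \<odot>\<^bsub>W\<^esub> w0)" using t nc by (simp add: R.W.smult_assoc1)
        also have "\<dots> = \<zero>\<^bsub>W\<^esub>" using n t R.maximal_smult_w0[of "p n"] by (simp add: \<nn>_def)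
        finally show ?thesis .
      qed
    qed
    then show "n \<odot>\<^bsub>regular_module S\<^esub> \<sigma> = \<zero>\<^bsub>regular_module S\<^esub>" if "n \<in> \<nn>" for n
      using that by simp
    fix z assume "z \<in> carrier (regular_module S)" "z \<noteq> \<zero>\<^bsub>regular_module S\<^esub>"
    then have z: "z \<in> carrier S" "z \<noteq> \<zero>\<^bsub>S\<^esub>" by simp_all
    \<comment> \<open>Passing to a nonzero socle element \<open>y\<close> of \<open>S z\<close> puts
      \<open>\<Lambda> y\<close> into the socle \<open>R w0\<close>, because \<open>\<rho>\<close>
      maps \<open>\<mm>\<close> into \<open>\<nn>\<close>.\<close>
    obtain x where x: "x \<in> carrier S" "x \<otimes>\<^bsub>S\<^esub> z \<noteq> \<zero>\<^bsub>S\<^esub>"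
      and nx: "\<And>n. n \<in> \<nn> \<Longrightarrow> n \<otimes>\<^bsub>S\<^esub> (x \<otimes>\<^bsub>S\<^esub> z) = \<zero>\<^bsub>S\<^esub>"
      using artinian_local_ring.exists_socle_multiple[OF S z] by blast
    define y where "y = x \<otimes>\<^bsub>S\<^esub> z"
    have y: "y \<in> carrier S" "y \<noteq> \<zero>\<^bsub>S\<^esub>" using x z by (simp_all add: y_def)
    have ny: "n \<otimes>\<^bsub>S\<^esub> y = \<zero>\<^bsub>S\<^esub>" if "n \<in> \<nn>" for n
      using nx[OF that] by (simp add: y_def)
    have "k \<odot>\<^bsub>W\<^esub> \<Lambda> y = \<zero>\<^bsub>W\<^esub>" if "k \<in> \<mm>" for k
      using \<Lambda>_\<rho>[OF R.m_carrier[OF that] y(1)] ny[OF \<rho>_maximal[OF that]] \<Lambda>_zero by simp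
    then obtain c where c: "c \<in> carrier R" "\<Lambda> y = c \<odot>\<^bsub>W\<^esub> w0"
      using R.socle[of "\<Lambda> y"] y by auto
    have \<Lambda>y: "\<Lambda> (t \<otimes>\<^bsub>S\<^esub> y) = p t \<odot>\<^bsub>W\<^esub> (c \<odot>\<^bsub>W\<^esub> w0)" if t: "t \<in> carrier S" for t
    proof -
      obtain n where n: "n \<in> \<nn>" "t = \<rho> (p t) \<oplus>\<^bsub>S\<^esub> n" using residue_decomposition[OF t] .
      have pt: "p t \<in> carrier R" using t by simp
      have "t \<otimes>\<^bsub>S\<^esub> y = (\<rho> (p t) \<oplus>\<^bsub>S\<^esub> n) \<otimes>\<^bsub>S\<^esub> y" by (rule arg_cong[OF n(2)])
      also have "\<dots> = \<rho> (p t) \<otimes>\<^bsub>S\<^esub> y" using pt n(1) \<nn>_carrier y ny by (simp add: S.l_distr)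
      finally show ?thesis using \<Lambda>_\<rho>[OF pt y(1)] c by simp
    qed
    \<comment> \<open>Otherwise \<open>\<Lambda> (t y)\<close> would vanish for all
      \<open>t\<close>.\<close>
    have "c \<notin> \<mm>"
    proof
      assume "c \<in> \<mm>"
      then have "y = \<zero>\<^bsub>S\<^esub>" using y \<Lambda>y R.maximal_smult_w0 by (intro nondegenerate) simp_all
      then show False using y by simp
    qed
    then obtain v where v: "v \<in> carrier R" "v \<otimes>\<^bsub>R\<^esub> c = \<one>\<^bsub>R\<^esub>" using R.unit_inverse c(1) by blast
    have "\<rho> v \<otimes>\<^bsub>S\<^esub> y = \<sigma>"
    proof (rule eq_if_\<Lambda>_eq)
      fix t assume t: "t \<in> carrier S"
      have "t \<otimes>\<^bsub>S\<^esub> (\<rho> v \<otimes>\<^bsub>S\<^esub> y) = \<rho> v \<otimes>\<^bsub>S\<^esub> (t \<otimes>\<^bsub>S\<^esub> y)" using t v y by (simp add: S.m_lcomm)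
      then have "\<Lambda> (t \<otimes>\<^bsub>S\<^esub> (\<rho> v \<otimes>\<^bsub>S\<^esub> y)) = v \<odot>\<^bsub>W\<^esub> (p t \<odot>\<^bsub>W\<^esub> (c \<odot>\<^bsub>W\<^esub> w0))"
        using \<Lambda>_\<rho>[OF v(1), of "t \<otimes>\<^bsub>S\<^esub> y"] \<Lambda>y t y by simp
      also have "\<dots> = p t \<odot>\<^bsub>W\<^esub> ((v \<otimes>\<^bsub>R\<^esub> c) \<odot>\<^bsub>W\<^esub> w0)"
        using R.W.smult_commute[OF v(1), of "p t" "c \<odot>\<^bsub>W\<^esub> w0"] t c v(1) by (simp add: R.W.smult_assoc1)
      finally show "\<Lambda> (t \<otimes>\<^bsub>S\<^esub> (\<rho> v \<otimes>\<^bsub>S\<^esub> y)) = \<Lambda> (t \<otimes>\<^bsub>S\<^esub> \<sigma>)" using \<Lambda>\<sigma>[OF t] v by simp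
    qed (use v y \<sigma> in simp_all)
    then have "(\<rho> v \<otimes>\<^bsub>S\<^esub> x) \<odot>\<^bsub>regular_module S\<^esub> z = \<sigma>"
      using v x z by (simp add: y_def S.m_assoc)
    moreover have "\<rho> v \<otimes>\<^bsub>S\<^esub> x \<in> carrier S" using v x by simp
    ultimately show "\<exists>r\<in>carrier S. r \<odot>\<^bsub>regular_module S\<^esub> z = \<sigma>" by blast
  qed
  then have "canonical_module S \<nn> (regular_module S)" by (rule dualizing_module.canonical)
  then show ?thesis unfolding gorenstein_artinian_local_def using S by blast
qed

lemma ring_length_diff_le:
  assumes "chains_bounded {J. ideal J R \<and> I \<subseteq> J} b"
  shows "ring_length S - ring_length R \<le> enat b"
proof -
  \<comment> \<open>Finiteness of \<open>ring_length R\<close> is what lets the subtraction in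
    \<open>enat\<close> cancel.\<close>
  obtain N where "ring_length R \<le> enat N" using R.finite_length ring_length_le_iff by blast
  then obtain l where l: "ring_length R = enat l" by (cases "ring_length R") auto
  then have "chains_bounded {J. ideal J R} l" using ring_length_le_iff[of R l] by simp
  from chains_bounded_ideals[OF this assms] have "ring_length S \<le> enat (b + l)"
    using ring_length_le_iff by blast
  then show ?thesis unfolding l by (cases "ring_length S") auto
qed

end

section \<open>Twisted extensions\<close>

text \<open>The Hochschild extension of \<open>R\<close> by \<open>E\<close> with cocycle
  \<open>\<beta>\<close>; for zero \<open>\<beta>\<close> it is the trivial extension, or
  idealization. Addition is not twisted.\<close>

definition twisted_extension ::
    "('a, 'm) ring_scheme \<Rightarrow> ('a, 'b, 'k) module_scheme \<Rightarrow> 'b set \<Rightarrow> ('a \<Rightarrow> 'a \<Rightarrow> 'b) \<Rightarrow> ('a \<times> 'b) ring" where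
  "twisted_extension R W E \<beta> =
     \<lparr>carrier = carrier R \<times> E,
      monoid.mult = (\<lambda>(r, e) (s, d). (r \<otimes>\<^bsub>R\<^esub> s, (r \<odot>\<^bsub>W\<^esub> d \<oplus>\<^bsub>W\<^esub> s \<odot>\<^bsub>W\<^esub> e) \<oplus>\<^bsub>W\<^esub> \<beta> r s)),
      monoid.one = (\<one>\<^bsub>R\<^esub>, \<zero>\<^bsub>W\<^esub>),
      ring.zero = (\<zero>\<^bsub>R\<^esub>, \<zero>\<^bsub>W\<^esub>),
      ring.add = (\<lambda>(r, e) (s, d). (r \<oplus>\<^bsub>R\<^esub> s, e \<oplus>\<^bsub>W\<^esub> d))\<rparr>"

lemma twisted_extension_simps [simp]:
  "carrier (twisted_extension R W E \<beta>) = carrier R \<times> E"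
  "(r, e) \<otimes>\<^bsub>twisted_extension R W E \<beta>\<^esub> (s, d) =
     (r \<otimes>\<^bsub>R\<^esub> s, (r \<odot>\<^bsub>W\<^esub> d \<oplus>\<^bsub>W\<^esub> s \<odot>\<^bsub>W\<^esub> e) \<oplus>\<^bsub>W\<^esub> \<beta> r s)"
  "\<one>\<^bsub>twisted_extension R W E \<beta>\<^esub> = (\<one>\<^bsub>R\<^esub>, \<zero>\<^bsub>W\<^esub>)"
  "\<zero>\<^bsub>twisted_extension R W E \<beta>\<^esub> = (\<zero>\<^bsub>R\<^esub>, \<zero>\<^bsub>W\<^esub>)"
  "(r, e) \<oplus>\<^bsub>twisted_extension R W E \<beta>\<^esub> (s, d) = (r \<oplus>\<^bsub>R\<^esub> s, e \<oplus>\<^bsub>W\<^esub> d)"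
  by (simp_all add: twisted_extension_def)

text \<open>Associativity is the cocycle identity, commutativity the symmetry of
  \<open>\<beta>\<close>, distributivity its additivity. Symmetry also reduces the unit and
  distributive laws to one side.\<close>

lemma (in module) twisted_extension_cring:
  assumes E: "submodule E R M"
    and \<beta>E: "\<And>r s. r \<in> carrier R \<Longrightarrow> s \<in> carrier R \<Longrightarrow> \<beta> r s \<in> E"
    and sym: "\<And>r s. r \<in> carrier R \<Longrightarrow> s \<in> carrier R \<Longrightarrow> \<beta> r s = \<beta> s r"
    and add: "\<And>r s t. r \<in> carrier R \<Longrightarrow> s \<in> carrier R \<Longrightarrow> t \<in> carrier R \<Longrightarrow>
        \<beta> (r \<oplus> s) t = \<beta> r t \<oplus>\<^bsub>M\<^esub> \<beta> s t"
    and one: "\<And>r. r \<in> carrier R \<Longrightarrow> \<beta> \<one> r = \<zero>\<^bsub>M\<^esub>"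
    and cocycle: "\<And>r s t. r \<in> carrier R \<Longrightarrow> s \<in> carrier R \<Longrightarrow> t \<in> carrier R \<Longrightarrow>
        r \<odot>\<^bsub>M\<^esub> \<beta> s t \<oplus>\<^bsub>M\<^esub> \<beta> r (s \<otimes> t) = t \<odot>\<^bsub>M\<^esub> \<beta> r s \<oplus>\<^bsub>M\<^esub> \<beta> (r \<otimes> s) t"
  shows "cring (twisted_extension R M E \<beta>)"
proof -
  let ?S = "twisted_extension R M E \<beta>"
  note Es = submoduleE[OF E]
  have Ec: "e \<in> carrier M" if "e \<in> E" for e using that Es(1) by blast
  have E0: "\<zero>\<^bsub>M\<^esub> \<in> E" using submodule.axioms(1)[OF E] subgroup.one_closed by fastforce
  have \<beta>c: "\<beta> r s \<in> carrier M" if "r \<in> carrier R" "s \<in> carrier R" for r s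
    using \<beta>E[OF that] Ec by blast
  have closed: "r \<odot>\<^bsub>M\<^esub> d \<oplus>\<^bsub>M\<^esub> s \<odot>\<^bsub>M\<^esub> e \<oplus>\<^bsub>M\<^esub> \<beta> r s \<in> E"
    if "r \<in> carrier R" "s \<in> carrier R" "e \<in> E" "d \<in> E" for r s e d
    using that by (intro Es(4,5) \<beta>E)
  have comm: "x \<otimes>\<^bsub>?S\<^esub> y = y \<otimes>\<^bsub>?S\<^esub> x" if "x \<in> carrier ?S" "y \<in> carrier ?S" for x y
    using that Ec \<beta>c sym R.m_comm by (auto simp: M.a_comm)
  have assoc: "(x \<otimes>\<^bsub>?S\<^esub> y) \<otimes>\<^bsub>?S\<^esub> z = x \<otimes>\<^bsub>?S\<^esub> (y \<otimes>\<^bsub>?S\<^esub> z)"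
    if xyz: "x \<in> carrier ?S" "y \<in> carrier ?S" "z \<in> carrier ?S" for x y z
  proof -
    obtain r a where x: "x = (r, a)" "r \<in> carrier R" "a \<in> carrier M" using xyz Ec by auto
    obtain s b where y: "y = (s, b)" "s \<in> carrier R" "b \<in> carrier M" using xyz Ec by auto
    obtain t c where z: "z = (t, c)" "t \<in> carrier R" "c \<in> carrier M" using xyz Ec by auto
    \<comment> \<open>The terms common to both bracketings; what remains are the two sides of
      \<open>cocycle\<close>.\<close>
    define u where "u = (r \<otimes> s) \<odot>\<^bsub>M\<^esub> c \<oplus>\<^bsub>M\<^esub> ((r \<otimes> t) \<odot>\<^bsub>M\<^esub> b \<oplus>\<^bsub>M\<^esub> (s \<otimes> t) \<odot>\<^bsub>M\<^esub> a)"
    have u: "u \<in> carrier M" using x y z by (simp add: u_def)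
    have "(r \<otimes> s) \<odot>\<^bsub>M\<^esub> c \<oplus>\<^bsub>M\<^esub> t \<odot>\<^bsub>M\<^esub> (r \<odot>\<^bsub>M\<^esub> b \<oplus>\<^bsub>M\<^esub> s \<odot>\<^bsub>M\<^esub> a \<oplus>\<^bsub>M\<^esub> \<beta> r s) \<oplus>\<^bsub>M\<^esub> \<beta> (r \<otimes> s) t
        = u \<oplus>\<^bsub>M\<^esub> (t \<odot>\<^bsub>M\<^esub> \<beta> r s \<oplus>\<^bsub>M\<^esub> \<beta> (r \<otimes> s) t)"
      using x y z \<beta>c unfolding u_def
      by (simp add: smult_r_distr smult_assoc1[symmetric] R.m_comm M.a_assoc)
    also have "\<dots> = u \<oplus>\<^bsub>M\<^esub> (r \<odot>\<^bsub>M\<^esub> \<beta> s t \<oplus>\<^bsub>M\<^esub> \<beta> r (s \<otimes> t))"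
      using cocycle x y z by simp
    also have "\<dots> = r \<odot>\<^bsub>M\<^esub> (s \<odot>\<^bsub>M\<^esub> c \<oplus>\<^bsub>M\<^esub> t \<odot>\<^bsub>M\<^esub> b \<oplus>\<^bsub>M\<^esub> \<beta> s t) \<oplus>\<^bsub>M\<^esub> (s \<otimes> t) \<odot>\<^bsub>M\<^esub> a \<oplus>\<^bsub>M\<^esub> \<beta> r (s \<otimes> t)"
      using x y z \<beta>c unfolding u_def
      by (simp add: smult_r_distr smult_assoc1[symmetric] M.a_ac)
    finally show ?thesis using x y z by (simp add: R.m_assoc)
  qed
  have distr: "(x \<oplus>\<^bsub>?S\<^esub> y) \<otimes>\<^bsub>?S\<^esub> z = x \<otimes>\<^bsub>?S\<^esub> z \<oplus>\<^bsub>?S\<^esub> y \<otimes>\<^bsub>?S\<^esub> z"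
    if xyz: "x \<in> carrier ?S" "y \<in> carrier ?S" "z \<in> carrier ?S" for x y z
  proof -
    obtain r a where x: "x = (r, a)" "r \<in> carrier R" "a \<in> carrier M" using xyz Ec by auto
    obtain s b where y: "y = (s, b)" "s \<in> carrier R" "b \<in> carrier M" using xyz Ec by auto
    obtain t c where z: "z = (t, c)" "t \<in> carrier R" "c \<in> carrier M" using xyz Ec by auto
    show ?thesis
      using x y z \<beta>c by (simp add: R.l_distr smult_l_distr smult_r_distr add M.a_ac)
  qed
  have "abelian_group ?S"
  proof (rule abelian_groupI)
    fix x assume "x \<in> carrier ?S"
    then obtain r e where x: "x = (r, e)" "r \<in> carrier R" "e \<in> E" by auto
    then show "\<exists>y\<in>carrier ?S. y \<oplus>\<^bsub>?S\<^esub> x = \<zero>\<^bsub>?S\<^esub>"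
      using Es(3) Ec by (intro bexI[of _ "(\<ominus> r, \<ominus>\<^bsub>M\<^esub> e)"]) (simp_all add: R.l_neg M.l_neg)
  qed (auto simp: Es Ec E0 R.a_ac M.a_ac)
  moreover have "comm_monoid ?S"
  proof (rule comm_monoidI)
    show "x \<otimes>\<^bsub>?S\<^esub> y \<in> carrier ?S" if "x \<in> carrier ?S" "y \<in> carrier ?S" for x y
      using that closed by auto
    show "\<one>\<^bsub>?S\<^esub> \<otimes>\<^bsub>?S\<^esub> x = x" if "x \<in> carrier ?S" for x
      using that Ec one by auto
  qed (use E0 comm assoc in simp_all)
  ultimately show ?thesis using distr by (rule cringI)
qed

text \<open>\<open>gorenstein_colength\<close> sees only rings of lists. Moving the whole cover
  along the coding \<open>f\<close> replaces proofs that length and the Gorenstein property are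
  invariant under isomorphism.\<close>

lemma gorenstein_cover_transport:
  assumes cover: "gorenstein_cover R \<mm> W w0 S I p \<rho> \<Lambda>" and f: "inj_on f (carrier S)"
  shows "gorenstein_cover R \<mm> W w0 (image_ring f S) I
    (\<lambda>x. p (inv_into (carrier S) f x)) (\<lambda>r. f (\<rho> r)) (\<lambda>x. \<Lambda> (inv_into (carrier S) f x))"
proof -
  interpret gorenstein_cover R \<mm> W w0 S I p \<rho> \<Lambda> by fact
  let ?S' = "image_ring f S" and ?g = "inv_into (carrier S) f"
  have gf [simp]: "?g (f s) = s" if "s \<in> carrier S" for s using f that by simp
  note iso = inj_imp_image_ring_iso[OF f]
  have hom: "f \<in> ring_hom S ?S'" using iso by (simp add: ring_iso_def)
  note fs = ring_hom_mult[OF hom] ring_hom_add[OF hom] ring_hom_one[OF hom]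
  have carr: "carrier ?S' = f ` carrier S" by (rule image_ring_carrier)
  have zero: "\<zero>\<^bsub>?S'\<^esub> = f \<zero>\<^bsub>S\<^esub>" by (rule image_ring_zero)
  have "cring (?S' \<lparr>zero := f \<zero>\<^bsub>S\<^esub>\<rparr>)" by (rule S.ring_iso_imp_img_cring[OF iso])
  then have S': "cring ?S'" unfolding zero[symmetric] by simp
  have sub: "x \<in> carrier ?S' \<Longrightarrow> \<exists>s\<in>carrier S. x = f s" for x unfolding carr by blast
  show ?thesis
  proof (intro gorenstein_cover.intro gorenstein_cover_axioms.intro S' R.dualizing_module_axioms)
    show "(\<lambda>x. p (?g x)) \<in> ring_hom ?S' R"
    proof (rule ring_hom_memI)
      fix x y assume "x \<in> carrier ?S'" "y \<in> carrier ?S'"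
      then obtain s t where st: "s \<in> carrier S" "x = f s" "t \<in> carrier S" "y = f t" using sub by meson
      then show "p (?g x) \<in> carrier R" by simp
      show "p (?g (x \<otimes>\<^bsub>?S'\<^esub> y)) = p (?g x) \<otimes>\<^bsub>R\<^esub> p (?g y)"
        using st by (simp flip: fs)
      show "p (?g (x \<oplus>\<^bsub>?S'\<^esub> y)) = p (?g x) \<oplus>\<^bsub>R\<^esub> p (?g y)"
        using st by (simp flip: fs)
    qed (simp flip: fs)
    show "(\<lambda>x. p (?g x)) ` carrier ?S' = carrier R"
      unfolding carr image_image p_surj[symmetric] by simp
    show "(\<lambda>r. f (\<rho> r)) \<in> ring_hom R ?S'"
      using ring_hom_trans[OF \<rho>_hom hom] by (simp add: comp_def)
    show "f (\<rho> x) = \<zero>\<^bsub>?S'\<^esub>" if "x \<in> I" for x using \<rho>_I[OF that] zero by simp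
    show "p (?g (f (\<rho> r))) \<ominus>\<^bsub>R\<^esub> r \<in> I" if "r \<in> carrier R" for r using p_\<rho>[OF that] that by simp
  next
    fix x assume "x \<in> carrier ?S'"
    then obtain s where s: "s \<in> carrier S" "x = f s" using sub by blast
    then show "\<Lambda> (?g x) \<in> carrier W" by simp
    show "\<Lambda> (?g (f (\<rho> r) \<otimes>\<^bsub>?S'\<^esub> x)) = r \<odot>\<^bsub>W\<^esub> \<Lambda> (?g x)" if "r \<in> carrier R" for r
      using that s \<Lambda>_\<rho> by (simp flip: fs)
    fix y assume "y \<in> carrier ?S'"
    then obtain t where t: "t \<in> carrier S" "y = f t" using sub by blast
    show "\<Lambda> (?g (x \<oplus>\<^bsub>?S'\<^esub> y)) = \<Lambda> (?g x) \<oplus>\<^bsub>W\<^esub> \<Lambda> (?g y)"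
      using s t \<Lambda>_add by (simp flip: fs)
    show "\<Lambda> (?g (x \<otimes>\<^bsub>?S'\<^esub> y)) = p (?g x) \<odot>\<^bsub>W\<^esub> \<Lambda> (?g y)" if "p (?g y) = \<zero>\<^bsub>R\<^esub>"
      using that s t \<Lambda>_ker by (simp flip: fs)
  next
    fix x assume "x \<in> carrier ?S'"
      and nd: "\<And>y. y \<in> carrier ?S' \<Longrightarrow> \<Lambda> (?g (y \<otimes>\<^bsub>?S'\<^esub> x)) = \<zero>\<^bsub>W\<^esub>"
    then obtain s where s: "s \<in> carrier S" "x = f s" using sub by blast
    have "s = \<zero>\<^bsub>S\<^esub>"
    proof (rule nondegenerate[OF s(1)])
      fix t assume t: "t \<in> carrier S"
      then show "\<Lambda> (t \<otimes>\<^bsub>S\<^esub> s) = \<zero>\<^bsub>W\<^esub>" using nd[of "f t"] s carr by (simp flip: fs)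
    qed
    then show "x = \<zero>\<^bsub>?S'\<^esub>" using s zero by simp
  qed (use I_ideal I_maximal in auto)
qed

section \<open>The cover of a ring with a self-dual ideal\<close>

text \<open>\<open>\<tau> r\<close> is the only element of \<open>T\<close> in the coset of
  \<open>r\<close>. Uniqueness yields all the laws: it suffices that the proposed value lies in
  \<open>T\<close> and is congruent to the argument modulo \<open>I\<close>.\<close>

lemma (in cring) algebra_retract_retraction:
  assumes I: "ideal I R" and T: "algebra_retract R I T"
  shows "\<exists>\<tau>\<in>ring_hom R R. (\<forall>r\<in>carrier R. \<tau> r \<ominus> r \<in> I \<and> \<tau> (\<tau> r) = \<tau> r) \<and> (\<forall>x\<in>I. \<tau> x = \<zero>)"
proof -
  interpret I: ideal I R by fact
  have sub: "subring T R" and iso: "(\<lambda>t. I +> t) \<in> ring_iso (R\<lparr>carrier := T\<rparr>) (R Quot I)"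
    using T by (auto simp: algebra_retract_def)
  have bij: "bij_betw (\<lambda>t. I +> t) T (carrier (R Quot I))"
    using iso by (simp add: ring_iso_def)
  have Tc: "t \<in> carrier R" if "t \<in> T" for t using subringE(1)[OF sub] that by blast
  define \<tau> where "\<tau> = (\<lambda>r. inv_into T (\<lambda>t. I +> t) (I +> r))"
  have coset: "I +> r \<in> (\<lambda>t. I +> t) ` T" if "r \<in> carrier R" for r
  proof -
    have "I +> r \<in> carrier (R Quot I)" using that by (auto simp: FactRing_def A_RCOSETS_def')
    then show ?thesis using bij by (simp add: bij_betw_def)
  qed
  have \<tau>T: "\<tau> r \<in> T" if "r \<in> carrier R" for r
    unfolding \<tau>_def using coset[OF that] by (rule inv_into_into)
  have \<tau>c: "\<tau> r \<in> carrier R" if "r \<in> carrier R" for r using Tc[OF \<tau>T[OF that]] .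
  have \<tau>I: "\<tau> r \<ominus> r \<in> I" if "r \<in> carrier R" for r
  proof -
    have "I +> \<tau> r = I +> r" unfolding \<tau>_def using coset[OF that] by (rule f_inv_into_f)
    then show ?thesis using quotient_eq_iff_same_a_r_cos[OF I \<tau>c[OF that] that] by simp
  qed
  have unique: "\<tau> r = t" if r: "r \<in> carrier R" and t: "t \<in> T" "t \<ominus> r \<in> I" for r t
  proof -
    have "I +> r = I +> t" using quotient_eq_iff_same_a_r_cos[OF I Tc[OF t(1)] r] t(2) by simp
    then show ?thesis
      using inv_into_f_f[OF bij_betw_imp_inj_on[OF bij] t(1)] by (simp add: \<tau>_def)
  qed
  have minus_I: "a \<ominus> b \<in> I" if "a \<in> I" "b \<in> I" for a b
    using that I.a_closed I.a_inv_closed by (simp add: minus_eq)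
  have "\<tau> \<in> ring_hom R R"
  proof (rule ring_hom_memI)
    fix r s assume r: "r \<in> carrier R" and s: "s \<in> carrier R"
    note c = \<tau>c[OF r] \<tau>c[OF s]
    show "\<tau> r \<in> carrier R" by fact
    have "\<tau> r \<otimes> \<tau> s \<ominus> r \<otimes> s = \<tau> r \<otimes> (\<tau> s \<ominus> s) \<oplus> (\<tau> r \<ominus> r) \<otimes> s"
      using r s c by algebra
    also have "\<dots> \<in> I"
      using I.I_l_closed[OF \<tau>I[OF s] c(1)] I.I_r_closed[OF \<tau>I[OF r] s] by (rule I.a_closed)
    finally show "\<tau> (r \<otimes> s) = \<tau> r \<otimes> \<tau> s"
      using r s subringE(6)[OF sub \<tau>T \<tau>T] by (intro unique) simp_all
    have "(\<tau> r \<oplus> \<tau> s) \<ominus> (r \<oplus> s) = (\<tau> r \<ominus> r) \<oplus> (\<tau> s \<ominus> s)"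
      using r s c by algebra
    also have "\<dots> \<in> I" using \<tau>I[OF r] \<tau>I[OF s] by (rule I.a_closed)
    finally show "\<tau> (r \<oplus> s) = \<tau> r \<oplus> \<tau> s"
      using r s subringE(7)[OF sub \<tau>T \<tau>T] by (intro unique) simp_all
  next
    show "\<tau> \<one> = \<one>"
      using subringE(3)[OF sub] I.zero_closed by (intro unique) (simp_all add: minus_eq r_neg)
  qed
  moreover have "\<tau> (\<tau> r) = \<tau> r" if "r \<in> carrier R" for r
    using \<tau>T[OF that] \<tau>c[OF that] I.zero_closed by (intro unique) (simp_all add: minus_eq r_neg)
  moreover have "\<tau> x = \<zero>" if "x \<in> I" for x
    using that I.Icarr I.a_inv_closed subringE(2)[OF sub] by (intro unique) (simp_all add: minus_eq)
  ultimately show ?thesis using \<tau>I by blast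
qed

context dualizing_module
begin

text \<open>If \<open>I\<close> contained a unit, it would contain one, and \<open>\<tau>\<close>
  would send one both to zero and to one.\<close>

lemma retract_ideal_le_maximal:
  assumes I: "ideal I R" and T: "algebra_retract R I T"
  shows "I \<subseteq> \<mm>"
proof
  fix x assume x: "x \<in> I"
  show "x \<in> \<mm>"
  proof (rule ccontr)
    assume "x \<notin> \<mm>"
    then obtain v where v: "v \<in> carrier R" "v \<otimes> x = \<one>"
      using unit_inverse[OF ideal.Icarr[OF I x]] by blast
    then have one: "\<one> \<in> I" using ideal.I_l_closed[OF I x v(1)] by simp
    obtain \<tau> where \<tau>: "\<tau> \<in> ring_hom R R" "\<forall>x\<in>I. \<tau> x = \<zero>"
      using algebra_retract_retraction[OF I T] by blast
    have "\<one> = \<zero>" using ring_hom_one[OF \<tau>(1)] \<tau>(2) one by simp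
    moreover have "\<zero> \<in> \<mm>" by (rule additive_subgroup.zero_closed[OF is_additive_subgroup])
    ultimately show False using one_notin_maximal by simp
  qed
qed

text \<open>Linearity is demanded in the first argument only; symmetry carries it over to the
  second.\<close>

definition nondegenerate_symmetric_form :: "'a set \<Rightarrow> ('a \<Rightarrow> 'a \<Rightarrow> 'b) \<Rightarrow> bool" where
  "nondegenerate_symmetric_form I B \<longleftrightarrow>
     (\<forall>x\<in>I. \<forall>y\<in>I. B x y \<in> carrier W) \<and>
     (\<forall>x\<in>I. \<forall>y\<in>I. \<forall>z\<in>I. B (x \<oplus> y) z = B x z \<oplus>\<^bsub>W\<^esub> B y z) \<and>
     (\<forall>r\<in>carrier R. \<forall>x\<in>I. \<forall>y\<in>I. B (r \<otimes> x) y = r \<odot>\<^bsub>W\<^esub> B x y) \<and>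
     (\<forall>x\<in>I. \<forall>y\<in>I. B x y = B y x) \<and>
     (\<forall>x\<in>I. (\<forall>y\<in>I. B x y = \<zero>\<^bsub>W\<^esub>) \<longrightarrow> x = \<zero>)"

text \<open>
  The isomorphism of \<open>I\<close> with its dual is a bilinear form that is symmetric as soon as one argument
  lies in \<open>I\<^sup>2\<close>.  Adding the transposed form makes it symmetric, and this stays nondegenerate because
  the radical, if nonzero, would contain a socle element of \<open>R\<close>; that element lies in
  \<open>(0 : I) \<subseteq> I\<^sup>2\<close>, where the new form is twice the old one.
\<close>

lemma symmetric_form:
  assumes I: "ideal I R" "I \<subseteq> \<mm>" and dual: "self_dual_ideal R W I"
    and ann: "annihilator R I \<subseteq> I \<cdot>\<^bsub>R\<^esub> I" and two: "\<one> \<oplus> \<one> \<in> Units R"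
  shows "\<exists>B. nondegenerate_symmetric_form I B"
proof -
  interpret I: ideal I R by fact
  note Ic = I.Icarr
  obtain f where f: "f \<in> mod_hom R (ideal_module R I) (Hom_module R (ideal_module R I) W)"
    and inj: "inj_on f I"
    using dual by (auto simp: self_dual_ideal_def mod_iso_def bij_betw_def ideal_module_def)
  have fc: "f x y \<in> carrier W" if "x \<in> I" "y \<in> I" for x y
    using mod_homD(1)[OF f, of x] that by (auto simp: ideal_module_def Hom_module_def mod_hom_def)
  have f_radd: "f x (y \<oplus> z) = f x y \<oplus>\<^bsub>W\<^esub> f x z" if "x \<in> I" "y \<in> I" "z \<in> I" for x y z
    using mod_homD(1)[OF f, of x] that by (auto simp: ideal_module_def Hom_module_def mod_hom_def)
  have f_rsm: "f x (r \<otimes> y) = r \<odot>\<^bsub>W\<^esub> f x y" if "r \<in> carrier R" "x \<in> I" "y \<in> I" for r x y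
    using mod_homD(1)[OF f, of x] that by (auto simp: ideal_module_def Hom_module_def mod_hom_def)
  have f_ladd: "f (x \<oplus> y) z = f x z \<oplus>\<^bsub>W\<^esub> f y z" if "x \<in> I" "y \<in> I" "z \<in> I" for x y z
    using mod_homD(2)[OF f, of x y] that by (simp add: ideal_module_def Hom_module_def)
  have f_lsm: "f (r \<otimes> x) y = r \<odot>\<^bsub>W\<^esub> f x y" if "r \<in> carrier R" "x \<in> I" "y \<in> I" for r x y
    using mod_homD(3)[OF f, of r x] that by (simp add: ideal_module_def Hom_module_def)
  have f_nondeg: "x = \<zero>" if x: "x \<in> I" and z: "\<And>y. y \<in> I \<Longrightarrow> f x y = \<zero>\<^bsub>W\<^esub>" for x
  proof -
    have z0: "f \<zero> y = \<zero>\<^bsub>W\<^esub>" if y: "y \<in> I" for y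
      using f_lsm[of \<zero> x y] x y Ic fc by simp
    have ext: "f u \<in> extensional I" if "u \<in> I" for u
      using mod_homD(1)[OF f, of u] that by (simp add: ideal_module_def Hom_module_def)
    \<comment> \<open>Injectivity of \<open>f\<close> concerns functions, so agreement on
      \<open>I\<close> is first turned into equality, which extensionality allows.\<close>
    have "f x = f \<zero>"
      by (rule extensionalityI[OF ext[OF x] ext[OF I.zero_closed]]) (simp add: z z0)
    then show ?thesis using inj_onD[OF inj _ x I.zero_closed] by simp
  qed
  have f_sym: "f z y = f y z" if z: "z \<in> I \<cdot>\<^bsub>R\<^esub> I" and y: "y \<in> I" for z y
  proof -
    \<comment> \<open>For a product, scalars pass between the arguments: f(ij, y) = f(j, yi) = f(yj,
      i) = f(y, ji), each of \<open>i\<close>, \<open>j\<close>, \<open>y\<close> serving both as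
      scalar and as argument. Membership in \<open>I\<close> is carried along for the case of
      sums.\<close>
    have "z \<in> I \<and> f z y = f y z"
      using z
    proof induction
      case (prod i j)
      have c: "i \<in> carrier R" "j \<in> carrier R" "y \<in> carrier R" using prod y Ic by auto
      have "f (i \<otimes> j) y = i \<odot>\<^bsub>W\<^esub> f j y" using f_lsm c prod y by simp
      also have "\<dots> = f j (i \<otimes> y)" using f_rsm c prod y by simp
      also have "\<dots> = f j (y \<otimes> i)" using c m_comm by simp
      also have "\<dots> = f (y \<otimes> j) i" using f_rsm[OF c(3), of j i] f_lsm[OF c(3), of j i] prod by simp
      also have "\<dots> = f (j \<otimes> y) i" using c m_comm by simp
      also have "\<dots> = j \<odot>\<^bsub>W\<^esub> f y i" using f_lsm c prod y by simp
      also have "\<dots> = f y (j \<otimes> i)" using f_rsm c prod y by simp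
      also have "\<dots> = f y (i \<otimes> j)" using c m_comm by simp
      finally show ?case using I.I_l_closed[OF prod(2) c(1)] by simp
    next
      case (sum s t)
      then show ?case using y f_ladd f_radd I.a_closed by simp
    qed
    then show ?thesis by simp
  qed
  define B where "B = (\<lambda>x y. f x y \<oplus>\<^bsub>W\<^esub> f y x)"
  have Bsm: "B (r \<otimes> x) y = r \<odot>\<^bsub>W\<^esub> B x y" if "r \<in> carrier R" "x \<in> I" "y \<in> I" for r x y
    using that f_lsm f_rsm fc by (simp add: B_def W.smult_r_distr)
  have "nondegenerate_symmetric_form I B"
    unfolding nondegenerate_symmetric_form_def
  proof (intro conjI ballI impI)
    fix x y assume x: "x \<in> I" and y: "y \<in> I"
    show "B x y \<in> carrier W" using x y fc by (simp add: B_def)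
    show "B (x \<oplus> y) z = B x z \<oplus>\<^bsub>W\<^esub> B y z" if "z \<in> I" for z
      using x y that f_ladd f_radd fc by (simp add: B_def W.a_ac)
    show "B x y = B y x" using x y fc by (simp add: B_def W.a_comm)
    show "B (r \<otimes> x) y = r \<odot>\<^bsub>W\<^esub> B x y" if "r \<in> carrier R" for r
      using that x y by (rule Bsm)
  next
    fix x assume x: "x \<in> I" and rad: "\<forall>y\<in>I. B x y = \<zero>\<^bsub>W\<^esub>"
    show "x = \<zero>"
    proof (rule ccontr)
      assume "x \<noteq> \<zero>"
      then obtain r where r: "r \<in> carrier R" "r \<otimes> x \<noteq> \<zero>"
        and soc: "\<forall>y\<in>\<mm>. y \<otimes> (r \<otimes> x) = \<zero>"
        using exists_socle_multiple[OF Ic[OF x]] by blast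
      define z where "z = r \<otimes> x"
      have zI: "z \<in> I" unfolding z_def using x r(1) by (rule I.I_l_closed)
      have "z \<in> annihilator R I"
        unfolding annihilator_def
      proof (intro CollectI conjI ballI)
        show "z \<in> carrier R" using zI by (rule Ic)
        fix y assume y: "y \<in> I"
        have "y \<otimes> z = \<zero>" using soc y I(2) by (auto simp: z_def)
        then show "z \<otimes> y = \<zero>" using m_comm[OF Ic[OF zI] Ic[OF y]] by simp
      qed
      then have zII: "z \<in> I \<cdot>\<^bsub>R\<^esub> I" using ann by blast
      obtain h where h: "h \<in> carrier R" "h \<otimes> (\<one> \<oplus> \<one>) = \<one>" using two by (auto simp: Units_def)
      have "f z y = \<zero>\<^bsub>W\<^esub>" if y: "y \<in> I" for y
      proof -
        have "B z y = \<zero>\<^bsub>W\<^esub>" unfolding z_def using Bsm[OF r(1) x y] rad y r(1) by simp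
        then have "(\<one> \<oplus> \<one>) \<odot>\<^bsub>W\<^esub> f z y = \<zero>\<^bsub>W\<^esub>"
          using f_sym[OF zII y] fc[OF zI y] by (simp add: B_def W.smult_l_distr)
        then have "h \<odot>\<^bsub>W\<^esub> ((\<one> \<oplus> \<one>) \<odot>\<^bsub>W\<^esub> f z y) = \<zero>\<^bsub>W\<^esub>" using h by simp
        then show ?thesis
          using W.smult_assoc1[OF h(1) _ fc[OF zI y], of "\<one> \<oplus> \<one>"] h(2) fc[OF zI y] by simp
      qed
      then have "z = \<zero>" by (rule f_nondeg[OF zI])
      then show False using r(2) by (simp add: z_def)
    qed
  qed
  then show ?thesis by blast
qed

text \<open>
  \<open>\<pi>\<close> retracts \<open>W\<close>, viewed as an \<open>R\<close>-module through \<open>\<tau>\<close>, onto the submodule killed by \<open>I\<close>: the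
  restriction along \<open>\<tau>\<close> does not change the \<open>R\<close>-action on that submodule, so its inclusion extends.
\<close>

lemma retraction_onto_annihilated:
  assumes I: "ideal I R" and \<tau>: "\<tau> \<in> ring_hom R R" "\<And>r. r \<in> carrier R \<Longrightarrow> \<tau> r \<ominus> r \<in> I"
      "\<And>x. x \<in> I \<Longrightarrow> \<tau> x = \<zero>"
    and E: "E = {w \<in> carrier W. \<forall>x\<in>I. x \<odot>\<^bsub>W\<^esub> w = \<zero>\<^bsub>W\<^esub>}"
  shows "submodule E R W"
    and "\<And>r e. r \<in> carrier R \<Longrightarrow> e \<in> E \<Longrightarrow> \<tau> r \<odot>\<^bsub>W\<^esub> e = r \<odot>\<^bsub>W\<^esub> e"
    and "\<exists>\<pi>. (\<forall>w\<in>carrier W. \<pi> w \<in> E) \<and>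
      (\<forall>w\<in>carrier W. \<forall>u\<in>carrier W. \<pi> (w \<oplus>\<^bsub>W\<^esub> u) = \<pi> w \<oplus>\<^bsub>W\<^esub> \<pi> u) \<and>
      (\<forall>r\<in>carrier R. \<forall>w\<in>carrier W. \<pi> (\<tau> r \<odot>\<^bsub>W\<^esub> w) = r \<odot>\<^bsub>W\<^esub> \<pi> w) \<and> (\<forall>e\<in>E. \<pi> e = e)"
proof -
  have Ic: "x \<in> carrier R" if "x \<in> I" for x using ideal.Icarr[OF I that] .
  have Ec: "e \<in> carrier W" if "e \<in> E" for e using that E by simp
  show subE: "submodule E R W"
  proof (rule W.submoduleI)
    show "r \<odot>\<^bsub>W\<^esub> e \<in> E" if r: "r \<in> carrier R" and e: "e \<in> E" for r e
      using r e Ic W.smult_commute[OF Ic r Ec[OF e]] by (auto simp: E)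
  qed (use Ic in \<open>auto simp: E W.smult_r_distr W.smult_r_minus\<close>)
  show \<tau>E: "\<tau> r \<odot>\<^bsub>W\<^esub> e = r \<odot>\<^bsub>W\<^esub> e" if r: "r \<in> carrier R" and e: "e \<in> E" for r e
  proof -
    have tc: "\<tau> r \<in> carrier R" using \<tau>(1) r by (rule ring_hom_closed)
    have "(\<tau> r \<ominus> r) \<odot>\<^bsub>W\<^esub> e = \<zero>\<^bsub>W\<^esub>" using \<tau>(2)[OF r] e E by simp
    moreover have "\<tau> r = (\<tau> r \<ominus> r) \<oplus> r" using r tc by (simp add: minus_eq a_assoc l_neg)
    ultimately show ?thesis
      using W.smult_l_distr[of "\<tau> r \<ominus> r" r e] r tc Ec[OF e] by simp
  qed
  let ?N = "restrict_scalars \<tau> W" and ?M = "W\<lparr>carrier := E\<rparr>"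
  have M: "module R ?M" by (rule submodule.submodule_is_module[OF subE W.module_axioms])
  have N: "module R ?N" by (rule restrict_scalars_module[OF is_cring \<tau>(1) W.module_axioms])
  have i: "(\<lambda>e. e) \<in> mod_hom R ?M ?N" using Ec \<tau>E by (auto simp: mod_hom_def)
  have inj: "inj_on (\<lambda>e. e) (carrier ?M)" by simp
  have g: "(\<lambda>e. e) \<in> mod_hom R ?M W" using Ec by (auto simp: mod_hom_def)
  obtain \<pi> where \<pi>: "\<pi> \<in> mod_hom R ?N W" and \<pi>E: "\<And>e. e \<in> E \<Longrightarrow> \<pi> e = e"
    using injective_module_extension[OF injective M N i inj g] by auto
  have \<pi>s: "w \<in> carrier W \<Longrightarrow> \<pi> w \<in> carrier W"
    "w \<in> carrier W \<Longrightarrow> u \<in> carrier W \<Longrightarrow> \<pi> (w \<oplus>\<^bsub>W\<^esub> u) = \<pi> w \<oplus>\<^bsub>W\<^esub> \<pi> u"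
    "r \<in> carrier R \<Longrightarrow> w \<in> carrier W \<Longrightarrow> \<pi> (\<tau> r \<odot>\<^bsub>W\<^esub> w) = r \<odot>\<^bsub>W\<^esub> \<pi> w" for w u r
    using mod_homD[OF \<pi>] by simp_all
  \<comment> \<open>\<open>I\<close> acts on the source of \<open>\<pi>\<close> through
    \<open>\<tau>\<close>, that is by zero, so linearity makes \<open>I\<close> kill the values of
    \<open>\<pi>\<close>.\<close>
  have "\<pi> w \<in> E" if w: "w \<in> carrier W" for w
  proof -
    have "x \<odot>\<^bsub>W\<^esub> \<pi> w = \<zero>\<^bsub>W\<^esub>" if x: "x \<in> I" for x
      using \<pi>s(3)[OF Ic[OF x] w] \<tau>(3)[OF x] w mod_hom_zero[OF N W.module_axioms \<pi>] by simp
    then show ?thesis using \<pi>s(1)[OF w] E by simp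
  qed
  then show "\<exists>\<pi>. (\<forall>w\<in>carrier W. \<pi> w \<in> E) \<and>
      (\<forall>w\<in>carrier W. \<forall>u\<in>carrier W. \<pi> (w \<oplus>\<^bsub>W\<^esub> u) = \<pi> w \<oplus>\<^bsub>W\<^esub> \<pi> u) \<and>
      (\<forall>r\<in>carrier R. \<forall>w\<in>carrier W. \<pi> (\<tau> r \<odot>\<^bsub>W\<^esub> w) = r \<odot>\<^bsub>W\<^esub> \<pi> w) \<and> (\<forall>e\<in>E. \<pi> e = e)"
    using \<pi>s \<pi>E by (intro exI[of _ \<pi>]) simp
qed

text \<open>In the pairing of \<open>(r, e)\<close> with \<open>(s, d)\<close> under
  \<open>snd\<close>, the cross terms between \<open>R\<close> and \<open>E\<close> detect
  \<open>e\<close> and the class of \<open>r\<close> modulo \<open>I\<close>, and the term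
  \<open>\<beta>\<close> detects \<open>r\<close> inside \<open>I\<close>.\<close>

lemma exists_gorenstein_cover:
  assumes I: "ideal I R" and dual: "self_dual_ideal R W I"
    and ann: "annihilator R I \<subseteq> I \<cdot>\<^bsub>R\<^esub> I" and T: "algebra_retract R I T"
    and two: "\<one> \<oplus> \<one> \<in> Units R"
  shows "\<exists>(S :: ('a \<times> 'b) ring) p \<rho> \<Lambda>. gorenstein_cover R \<mm> W w0 S I p \<rho> \<Lambda>"
proof -
  interpret I: ideal I R by fact
  note Ic = I.Icarr
  have Im: "I \<subseteq> \<mm>" by (rule retract_ideal_le_maximal[OF I T])
  obtain \<tau> where \<tau>: "\<tau> \<in> ring_hom R R" "\<And>r. r \<in> carrier R \<Longrightarrow> \<tau> r \<ominus> r \<in> I"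
    "\<And>r. r \<in> carrier R \<Longrightarrow> \<tau> (\<tau> r) = \<tau> r" "\<And>x. x \<in> I \<Longrightarrow> \<tau> x = \<zero>"
    using algebra_retract_retraction[OF I T] by blast
  note \<tau>s = ring_hom_mult[OF \<tau>(1)] ring_hom_add[OF \<tau>(1)] ring_hom_one[OF \<tau>(1)]
  have \<tau>c [simp]: "\<tau> r \<in> carrier R" if "r \<in> carrier R" for r using \<tau>(1) that by (rule ring_hom_closed)
  obtain B where "nondegenerate_symmetric_form I B"
    using symmetric_form[OF I Im dual ann two] by blast
  then have Bc: "\<And>x y. x \<in> I \<Longrightarrow> y \<in> I \<Longrightarrow> B x y \<in> carrier W"
    and Badd: "\<And>x y z. x \<in> I \<Longrightarrow> y \<in> I \<Longrightarrow> z \<in> I \<Longrightarrow> B (x \<oplus> y) z = B x z \<oplus>\<^bsub>W\<^esub> B y z"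
    and Bsm: "\<And>r x y. r \<in> carrier R \<Longrightarrow> x \<in> I \<Longrightarrow> y \<in> I \<Longrightarrow> B (r \<otimes> x) y = r \<odot>\<^bsub>W\<^esub> B x y"
    and Bsym: "\<And>x y. x \<in> I \<Longrightarrow> y \<in> I \<Longrightarrow> B x y = B y x"
    and Bnondeg: "\<And>x. x \<in> I \<Longrightarrow> (\<And>y. y \<in> I \<Longrightarrow> B x y = \<zero>\<^bsub>W\<^esub>) \<Longrightarrow> x = \<zero>"
    unfolding nondegenerate_symmetric_form_def by blast+
  define E where "E = {w \<in> carrier W. \<forall>x\<in>I. x \<odot>\<^bsub>W\<^esub> w = \<zero>\<^bsub>W\<^esub>}"
  note ret = retraction_onto_annihilated[OF I \<tau>(1,2,4) E_def]
  note subE = ret(1) and \<tau>E = ret(2)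
  obtain \<pi> where \<pi>E: "\<And>w. w \<in> carrier W \<Longrightarrow> \<pi> w \<in> E"
    and \<pi>add: "\<And>w u. w \<in> carrier W \<Longrightarrow> u \<in> carrier W \<Longrightarrow> \<pi> (w \<oplus>\<^bsub>W\<^esub> u) = \<pi> w \<oplus>\<^bsub>W\<^esub> \<pi> u"
    and \<pi>sm: "\<And>r w. r \<in> carrier R \<Longrightarrow> w \<in> carrier W \<Longrightarrow> \<pi> (\<tau> r \<odot>\<^bsub>W\<^esub> w) = r \<odot>\<^bsub>W\<^esub> \<pi> w"
    and \<pi>id: "\<And>e. e \<in> E \<Longrightarrow> \<pi> e = e"
    using ret(3) by blast
  note Es = W.submoduleE[OF subE]
  have Ec: "e \<in> carrier W" if "e \<in> E" for e using that by (simp add: E_def)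
  have E0: "\<zero>\<^bsub>W\<^esub> \<in> E" using Ic by (simp add: E_def)
  have \<pi>c: "\<pi> w \<in> carrier W" if "w \<in> carrier W" for w using Ec[OF \<pi>E[OF that]] .
  have \<pi>0: "\<pi> \<zero>\<^bsub>W\<^esub> = \<zero>\<^bsub>W\<^esub>" using \<pi>id[OF E0] .
  have w0E: "w0 \<in> E" using Im maximal_smult_w0 by (auto simp: E_def)
  define \<alpha> where "\<alpha> = (\<lambda>r. r \<ominus> \<tau> r)"
  have \<alpha>I: "\<alpha> r \<in> I" if r: "r \<in> carrier R" for r
  proof -
    have "\<alpha> r = \<ominus> (\<tau> r \<ominus> r)" using r by (simp add: \<alpha>_def minus_eq minus_add a_comm)
    then show ?thesis using I.a_inv_closed[OF \<tau>(2)[OF r]] by simp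
  qed
  have \<alpha>c: "\<alpha> r \<in> carrier R" if "r \<in> carrier R" for r using Ic[OF \<alpha>I[OF that]] .
  have \<alpha>add: "\<alpha> (r \<oplus> s) = \<alpha> r \<oplus> \<alpha> s" if "r \<in> carrier R" "s \<in> carrier R" for r s
    using that \<tau>c[OF that(1)] \<tau>c[OF that(2)] unfolding \<alpha>_def \<tau>s(2)[OF that] by algebra
  \<comment> \<open>Write both factors as \<open>\<tau> r \<oplus> \<alpha> r\<close> and
    \<open>\<tau> s \<oplus> \<alpha> s\<close>, expand, and drop
    \<open>\<tau> r \<otimes> \<tau> s\<close>.\<close>
  have \<alpha>mult: "\<alpha> (r \<otimes> s) = (\<tau> r \<otimes> \<alpha> s \<oplus> \<tau> s \<otimes> \<alpha> r) \<oplus> \<alpha> r \<otimes> \<alpha> s"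
    if "r \<in> carrier R" "s \<in> carrier R" for r s
    using that \<tau>c[OF that(1)] \<tau>c[OF that(2)] unfolding \<alpha>_def \<tau>s(1)[OF that] by algebra
  have \<alpha>\<tau>: "\<alpha> (\<tau> r) = \<zero>" if "r \<in> carrier R" for r
    using that \<tau>(3)[OF that] by (simp add: \<alpha>_def minus_eq r_neg)
  have \<alpha>1: "\<alpha> \<one> = \<zero>" by (simp add: \<alpha>_def \<tau>s minus_eq r_neg)
  have \<alpha>id: "\<alpha> x = x" if "x \<in> I" for x using that \<tau>(4)[OF that] Ic by (simp add: \<alpha>_def minus_eq)
  have B0: "B \<zero> y = \<zero>\<^bsub>W\<^esub>" if "y \<in> I" for y
    using Bsm[of \<zero> \<zero> y] I.zero_closed that Bc by simp
  define \<beta> where "\<beta> = (\<lambda>r s. \<pi> (B (\<alpha> r) (\<alpha> s)))"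
  have \<beta>E: "\<beta> r s \<in> E" if "r \<in> carrier R" "s \<in> carrier R" for r s
    unfolding \<beta>_def using that by (intro \<pi>E Bc \<alpha>I)
  have \<beta>c: "\<beta> r s \<in> carrier W" if "r \<in> carrier R" "s \<in> carrier R" for r s
    using Ec[OF \<beta>E[OF that]] .
  have \<beta>sym: "\<beta> r s = \<beta> s r" if "r \<in> carrier R" "s \<in> carrier R" for r s
    unfolding \<beta>_def using Bsym[OF \<alpha>I[OF that(1)] \<alpha>I[OF that(2)]] by simp
  have \<beta>add: "\<beta> (r \<oplus> s) t = \<beta> r t \<oplus>\<^bsub>W\<^esub> \<beta> s t"
    if "r \<in> carrier R" "s \<in> carrier R" "t \<in> carrier R" for r s t
    using that by (simp add: \<beta>_def \<alpha>add Badd \<alpha>I \<pi>add Bc)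
  \<comment> \<open>Because the cocycle vanishes on the image of \<open>\<tau>\<close>, the map
    \<open>r \<mapsto> (\<tau> r, 0)\<close> will be multiplicative.\<close>
  have \<beta>\<tau>: "\<beta> (\<tau> r) s = \<zero>\<^bsub>W\<^esub>" if "r \<in> carrier R" "s \<in> carrier R" for r s
    using that by (simp add: \<beta>_def \<alpha>\<tau> B0 \<alpha>I \<pi>0)
  have \<beta>one: "\<beta> \<one> s = \<zero>\<^bsub>W\<^esub>" if "s \<in> carrier R" for s
    using that by (simp add: \<beta>_def \<alpha>1 B0 \<alpha>I \<pi>0)
  \<comment> \<open>In its first argument \<open>\<beta>\<close> fails to be a derivation only by
    the term with \<open>\<alpha> r \<otimes> \<alpha> s\<close>. The scalars
    \<open>\<tau> r\<close> and \<open>\<tau> s\<close> in the other two terms are of the kind that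
    \<open>\<pi>\<close> lets through, as \<open>r\<close> and \<open>s\<close>.\<close>
  have \<beta>mult: "\<beta> (r \<otimes> s) t = (r \<odot>\<^bsub>W\<^esub> \<beta> s t \<oplus>\<^bsub>W\<^esub> s \<odot>\<^bsub>W\<^esub> \<beta> r t) \<oplus>\<^bsub>W\<^esub> \<pi> (B (\<alpha> r \<otimes> \<alpha> s) (\<alpha> t))"
    if r: "r \<in> carrier R" and s: "s \<in> carrier R" and t: "t \<in> carrier R" for r s t
  proof -
    have I1: "\<tau> r \<otimes> \<alpha> s \<in> I" "\<tau> s \<otimes> \<alpha> r \<in> I" "\<alpha> r \<otimes> \<alpha> s \<in> I"
      using r s \<alpha>I \<alpha>c I.I_l_closed by simp_all
    have "B (\<alpha> (r \<otimes> s)) (\<alpha> t) =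
        (\<tau> r \<odot>\<^bsub>W\<^esub> B (\<alpha> s) (\<alpha> t) \<oplus>\<^bsub>W\<^esub> \<tau> s \<odot>\<^bsub>W\<^esub> B (\<alpha> r) (\<alpha> t)) \<oplus>\<^bsub>W\<^esub> B (\<alpha> r \<otimes> \<alpha> s) (\<alpha> t)"
      unfolding \<alpha>mult[OF r s] using I1 r s t by (simp add: Badd I.a_closed \<alpha>I Bsm[OF \<tau>c])
    then show ?thesis
      using r s t I1 unfolding \<beta>_def by (simp add: \<pi>add \<pi>sm Bc \<alpha>I)
  qed
  have cocycle: "r \<odot>\<^bsub>W\<^esub> \<beta> s t \<oplus>\<^bsub>W\<^esub> \<beta> r (s \<otimes> t) = t \<odot>\<^bsub>W\<^esub> \<beta> r s \<oplus>\<^bsub>W\<^esub> \<beta> (r \<otimes> s) t"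
    if r: "r \<in> carrier R" and s: "s \<in> carrier R" and t: "t \<in> carrier R" for r s t
  proof -
    have I1: "\<alpha> s \<otimes> \<alpha> t \<in> I" "\<alpha> r \<otimes> \<alpha> s \<in> I" using r s t \<alpha>I \<alpha>c I.I_l_closed by simp_all
    \<comment> \<open>The terms violating the derivation rule on the two sides of the cocycle
      identity coincide, by linearity and symmetry of \<open>B\<close>.\<close>
    have "B (\<alpha> s \<otimes> \<alpha> t) (\<alpha> r) = \<alpha> s \<odot>\<^bsub>W\<^esub> B (\<alpha> r) (\<alpha> t)"
      using Bsm[OF \<alpha>c[OF s] \<alpha>I[OF t] \<alpha>I[OF r]] Bsym[OF \<alpha>I[OF r] \<alpha>I[OF t]] by simp
    also have "\<dots> = B (\<alpha> s \<otimes> \<alpha> r) (\<alpha> t)"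
      using Bsm[OF \<alpha>c[OF s] \<alpha>I[OF r] \<alpha>I[OF t]] by simp
    also have "\<alpha> s \<otimes> \<alpha> r = \<alpha> r \<otimes> \<alpha> s" using m_comm[OF \<alpha>c[OF s] \<alpha>c[OF r]] .
    finally have B: "B (\<alpha> s \<otimes> \<alpha> t) (\<alpha> r) = B (\<alpha> r \<otimes> \<alpha> s) (\<alpha> t)" .
    define u where "u = \<pi> (B (\<alpha> r \<otimes> \<alpha> s) (\<alpha> t))"
    have uc: "u \<in> carrier W" unfolding u_def by (intro \<pi>c Bc I1 \<alpha>I t)
    have "\<beta> r (s \<otimes> t) = (s \<odot>\<^bsub>W\<^esub> \<beta> r t \<oplus>\<^bsub>W\<^esub> t \<odot>\<^bsub>W\<^esub> \<beta> r s) \<oplus>\<^bsub>W\<^esub> u"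
      using \<beta>sym[OF r, of "s \<otimes> t"] \<beta>mult[OF s t r] \<beta>sym[OF t r] \<beta>sym[OF s r] s t B
      by (simp add: u_def)
    moreover have "\<beta> (r \<otimes> s) t = (r \<odot>\<^bsub>W\<^esub> \<beta> s t \<oplus>\<^bsub>W\<^esub> s \<odot>\<^bsub>W\<^esub> \<beta> r t) \<oplus>\<^bsub>W\<^esub> u"
      using \<beta>mult[OF r s t] by (simp add: u_def)
    ultimately show ?thesis
      using r s t uc \<beta>c[OF s t] \<beta>c[OF r t] \<beta>c[OF r s] by (simp add: W.a_ac)
  qed
  let ?S = "twisted_extension R W E \<beta>"
  have S: "cring ?S"
    by (rule W.twisted_extension_cring[OF subE \<beta>E \<beta>sym \<beta>add \<beta>one cocycle])
  have "gorenstein_cover R \<mm> W w0 ?S I fst (\<lambda>r. (\<tau> r, \<zero>\<^bsub>W\<^esub>)) snd"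
  proof (intro gorenstein_cover.intro gorenstein_cover_axioms.intro S dualizing_module_axioms I Im)
    show "fst \<in> ring_hom ?S R" by (rule ring_hom_memI) auto
    show "fst ` carrier ?S = carrier R" using E0 by force
    show "(\<lambda>r. (\<tau> r, \<zero>\<^bsub>W\<^esub>)) \<in> ring_hom R ?S"
      by (rule ring_hom_memI) (simp_all add: \<tau>s E0 \<beta>\<tau>)
    show "(\<tau> x, \<zero>\<^bsub>W\<^esub>) = \<zero>\<^bsub>?S\<^esub>" if "x \<in> I" for x using \<tau>(4)[OF that] by simp
    show "fst (\<tau> r, \<zero>\<^bsub>W\<^esub>) \<ominus> r \<in> I" if "r \<in> carrier R" for r using \<tau>(2)[OF that] by simp
  next
    fix x assume "x \<in> carrier ?S"
    then obtain r e where x: "x = (r, e)" "r \<in> carrier R" "e \<in> E" by auto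
    then show "snd x \<in> carrier W" using Ec by simp
    show "snd ((\<tau> s, \<zero>\<^bsub>W\<^esub>) \<otimes>\<^bsub>?S\<^esub> x) = s \<odot>\<^bsub>W\<^esub> snd x" if "s \<in> carrier R" for s
      using x that Ec \<tau>E \<beta>\<tau> by simp
    fix y assume "y \<in> carrier ?S"
    then obtain s d where y: "y = (s, d)" "s \<in> carrier R" "d \<in> E" by auto
    show "snd (x \<oplus>\<^bsub>?S\<^esub> y) = snd x \<oplus>\<^bsub>W\<^esub> snd y" using x y by simp
    assume "fst y = \<zero>"
    moreover have "\<beta> r \<zero> = \<zero>\<^bsub>W\<^esub>"
      using \<beta>sym[OF x(2), of \<zero>] \<beta>\<tau>[of \<zero> r] x(2) \<tau>(4)[OF I.zero_closed] by simp
    ultimately show "snd (x \<otimes>\<^bsub>?S\<^esub> y) = fst x \<odot>\<^bsub>W\<^esub> snd y" using x y Ec by simp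
  next
    fix x assume "x \<in> carrier ?S" and nd: "\<And>y. y \<in> carrier ?S \<Longrightarrow> snd (y \<otimes>\<^bsub>?S\<^esub> x) = \<zero>\<^bsub>W\<^esub>"
    then obtain r e where x: "x = (r, e)" "r \<in> carrier R" "e \<in> E" by auto
    \<comment> \<open>Pairing with \<open>(\<one>, 0)\<close> isolates \<open>e\<close>; pairing
      with \<open>(0, d)\<close> then isolates the action of \<open>r\<close> on
      \<open>E\<close>.\<close>
    have e0: "e = \<zero>\<^bsub>W\<^esub>" using nd[of "(\<one>, \<zero>\<^bsub>W\<^esub>)"] x E0 Ec \<beta>one by simp
    have rE: "r \<odot>\<^bsub>W\<^esub> d = \<zero>\<^bsub>W\<^esub>" if d: "d \<in> E" for d
      using nd[of "(\<zero>, d)"] x d e0 Ec \<beta>\<tau>[of \<zero> r] \<tau>(4)[OF I.zero_closed] by simp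
    \<comment> \<open>\<open>E\<close> is faithful over \<open>R/I\<close>: for \<open>r\<close>
      outside \<open>I\<close>, a homomorphism \<open>\<theta>\<close> killing \<open>I\<close> with
      \<open>\<theta> r = w0\<close> has its value at one in \<open>E\<close>, and \<open>r\<close>
      does not kill that value.\<close>
    have rI: "r \<in> I"
    proof (rule ccontr)
      assume "r \<notin> I"
      interpret RM: module R "regular_module R" by (rule ideal_module_is_module[OF is_cring oneideal])
      have "submodule I R (regular_module R)"
      proof (rule RM.module_incl_imp_submodule)
        have "(regular_module R)\<lparr>carrier := I\<rparr> = ideal_module R I" by (simp add: ideal_module_def)
        then show "module R ((regular_module R)\<lparr>carrier := I\<rparr>)"
          using ideal_module_is_module[OF is_cring I] by simp
      qed (use Ic in auto)
      then obtain \<theta> where \<theta>: "\<theta> \<in> mod_hom R (regular_module R) W" "\<forall>u\<in>I. \<theta> u = \<zero>\<^bsub>W\<^esub>" "\<theta> r = w0"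
        using cogenerator[OF RM.module_axioms, of I r] \<open>r \<notin> I\<close> x(2) by auto
      have \<theta>1: "\<theta> s = s \<odot>\<^bsub>W\<^esub> \<theta> \<one>" if "s \<in> carrier R" for s
        using mod_homD(3)[OF \<theta>(1) that, of \<one>] that by simp
      have "\<theta> \<one> \<in> carrier W" using mod_homD(1)[OF \<theta>(1), of \<one>] by simp
      then have "\<theta> \<one> \<in> E" using \<theta>1[OF Ic] \<theta>(2) by (simp add: E_def)
      then have "\<theta> r = \<zero>\<^bsub>W\<^esub>" using rE \<theta>1[OF x(2)] by simp
      then show False using \<theta>(3) w0_nonzero by simp
    qed
    have "r = \<zero>"
    proof (rule Bnondeg[OF rI], rule ccontr)
      fix y assume y: "y \<in> I" and ne: "B r y \<noteq> \<zero>\<^bsub>W\<^esub>"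
      \<comment> \<open>Scaling \<open>y\<close> by \<open>s\<close> turns the nonzero value into
        \<open>w0\<close>. This lies in \<open>E\<close> because \<open>I \<subseteq> \<mm>\<close>,
        so \<open>\<pi>\<close> fixes it and cannot hide it.\<close>
      obtain s where s: "s \<in> carrier R" "s \<odot>\<^bsub>W\<^esub> B r y = w0" using essential[OF Bc[OF rI y] ne] by blast
      have sy: "s \<otimes> y \<in> I" using y s(1) by (rule I.I_l_closed)
      have "B (s \<otimes> y) r = w0" using Bsm[OF s(1) y rI] Bsym[OF rI y] s(2) by simp
      moreover have "\<beta> (s \<otimes> y) r = \<zero>\<^bsub>W\<^esub>"
        using nd[of "(s \<otimes> y, \<zero>\<^bsub>W\<^esub>)"] x e0 E0 Ic[OF sy] \<beta>c[OF Ic[OF sy] x(2)] by simp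
      ultimately have "w0 = \<zero>\<^bsub>W\<^esub>" using \<alpha>id[OF sy] \<alpha>id[OF rI] \<pi>id[OF w0E] by (simp add: \<beta>_def)
      then show False using w0_nonzero by simp
    qed
    then show "x = \<zero>\<^bsub>?S\<^esub>" using x e0 by simp
  qed
  then show ?thesis by blast
qed

end

theorem theorem4p7:
  fixes R :: "'a ring" and \<mm> \<aa> T :: "'a set" and \<omega> :: "('a, 'b) module"
  assumes "artinian_local_ring R \<mm>"
    and "canonical_module R \<mm> \<omega>"
    and "self_dual_ideal R \<omega> \<aa>"
    and "annihilator R \<aa> \<subseteq> \<aa> \<cdot>\<^bsub>R\<^esub> \<aa>"
    and "algebra_retract R \<aa> T"
    and "\<one>\<^bsub>R\<^esub> \<oplus>\<^bsub>R\<^esub> \<one>\<^bsub>R\<^esub> \<in> Units R"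
  shows "gorenstein_colength R \<le> ring_length (R Quot \<aa>)"
proof (cases "ring_length (R Quot \<aa>)")
  case infinity
  then show ?thesis by simp
next
  case (enat b)
  obtain w0 where "dualizing_module R \<mm> \<omega> w0"
    using canonical_module_dualizing[OF assms(1,2)] by blast
  then interpret R: dualizing_module R \<mm> \<omega> w0 .
  have \<aa>: "ideal \<aa> R" using assms(3) by (simp add: self_dual_ideal_def)
  have b: "chains_bounded {J. ideal J R \<and> \<aa> \<subseteq> J} b"
    by (rule R.chains_bounded_above_ideal[OF \<aa>]) (simp add: enat)
  obtain S0 :: "('a \<times> 'b) ring" and p \<rho> \<Lambda> where S0: "gorenstein_cover R \<mm> \<omega> w0 S0 \<aa> p \<rho> \<Lambda>"
    using R.exists_gorenstein_cover[OF \<aa> assms(3-6)] by blast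
  interpret S0: gorenstein_cover R \<mm> \<omega> w0 S0 \<aa> p \<rho> \<Lambda> by fact
  have "\<one>\<^bsub>R\<^esub> \<noteq> \<zero>\<^bsub>R\<^esub>"
    using R.one_notin_maximal additive_subgroup.zero_closed[OF R.is_additive_subgroup] by metis
  \<comment> \<open>For the coding it is enough that the ring of pairs is Artinian local and maps
    onto \<open>R\<close>; the Gorenstein property is derived only after the transport.\<close>
  then obtain f :: "'a \<times> 'b \<Rightarrow> 'a list" where f: "inj_on f (carrier S0)"
    using artinian_local_cover_list_coding[OF S0.artinian_local[OF b] R.ring_axioms _ S0.p_hom S0.p_surj]
    by blast
  define S where "S = image_ring f S0"
  obtain p' \<rho>' \<Lambda>' where S: "gorenstein_cover R \<mm> \<omega> w0 S \<aa> p' \<rho>' \<Lambda>'"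
    unfolding S_def using gorenstein_cover_transport[OF S0 f] by blast
  interpret S: gorenstein_cover R \<mm> \<omega> w0 S \<aa> p' \<rho>' \<Lambda>' by fact
  have "gorenstein_artinian_local S" by (rule S.gorenstein[OF S.artinian_local[OF b]])
  then have "gorenstein_colength R \<le> ring_length S - ring_length R"
    unfolding gorenstein_colength_def using S.p_hom S.p_surj by (intro Inf_lower) blast
  also have "\<dots> \<le> enat b" by (rule S.ring_length_diff_le[OF b])
  finally show ?thesis by (simp add: enat)
qed

end
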